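(* Let $\alpha,\beta>0$ be such that $0<2\beta<\alpha$, let $1\le p,q\le\infty$ and $f:\mathbb{Z}\to\mathbb{R}$. (1) If $f\in\Lambda_H^{\alpha,p,q}\cap\ell_\beta$, then $(-\Delta_d)^\beta f\in\Lambda_H^{\alpha-2\beta,p,q}$. (2) If $\beta\in\mathbb{N}$ and $f\in\Lambda_H^{\alpha,p,q}$, then $\underbrace{(-\Delta_d)\circ(-\Delta_d)\circ\cdots\circ(-\Delta_d)}_{\beta\text{ times}}f\in\Lambda_H^{\alpha-2\beta,p,q}$.
   Context: $\mathbb{N}=\{1,2,\dots\}$; $[x]$ denotes the integer part of $x$; $\|\cdot\|_p$ is the norm of $\ell^p(\mathbb{Z})$. Weighted space: $\mu=\sum_{n\in\mathbb{Z}}\frac{1}{1+|n|}\delta_n$ ($\delta_n$ the Dirac measure at $n$). So $g\in\ell^q(\mathbb{Z},\mu)$ means $\sum_{n}|g(n)|^q\frac{1}{1+|n|}<\infty$ if $1\le q<\infty$, and $\ell^\infty(\mathbb{Z},\mu)=\ell^\infty(\mathbb{Z})$. The expression $\frac{f}{1+|\cdot|^\alpha}$ is the sequence $n\mapsto \frac{f(n)}{1+|n|^\alpha}$. Discrete Laplacian: $\Delta_df(n)=f(n+1)-2f(n)+f(n-1)$. Heat semigroup: $e^{t\Delta_d}f(n)=\sum_{j\in\mathbb{Z}}G(t,n-j)f(j)$, with $G(t,n)=e^{-2t}I_n(2t)$, $t>0$, $n\in\mathbb{Z}$, and $I_n$ the modified Bessel function of the first kind of order $n$. Mixed norms: for a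 function $F$ of $t>0$ with values in sequences on $\mathbb{Z}$, $\|F\|_{p,q}=\left(\int_0^\infty\|F(t)\|_p^q\frac{dt}{t}\right)^{1/q}$ for $1\le q<\infty$ and $\|F\|_{p,\infty}=\operatorname{ess\,sup}_{t>0}\|F(t)\|_p$. For $\alpha>0$, $\Lambda_H^{\alpha,p,q}$ is the set of $f:\mathbb{Z}\to\mathbb{R}$ with $\frac{f}{1+|\cdot|^\alpha}\in\ell^q(\mathbb{Z},\mu)$ and $\|t^{k-\alpha/2}\partial_t^ke^{t\Delta_d}f\|_{p,q}<\infty$, where $k=[\alpha/2]+1$. $\ell_\beta=\left\{u:\mathbb{Z}\to\mathbb{R}:\ \sum_{m\in\mathbb{Z}}\frac{|u(m)|}{(1+|m|)^{1+2\beta}}<\infty\right\}$. Positive fractional power of the discrete Laplacian, $\beta>0$ ($I$ is the identity operator): $(-\Delta_d)^\beta f(n)=\frac{1}{c_\beta}\int_0^\infty\left(e^{\tau\Delta_d}-I\right)^{[\beta]+1}f(n)\frac{d\tau}{\tau^{1+\beta}}$, $n\in\mathbb{Z}$, where $c_\beta=\int_0^\infty(e^{-\tau}-1)^{[\beta]+1}\frac{d\tau}{\tau^{1+\beta}}$ (well defined for $f\in\ell_\beta$). *)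

theory Defs
  imports "HOL-Probability.Essential_Supremum"
begin

text \<open>Extended nonnegative powers with a positive exponent; in particular the power
  of infinity is infinity and the power of zero is zero.\<close>

definition ennpowr :: "ennreal \<Rightarrow> real \<Rightarrow> ennreal" where
  "ennpowr x a = (if x = \<infinity> then \<infinity> else ennreal (enn2real x powr a))"

text \<open>The \<open>L\<^sup>p(M)\<close> norm of a function with values in \<open>[0,\<infinity>]\<close>, for an exponent
  \<open>1 \<le> p \<le> \<infinity>\<close>. All norms below are instances: \<open>\<ell>\<^sup>p(\<int>)\<close> (counting measure), the
  weighted space \<open>\<ell>\<^sup>q(\<int>,\<mu>)\<close>, and the outer norm in \<open>t\<close> (measure \<open>dt/t\<close> on \<open>(0,\<infinity>)\<close>,
  which has the same null sets as \<open>dt\<close>).\<close>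

definition Lnorm :: "'a measure \<Rightarrow> ennreal \<Rightarrow> ('a \<Rightarrow> ennreal) \<Rightarrow> ennreal" where
  "Lnorm M p g =
    (if p = \<infinity> then esssup M g
     else ennpowr (\<integral>\<^sup>+ x. ennpowr (g x) (enn2real p) \<partial>M) (1 / enn2real p))"

definition lp_norm :: "ennreal \<Rightarrow> (int \<Rightarrow> real) \<Rightarrow> ennreal" where
  "lp_norm p u = Lnorm (count_space UNIV) p (\<lambda>n. ennreal \<bar>u n\<bar>)"

definition wmeasure :: "int measure" where
  "wmeasure = point_measure UNIV (\<lambda>n. ennreal (1 / (1 + \<bar>real_of_int n\<bar>)))"

definition weighted_lq :: "ennreal \<Rightarrow> (int \<Rightarrow> real) set" where
  "weighted_lq q = {g. Lnorm wmeasure q (\<lambda>n. ennreal \<bar>g n\<bar>) < \<infinity>}"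

definition dt_over_t :: "real measure" where
  "dt_over_t = density (restrict_space lborel {0<..}) (\<lambda>t. ennreal (1 / t))"

definition mixed_norm :: "ennreal \<Rightarrow> ennreal \<Rightarrow> (real \<Rightarrow> int \<Rightarrow> real) \<Rightarrow> ennreal" where
  "mixed_norm p q F = Lnorm dt_over_t q (\<lambda>t. lp_norm p (F t))"

text \<open>Modified Bessel function of the first kind of integer order, by its power series;
  \<open>I\<^sub>-\<^sub>n = I\<^sub>n\<close> for integer \<open>n\<close>.\<close>

definition bessel_I :: "int \<Rightarrow> real \<Rightarrow> real" where
  "bessel_I n x =
    (\<Sum>k. (x / 2) ^ (2 * k + nat \<bar>n\<bar>) / (fact k * fact (k + nat \<bar>n\<bar>)))"

definition heat_kernel :: "real \<Rightarrow> int \<Rightarrow> real" where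
  "heat_kernel t n = exp (- 2 * t) * bessel_I n (2 * t)"

definition heat :: "real \<Rightarrow> (int \<Rightarrow> real) \<Rightarrow> int \<Rightarrow> real" where
  "heat t f n = (\<Sum>\<^sub>\<infinity>j. heat_kernel t (n - j) * f j)"

definition heat_deriv :: "nat \<Rightarrow> real \<Rightarrow> (int \<Rightarrow> real) \<Rightarrow> int \<Rightarrow> real" where
  "heat_deriv k t f n = (deriv ^^ k) (\<lambda>s. heat s f n) t"

definition Lambda_H :: "real \<Rightarrow> ennreal \<Rightarrow> ennreal \<Rightarrow> (int \<Rightarrow> real) set" where
  "Lambda_H \<alpha> p q =
    {f. (\<lambda>n. f n / (1 + \<bar>real_of_int n\<bar> powr \<alpha>)) \<in> weighted_lq q \<and>
        (let k = nat \<lfloor>\<alpha> / 2\<rfloor> + 1 in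
          mixed_norm p q (\<lambda>t n. t powr (real k - \<alpha> / 2) * heat_deriv k t f n) < \<infinity>)}"

definition ell :: "real \<Rightarrow> (int \<Rightarrow> real) set" where
  "ell \<beta> = {u. (\<lambda>m. \<bar>u m\<bar> / (1 + \<bar>real_of_int m\<bar>) powr (1 + 2 * \<beta>)) summable_on UNIV}"

definition discrete_laplacian :: "(int \<Rightarrow> real) \<Rightarrow> int \<Rightarrow> real" where
  "discrete_laplacian f n = f (n + 1) - 2 * f n + f (n - 1)"

definition frac_const :: "real \<Rightarrow> real" where
  "frac_const \<beta> =
    (LINT \<tau>:{0<..}|lborel. (exp (- \<tau>) - 1) ^ (nat \<lfloor>\<beta>\<rfloor> + 1) / \<tau> powr (1 + \<beta>))"

definition frac_laplacian :: "real \<Rightarrow> (int \<Rightarrow> real) \<Rightarrow> int \<Rightarrow> real" where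
  "frac_laplacian \<beta> f n =
    1 / frac_const \<beta> *
    (LINT \<tau>:{0<..}|lborel.
      ((\<lambda>g m. heat \<tau> g m - g m) ^^ (nat \<lfloor>\<beta>\<rfloor> + 1)) f n / \<tau> powr (1 + \<beta>))"

text \<open>The general norm specialises to the usual explicit expressions.\<close>

lemma weighted_lq_finite:
  assumes "q \<noteq> \<infinity>"
  shows "g \<in> weighted_lq q \<longleftrightarrow>
    (\<integral>\<^sup>+ n. ennreal (1 / (1 + \<bar>real_of_int n\<bar>)) * ennreal (\<bar>g n\<bar> powr enn2real q)
      \<partial>count_space UNIV) < \<infinity>"
  using assms
  by (auto simp: weighted_lq_def Lnorm_def wmeasure_def point_measure_def ennpowr_def
      nn_integral_density top.not_eq_extremum)

lemma esssup_eq_SUP: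
  fixes g :: "'a \<Rightarrow> ennreal"
  assumes "g \<in> borel_measurable M" and "\<And>P. (AE x in M. P x) \<longleftrightarrow> (\<forall>x. P x)"
  shows "esssup M g = (SUP x. g x)"
proof -
  have "esssup M g = Inf {z. \<forall>x. g x \<le> z}"
    using esssup_eq_AE[OF assms(1)] assms(2) by simp
  also have "\<dots> = (SUP x. g x)"
    by (intro antisym Inf_lower Inf_greatest) (auto intro: SUP_upper SUP_least)
  finally show ?thesis .
qed

lemma lp_norm_infinity: "lp_norm \<infinity> u = (SUP n. ennreal \<bar>u n\<bar>)"
  by (simp add: lp_norm_def Lnorm_def esssup_eq_SUP AE_count_space)

lemma weighted_lq_infinity: "g \<in> weighted_lq \<infinity> \<longleftrightarrow> lp_norm \<infinity> g < \<infinity>"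
proof -
  have "(AE x in wmeasure. P x) \<longleftrightarrow> (\<forall>x. P x)" for P
  proof -
    have "ennreal (1 / (1 + \<bar>real_of_int x\<bar>)) > 0" for x
      by (simp add: add_pos_nonneg)
    then show ?thesis
      unfolding wmeasure_def point_measure_def
      by (subst AE_density) (auto simp: AE_count_space)
  qed
  then have "esssup wmeasure (\<lambda>n. ennreal \<bar>g n\<bar>) = (SUP n. ennreal \<bar>g n\<bar>)"
    by (intro esssup_eq_SUP) (auto simp: wmeasure_def point_measure_def)
  then show ?thesis
    unfolding lp_norm_infinity by (simp add: weighted_lq_def Lnorm_def)
qed

lemma mixed_norm_finite_exponent:
  assumes "q \<noteq> \<infinity>" and "(\<lambda>t. lp_norm p (F t)) \<in> borel_measurable lborel"
  shows "mixed_norm p q F =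
    ennpowr (\<integral>\<^sup>+ t\<in>{0<..}. ennreal (1 / t) * ennpowr (lp_norm p (F t)) (enn2real q) \<partial>lborel)
      (1 / enn2real q)"
proof -
  have "(\<lambda>x. ennpowr x a) \<in> borel_measurable borel" for a
    unfolding ennpowr_def by measurable
  then have [measurable]: "(\<lambda>t. ennpowr (lp_norm p (F t)) (enn2real q)) \<in> borel_measurable borel"
    using assms(2) by (auto intro: measurable_compose)
  have "(\<lambda>t. ennpowr (lp_norm p (F t)) (enn2real q)) \<in> borel_measurable (restrict_space lborel {0<..})"
    by (intro measurable_restrict_space1) simp
  moreover have "(\<lambda>t. ennreal (1 / t)) \<in> borel_measurable (restrict_space lborel {0<..})"
    by (intro measurable_restrict_space1) simp
  ultimately show ?thesis
    using assms(1)
    by (simp add: mixed_norm_def Lnorm_def dt_over_t_def nn_integral_density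
        nn_integral_restrict_space)
qed

end

theory Submission
  imports Defs
begin

text \<open>On functions of exponential growth \<open>t \<mapsto> e\<^bsup>t\<Delta>\<^esup> f(n)\<close> is an entire function with derivative
  \<open>e\<^bsup>t\<Delta>\<^esup> \<Delta>f(n)\<close>, so the heat seminorm only involves \<open>t\<^bsup>k-\<alpha>/2\<^esup> \<parallel>\<Delta>\<^sup>k e\<^bsup>t\<Delta>\<^esup> f\<parallel>\<^sub>p\<close>. The kernel of
  \<open>e\<^bsup>t\<Delta>\<^esup>\<close> is the law of the difference of two Poisson variables of mean \<open>t\<close>; the variance of the
  Poisson law and the eigenfunctions \<open>e\<^bsup>cn\<^esup>\<close> give
  \<open>\<bar>\<Delta>\<^sup>L G(t,n)\<bar> \<le> C t\<^bsup>-L-1/2\<^esup> e\<^bsup>-c\<bar>n\<bar>/\<surd>t\<^esup>\<close> for \<open>t \<ge> 1\<close>.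

  Writing \<open>D\<^sub>\<tau> = e\<^bsup>\<tau>\<Delta>\<^esup> - I\<close>, the norm of \<open>D\<^sub>\<tau>\<^sup>L v\<close> is at most a multiple of
  \<open>\<integral>\<^sub>0\<^sup>\<tau> r\<^bsup>L-1\<^esup> \<parallel>\<Delta>\<^sup>L e\<^bsup>r\<Delta>\<^esup> v\<parallel> dr\<close> because \<open>r \<mapsto> \<parallel>e\<^bsup>r\<Delta>\<^esup> w\<parallel>\<close> is decreasing. This bounds the seminorm of
  \<open>(-\<Delta>)\<^sup>\<beta> f\<close> by a dilation-invariant integral operator applied to the seminorm of \<open>f\<close>, which
  Minkowski's inequality on \<open>L\<^sup>q(dt/t)\<close> controls. For the weighted condition at \<open>n\<close> one works at the
  scale \<open>T = (1 + \<bar>n\<bar>)\<^sup>2\<close>: expanding \<open>D\<^sub>T\<^sup>k\<close> writes \<open>v\<close> as \<open>\<plusminus>D\<^sub>T\<^sup>k v\<close> plus a combination of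
  \<open>e\<^bsup>iT\<Delta>\<^esup> v\<close>, \<open>1 \<le> i \<le> k\<close>. The first term is handled by Hardy's inequality, the others by the kernel
  bound and a Schur test, and the part \<open>\<tau> \<ge> T\<close> of the integral defining \<open>(-\<Delta>)\<^sup>\<beta> f\<close> by \<open>f \<in> \<ell>\<^sub>\<beta>\<close>.\<close>

section \<open>Functions of exponential growth and the heat semigroup\<close>

text \<open>Functions of the space may grow polynomially, so neither an l^p norm of f nor a Fourier
  representation is at hand; only high derivatives of the heat flow are controlled. Hence the work
  is done in one class closed under shifts, \<open>Lap\<close> and \<open>heat\<close> that contains
  polynomials and the eigenfunctions e^{cn}, |c| <= 1. Decay in |n| / sqrt t replaces Gaussian
  bounds: slopes c of order 1 / sqrt(1 + t) keep e^{t (2 cosh c - 2)} bounded. The extra factor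
  t^{-1/2} of the kernel comes from writing the point mass as the discrete gradient of a half-line
  indicator. Two facts reconcile differing orders. The order of the time derivative can be raised,
  since half of the time can be spent on one more Laplacian; this matters because [\<beta>] + 1 plus
  the order attached to \<alpha> - 2 \<beta> can exceed the order attached to \<alpha>. And the l^p
  norm dominates the sup norm, so pointwise weighted estimates are run with the sup norm. In part
  (2) the operator is a finite difference: no integral over large \<tau> arises, and the orders of
  the two seminorms match exactly.\<close>

abbreviation Lap :: "(int \<Rightarrow> real) \<Rightarrow> int \<Rightarrow> real" where
  "Lap \<equiv> discrete_laplacian"

abbreviation iabs :: "int \<Rightarrow> real" where
  "iabs n \<equiv> \<bar>real_of_int n\<bar>"

text \<open>Rate 1 leaves room for every eigenfunction e^{cn} with |c| <= 1 and for every polynomial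
  weight, while the factorials in the kernel keep all series convergent.\<close>

definition expb :: "(int \<Rightarrow> real) set" where
  "expb = {f. \<exists>C. \<forall>n. \<bar>f n\<bar> \<le> C * exp (iabs n)}"

lemma expbI: "(\<And>n. \<bar>f n\<bar> \<le> C * exp (iabs n)) \<Longrightarrow> f \<in> expb"
  by (auto simp: expb_def)

lemma expbE:
  assumes "f \<in> expb"
  obtains C where "C \<ge> 0" "\<And>n. \<bar>f n\<bar> \<le> C * exp (iabs n)"
proof -
  obtain C where C: "\<And>n. \<bar>f n\<bar> \<le> C * exp (iabs n)"
    using assms by (auto simp: expb_def)
  have "0 \<le> C" using C[of 0] by simp
  with C show ?thesis using that by blast
qed

lemma expb_shift [intro]: "f \<in> expb \<Longrightarrow> (\<lambda>n. f (n + c)) \<in> expb"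
proof (elim expbE)
  fix C assume C: "C \<ge> 0" "\<And>n. \<bar>f n\<bar> \<le> C * exp (iabs n)"
  show "(\<lambda>n. f (n + c)) \<in> expb"
  proof (rule expbI)
    fix n
    have "\<bar>f (n + c)\<bar> \<le> C * exp (iabs (n + c))" by (rule C)
    also have "\<dots> \<le> C * exp (iabs c + iabs n)"
      using C(1) by (intro mult_left_mono) auto
    finally show "\<bar>f (n + c)\<bar> \<le> (C * exp (iabs c)) * exp (iabs n)"
      by (simp add: exp_add mult_ac)
  qed
qed

lemma expb_add [intro]: "f \<in> expb \<Longrightarrow> g \<in> expb \<Longrightarrow> (\<lambda>n. f n + g n) \<in> expb"
proof (elim expbE)
  fix C D assume C: "\<And>n. \<bar>f n\<bar> \<le> C * exp (iabs n)"
    and D: "\<And>n. \<bar>g n\<bar> \<le> D * exp (iabs n)"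
  show ?thesis
    by (rule expbI[where C = "C + D"])
       (use C D in \<open>simp add: algebra_simps order_trans[OF abs_triangle_ineq add_mono]\<close>)
qed

lemma expb_cmult [intro]: "f \<in> expb \<Longrightarrow> (\<lambda>n. c * f n) \<in> expb"
proof (elim expbE)
  fix C assume C: "\<And>n. \<bar>f n\<bar> \<le> C * exp (iabs n)"
  show ?thesis
    by (rule expbI[where C = "\<bar>c\<bar> * C"])
       (use C in \<open>simp add: abs_mult mult.assoc mult_left_mono\<close>)
qed

lemma expb_diff [intro]: "f \<in> expb \<Longrightarrow> g \<in> expb \<Longrightarrow> (\<lambda>n. f n - g n) \<in> expb"
  using expb_add[of f "\<lambda>n. -1 * g n"] expb_cmult[of g "-1"] by simp

lemma expb_uminus [intro]: "f \<in> expb \<Longrightarrow> (\<lambda>n. - f n) \<in> expb"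
  using expb_cmult[of f "-1"] by simp

lemma expb_Lap [intro]: "f \<in> expb \<Longrightarrow> Lap f \<in> expb"
  unfolding discrete_laplacian_def[abs_def] using expb_shift[of f 1] expb_shift[of f "-1"]
  by (intro expb_add expb_diff expb_cmult) auto

lemma expb_Lap_pow [intro]: "f \<in> expb \<Longrightarrow> (Lap ^^ k) f \<in> expb"
  by (induction k) auto

text \<open>The heat kernel is the law of the difference of two independent Poisson variables with
  mean \<open>t\<close>.\<close>

definition poisson2 :: "real \<Rightarrow> nat \<times> nat \<Rightarrow> real" where
  "poisson2 t = (\<lambda>(a, b). exp (- 2 * t) * t ^ (a + b) / (fact a * fact b))"

lemma exp_has_sum: "((\<lambda>a. x ^ a / fact a) has_sum exp (x::real)) UNIV"
  using exp_converges[of x] summable_norm_exp[of x]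
  by (intro norm_summable_imp_has_sum) (auto simp: divide_inverse_commute scaleR_conv_of_real abs_mult power_abs)

lemma has_sum_product_nonneg:
  fixes f :: "'a \<Rightarrow> real" and g :: "'b \<Rightarrow> real"
  assumes "(f has_sum S) UNIV" "(g has_sum T) UNIV" "\<And>x. f x \<ge> 0" "\<And>x. g x \<ge> 0"
  shows "((\<lambda>(x, y). f x * g y) has_sum S * T) UNIV"
proof -
  have 1: "((\<lambda>y. (case (x, y) of (x, y) \<Rightarrow> f x * g y)) has_sum f x * T) UNIV" for x
    using has_sum_cmult_right[OF assms(2)] by simp
  have 2: "((\<lambda>x. f x * T) has_sum S * T) UNIV"
    using has_sum_cmult_left[OF assms(1)] by simp
  have "(\<lambda>(x, y). f x * g y) summable_on Sigma UNIV (\<lambda>_. UNIV)"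
    by (rule summable_on_SigmaI[OF 1 has_sum_imp_summable[OF 2]]) (use assms in auto)
  from has_sum_SigmaI[OF 1 2 this] show ?thesis by simp
qed

lemma exp2_has_sum:
  assumes "x \<ge> 0" "y \<ge> 0"
  shows "((\<lambda>(a, b). x ^ a / fact a * (y ^ b / fact b)) has_sum exp x * exp (y::real)) UNIV"
  using has_sum_product_nonneg[OF exp_has_sum[of x] exp_has_sum[of y]] assms by simp

lemma expb_le_diff:
  assumes "\<And>n. \<bar>f n\<bar> \<le> C * exp (iabs n)" "C \<ge> 0"
  shows "\<bar>f (n - int a + int b)\<bar> \<le> C * exp (iabs n) * (exp 1 ^ a * exp 1 ^ b)"
proof -
  have "\<bar>f (n - int a + int b)\<bar> \<le> C * exp (iabs (n - int a + int b))" by (rule assms)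
  also have "\<dots> \<le> C * exp (iabs n + (real a + real b))"
    using assms(2) by (intro mult_left_mono) auto
  also have "\<dots> = C * exp (iabs n) * (exp 1 ^ a * exp 1 ^ b)"
    by (simp add: exp_add exp_of_nat_mult[symmetric])
  finally show ?thesis .
qed

lemma poisson2_bound:
  assumes "\<And>n. \<bar>f n\<bar> \<le> C * exp (iabs n)" "C \<ge> 0"
  shows "(\<lambda>(a, b). \<bar>poisson2 t (a, b) * f (n - int a + int b)\<bar>) summable_on UNIV"
    and "infsum (\<lambda>(a, b). \<bar>poisson2 t (a, b) * f (n - int a + int b)\<bar>) UNIV
      \<le> exp (- 2 * t) * exp (2 * exp 1 * \<bar>t\<bar>) * C * exp (iabs n)"
proof -
  define x where "x = exp 1 * \<bar>t\<bar>"
  define h where "h = (\<lambda>(a::nat, b::nat). x ^ a / fact a * (x ^ b / fact b))"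
  define K where "K = exp (- 2 * t) * C * exp (iabs n)"
  have hs: "((\<lambda>p. K * h p) has_sum K * (exp x * exp x)) UNIV"
    unfolding h_def by (intro has_sum_cmult_right exp2_has_sum) (auto simp: x_def)
  have le: "(\<lambda>(a, b). \<bar>poisson2 t (a, b) * f (n - int a + int b)\<bar>) p \<le> K * h p" for p
  proof (cases p)
    case (Pair a b)
    have "\<bar>poisson2 t (a, b) * f (n - int a + int b)\<bar>
      \<le> (exp (- 2 * t) * \<bar>t\<bar> ^ (a + b) / (fact a * fact b)) * (C * exp (iabs n) * (exp 1 ^ a * exp 1 ^ b))"
      unfolding abs_mult poisson2_def
      by (intro mult_mono expb_le_diff assms) (auto simp: abs_mult power_abs)
    also have "\<dots> = K * h (a, b)"
      by (simp add: K_def h_def x_def power_mult_distrib power_add field_simps)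
    finally show ?thesis using Pair by simp
  qed
  show s: "(\<lambda>(a, b). \<bar>poisson2 t (a, b) * f (n - int a + int b)\<bar>) summable_on UNIV"
    by (rule summable_on_comparison_test[OF has_sum_imp_summable[OF hs]]) (use le in auto)
  have "infsum (\<lambda>(a, b). \<bar>poisson2 t (a, b) * f (n - int a + int b)\<bar>) UNIV \<le> K * (exp x * exp x)"
    using infsum_mono[OF s has_sum_imp_summable[OF hs]] le infsumI[OF hs] by simp
  also have "\<dots> = exp (- 2 * t) * exp (2 * exp 1 * \<bar>t\<bar>) * C * exp (iabs n)"
    by (simp add: K_def x_def exp_add[symmetric] mult_ac)
  finally show "infsum (\<lambda>(a, b). \<bar>poisson2 t (a, b) * f (n - int a + int b)\<bar>) UNIV
      \<le> exp (- 2 * t) * exp (2 * exp 1 * \<bar>t\<bar>) * C * exp (iabs n)" .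
qed

lemma poisson2_abs_summable:
  assumes "f \<in> expb"
  shows "(\<lambda>p. norm ((\<lambda>(a, b). poisson2 t (a, b) * f (n - int a + int b)) p)) summable_on UNIV"
proof -
  obtain C where "C \<ge> 0" "\<And>n. \<bar>f n\<bar> \<le> C * exp (iabs n)" using expbE[OF assms] by blast
  from poisson2_bound(1)[OF this(2,1)] show ?thesis by (simp add: case_prod_unfold)
qed

lemma poisson2_summable:
  assumes "f \<in> expb"
  shows "(\<lambda>(a, b). poisson2 t (a, b) * f (n - int a + int b)) summable_on UNIV"
  by (rule abs_summable_summable[OF poisson2_abs_summable[OF assms]])

definition fibre :: "int \<Rightarrow> (nat \<times> nat) set" where
  "fibre m = {(a, b). int a - int b = m}"

text \<open>The pairs with difference m are enumerated by their minimum k, as (k + m^+, k + m^-). In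
  this order t^{a+b} / (a! b!) is the k-th term of the Bessel series at 2t.\<close>

lemma heat_kernel_fibre: "(poisson2 t has_sum heat_kernel t m) (fibre m)"
proof -
  have s: "(\<lambda>(a, b). poisson2 t (a, b) * 1) summable_on UNIV"
    by (rule poisson2_summable[where n = 0 and f = "\<lambda>_. 1"], rule expbI[where C = 1]) auto
  then have "poisson2 t summable_on fibre m"
    using summable_on_subset_banach[OF s, of "fibre m"] by (simp add: case_prod_unfold)
  then obtain S where S: "(poisson2 t has_sum S) (fibre m)" by (auto simp: summable_on_def)
  define j where "j k = (k + nat m, k + nat (- m))" for k
  have b: "bij_betw j UNIV (fibre m)"
    by (rule bij_betwI[where g = "\<lambda>(a, b). min a b"]) (auto simp: j_def fibre_def min_def)
  have eq: "poisson2 t (j k) = exp (- 2 * t) * ((2 * t / 2) ^ (2 * k + nat \<bar>m\<bar>) / (fact k * fact (k + nat \<bar>m\<bar>)))" for k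
  proof -
    have "t ^ (k + nat m + (k + nat (- m))) = t ^ (2 * k + nat \<bar>m\<bar>)"
      by (rule arg_cong[where f = "\<lambda>i. t ^ i"]) auto
    moreover have "(fact (k + nat m) * fact (k + nat (- m)) :: real) = fact k * fact (k + nat \<bar>m\<bar>)"
      by (cases "m \<ge> 0") auto
    ultimately show ?thesis by (simp add: poisson2_def j_def)
  qed
  from S have "((\<lambda>k. poisson2 t (j k)) has_sum S) UNIV"
    by (simp add: has_sum_reindex_bij_betw[OF b])
  then have "(\<lambda>k. exp (- 2 * t) * ((2 * t / 2) ^ (2 * k + nat \<bar>m\<bar>) / (fact k * fact (k + nat \<bar>m\<bar>)))) sums S"
    unfolding eq by (rule has_sum_imp_sums)
  then have "(\<lambda>k. ((2 * t / 2) ^ (2 * k + nat \<bar>m\<bar>) / (fact k * fact (k + nat \<bar>m\<bar>)))) sums (S / exp (- 2 * t))"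
    using sums_divide[of _ S "exp (- 2 * t)"] by fastforce
  then have "S / exp (- 2 * t) = bessel_I m (2 * t)"
    unfolding bessel_I_def by (simp add: sums_iff)
  then have "S = heat_kernel t m"
    unfolding heat_kernel_def by (auto simp: field_simps)
  with S show ?thesis by simp
qed

lemma heat_kernel_nonneg: "t \<ge> 0 \<Longrightarrow> heat_kernel t m \<ge> 0"
  by (rule has_sum_nonneg[OF heat_kernel_fibre]) (auto simp: poisson2_def)

text \<open>The absolutely convergent sum over pairs is regrouped along the fibres a - b = n - j.
  From here on \<open>heat\<close> can be read either as a convolution or as a Poisson
  expectation.\<close>

lemma heat_has_sum_kernel:
  assumes "f \<in> expb"
  shows "((\<lambda>j. heat_kernel t (n - j) * f j) has_sum
     infsum (\<lambda>(a, b). poisson2 t (a, b) * f (n - int a + int b)) UNIV) UNIV"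
    and "(\<lambda>j. \<bar>heat_kernel t (n - j) * f j\<bar>) summable_on UNIV"
proof -
  define F where "F = (\<lambda>(j::int, p). poisson2 t p * f j)"
  define S where "S = infsum (\<lambda>(a, b). poisson2 t (a, b) * f (n - int a + int b)) UNIV"
  have S: "((\<lambda>(a, b). poisson2 t (a, b) * f (n - int a + int b)) has_sum S) UNIV"
    unfolding S_def by (intro has_sum_infsum poisson2_summable assms)
  have jeq: "n - int a + int b = j" if "int a - int b = n - j" for a b j
    using that by simp
  have FS: "(F has_sum S) (Sigma UNIV (\<lambda>j. fibre (n - j)))"
    by (rule has_sum_reindex_bij_witness[where i = "\<lambda>(a, b). (n - int a + int b, (a, b))" and j = snd, THEN iffD2, OF _ _ _ _ _ refl S])
       (auto simp: F_def fibre_def jeq)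
  have 1: "((\<lambda>p. F (j, p)) has_sum heat_kernel t (n - j) * f j) (fibre (n - j))" for j
    unfolding F_def using has_sum_cmult_left[OF heat_kernel_fibre] by simp
  show "((\<lambda>j. heat_kernel t (n - j) * f j) has_sum
     infsum (\<lambda>(a, b). poisson2 t (a, b) * f (n - int a + int b)) UNIV) UNIV"
    using has_sum_SigmaD[OF FS 1] unfolding S_def by simp
  then show "(\<lambda>j. \<bar>heat_kernel t (n - j) * f j\<bar>) summable_on UNIV"
    using has_sum_imp_summable summable_on_iff_abs_summable_on_real by fastforce
qed

lemma heat_has_sum:
  assumes "f \<in> expb"
  shows "((\<lambda>(a, b). poisson2 t (a, b) * f (n - int a + int b)) has_sum heat t f n) UNIV"
  unfolding heat_def infsumI[OF heat_has_sum_kernel(1)[OF assms]]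
  by (intro has_sum_infsum poisson2_summable assms)

lemmas heat_eq = infsumI[OF heat_has_sum, symmetric]

lemma heat_bound:
  assumes "\<And>n. \<bar>f n\<bar> \<le> C * exp (iabs n)" "C \<ge> 0"
  shows "\<bar>heat t f n\<bar> \<le> exp (- 2 * t) * exp (2 * exp 1 * \<bar>t\<bar>) * C * exp (iabs n)"
proof -
  have "f \<in> expb" using assms(1) by (rule expbI)
  then have "\<bar>heat t f n\<bar> \<le> infsum (\<lambda>x. norm ((\<lambda>(a, b). poisson2 t (a, b) * f (n - int a + int b)) x)) UNIV"
    unfolding heat_eq[OF \<open>f \<in> expb\<close>] using norm_infsum_bound[OF poisson2_abs_summable[OF \<open>f \<in> expb\<close>]]
    by simp
  also have "\<dots> = infsum (\<lambda>(a, b). \<bar>poisson2 t (a, b) * f (n - int a + int b)\<bar>) UNIV"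
    by (intro infsum_cong) auto
  also note poisson2_bound(2)[OF assms]
  finally show ?thesis .
qed

lemma expb_heat [intro]: "f \<in> expb \<Longrightarrow> heat t f \<in> expb"
proof (elim expbE)
  fix C assume "C \<ge> 0" "\<And>n. \<bar>f n\<bar> \<le> C * exp (iabs n)"
  from heat_bound[OF this(2,1)] show ?thesis by (intro expbI)
qed

section \<open>Linearity, commutation with shifts and positivity of the heat semigroup\<close>

lemma heat_add:
  assumes "f \<in> expb" "g \<in> expb"
  shows "heat t (\<lambda>n. f n + g n) n = heat t f n + heat t g n"
proof -
  have "((\<lambda>(a, b). poisson2 t (a, b) * (f (n - int a + int b) + g (n - int a + int b))) has_sum heat t f n + heat t g n) UNIV"
    using has_sum_add[OF heat_has_sum[OF assms(1), of t n] heat_has_sum[OF assms(2), of t n]]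
    by (simp add: case_prod_unfold algebra_simps)
  then show ?thesis
    using heat_has_sum[OF expb_add[OF assms], of t n] has_sum_unique by blast
qed

lemma heat_cmult: "f \<in> expb \<Longrightarrow> heat t (\<lambda>n. c * f n) n = c * heat t f n"
  unfolding heat_def by (subst infsum_cmult_right'[symmetric]) (simp add: mult_ac)

lemma heat_uminus: "f \<in> expb \<Longrightarrow> heat t (\<lambda>n. - f n) n = - heat t f n"
  using heat_cmult[of f t "-1"] by simp

lemma heat_diff:
  "f \<in> expb \<Longrightarrow> g \<in> expb \<Longrightarrow> heat t (\<lambda>n. f n - g n) n = heat t f n - heat t g n"
  using heat_add[of f "\<lambda>n. - g n" t n] heat_uminus[of g t n] by auto

lemma heat_shift:
  assumes "f \<in> expb"
  shows "heat t (\<lambda>n. f (n + c)) n = heat t f (n + c)"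
  unfolding heat_eq[OF assms] heat_eq[OF expb_shift[OF assms]] by (simp add: algebra_simps)

lemma Lap_heat:
  assumes "f \<in> expb"
  shows "Lap (heat t f) = heat t (Lap f)"
proof
  fix n
  have e: "(\<lambda>n. f (n + 1)) \<in> expb" "(\<lambda>n. f (n + (-1))) \<in> expb" "(\<lambda>n. 2 * f n) \<in> expb"
    using assms by blast+
  have "heat t (Lap f) n = heat t (\<lambda>n. (f (n + 1) - 2 * f n) + f (n + (-1))) n"
    by (simp add: discrete_laplacian_def[abs_def])
  also have "\<dots> = heat t f (n + 1) - 2 * heat t f n + heat t f (n + (-1))"
    using e assms by (subst heat_add) (auto simp: heat_diff heat_cmult heat_shift[OF assms] simp del: add_uminus_conv_diff)
  finally show "Lap (heat t f) n = heat t (Lap f) n" by (simp add: discrete_laplacian_def)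
qed

lemma Lap_pow_heat: "f \<in> expb \<Longrightarrow> (Lap ^^ k) (heat t f) = heat t ((Lap ^^ k) f)"
  by (induction k) (auto simp: Lap_heat expb_Lap_pow)

lemma heat_nonneg: "t \<ge> 0 \<Longrightarrow> (\<And>n. f n \<ge> 0) \<Longrightarrow> heat t f n \<ge> 0"
  unfolding heat_def by (intro infsum_nonneg mult_nonneg_nonneg heat_kernel_nonneg)

lemma heat_mono:
  assumes "t \<ge> 0" "f \<in> expb" "g \<in> expb" "\<And>n. f n \<le> g n"
  shows "heat t f n \<le> heat t g n"
  using heat_nonneg[of t "\<lambda>n. g n - f n" n] heat_diff[OF assms(3,2), of t n] assms by auto

lemma heat_abs_le:
  assumes "t \<ge> 0" "f \<in> expb" "g \<in> expb" "\<And>n. \<bar>f n\<bar> \<le> g n"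
  shows "\<bar>heat t f n\<bar> \<le> heat t g n"
proof -
  have "heat t f n \<le> heat t g n" using assms by (intro heat_mono) (auto simp: abs_le_iff)
  moreover have "heat t (\<lambda>n. - f n) n \<le> heat t g n" using assms by (intro heat_mono) (auto simp: abs_le_iff)
  ultimately show ?thesis using assms by (auto simp: heat_uminus)
qed

text \<open>The coefficient of t^N in e^{2t} e^{t\<Delta>} f(n): the part of the Poisson double sum
  on the antidiagonal a + b = N.\<close>

definition antidiag :: "(int \<Rightarrow> real) \<Rightarrow> int \<Rightarrow> nat \<Rightarrow> real" where
  "antidiag f n N = (\<Sum>a\<le>N. f (n - int a + int (N - a)) / (fact a * fact (N - a)))"

lemma antidiag_bij: "bij_betw (\<lambda>(N, a). (a, N - a)) (Sigma UNIV (\<lambda>N::nat. {..N})) UNIV"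
  by (rule bij_betwI[where g = "\<lambda>(a, b). (a + b, a)"]) auto

lemma heat_sums:
  assumes "f \<in> expb"
  shows "(\<lambda>N. exp (- 2 * t) * (antidiag f n N * t ^ N)) sums heat t f n"
    and "summable (\<lambda>N. antidiag f n N * t ^ N)"
proof -
  have 1: "((\<lambda>x. (\<lambda>(a, b). poisson2 t (a, b) * f (n - int a + int b)) ((\<lambda>(N, a). (a, N - a)) x)) has_sum heat t f n) (Sigma UNIV (\<lambda>N::nat. {..N}))"
    by (subst has_sum_reindex_bij_betw[OF antidiag_bij]) (rule heat_has_sum[OF assms])
  have 2: "((\<lambda>a. (\<lambda>x. (\<lambda>(a, b). poisson2 t (a, b) * f (n - int a + int b)) ((\<lambda>(N, a). (a, N - a)) x)) (N, a))
     has_sum exp (- 2 * t) * (antidiag f n N * t ^ N)) {..N}" for N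
    by (rule has_sum_finiteI)
       (auto simp: antidiag_def poisson2_def sum_distrib_left sum_distrib_right intro!: sum.cong)
  show s: "(\<lambda>N. exp (- 2 * t) * (antidiag f n N * t ^ N)) sums heat t f n"
    by (rule has_sum_imp_sums[OF has_sum_SigmaD[OF 1 2]])
  from sums_summable[OF s] show "summable (\<lambda>N. antidiag f n N * t ^ N)"
    by (simp add: summable_cmult_iff)
qed

text \<open>Write the factor N + 1 as a + (N + 1 - a). The first part lowers a! and shifts f to n -
  1, the second lowers (N + 1 - a)! and shifts f to n + 1.\<close>

lemma diffs_antidiag:
  "diffs (antidiag f n) N = antidiag (\<lambda>n. f (n + 1) + f (n + (-1))) n N"
proof -
  let ?h = "\<lambda>a b. f (n - int a + int b)"
  have "diffs (antidiag f n) N = (\<Sum>a\<le>Suc N. ?h a (Suc N - a) * (real (Suc N) / (fact a * fact (Suc N - a))))"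
    by (simp only: diffs_def antidiag_def sum_distrib_left) (simp add: mult_ac)
  also have "\<dots> = (\<Sum>a\<le>Suc N. ?h a (Suc N - a) * (real a / (fact a * fact (Suc N - a)))
      + ?h a (Suc N - a) * (real (Suc N - a) / (fact a * fact (Suc N - a))))"
    by (intro sum.cong refl) (simp add: distrib_left[symmetric] add_divide_distrib[symmetric] of_nat_diff)
  also have "\<dots> = (\<Sum>a\<le>Suc N. ?h a (Suc N - a) * (real a / (fact a * fact (Suc N - a))))
      + (\<Sum>a\<le>Suc N. ?h a (Suc N - a) * (real (Suc N - a) / (fact a * fact (Suc N - a))))"
    by (rule sum.distrib)
  also have "(\<Sum>a\<le>Suc N. ?h a (Suc N - a) * (real a / (fact a * fact (Suc N - a))))
     = (\<Sum>a\<le>N. ?h (Suc a) (N - a) * (1 / (fact a * fact (N - a))))"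
    by (simp add: sum.atMost_Suc_shift del: sum.atMost_Suc) (simp add: field_simps)
  also have "(\<Sum>a\<le>Suc N. ?h a (Suc N - a) * (real (Suc N - a) / (fact a * fact (Suc N - a))))
     = (\<Sum>a\<le>N. ?h a (Suc N - a) * (1 / (fact a * fact (N - a))))"
  proof -
    have "real (Suc N - a) / (fact a * fact (Suc N - a)) = 1 / (fact a * fact (N - a))" if "a \<le> N" for a
      using that by (simp add: Suc_diff_le del: of_nat_Suc)
    note t = this
    have "(\<Sum>a\<le>Suc N. ?h a (Suc N - a) * (real (Suc N - a) / (fact a * fact (Suc N - a))))
      = (\<Sum>a\<le>N. ?h a (Suc N - a) * (real (Suc N - a) / (fact a * fact (Suc N - a))))"
      by (simp add: sum.atMost_Suc)
    also have "\<dots> = (\<Sum>a\<le>N. ?h a (Suc N - a) * (1 / (fact a * fact (N - a))))"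
      by (intro sum.cong refl) (simp only: t atMost_iff)
    finally show ?thesis .
  qed
  also have "(\<Sum>a\<le>N. ?h (Suc a) (N - a) * (1 / (fact a * fact (N - a)))) +
     (\<Sum>a\<le>N. ?h a (Suc N - a) * (1 / (fact a * fact (N - a))))
     = antidiag (\<lambda>n. f (n + 1) + f (n + (-1))) n N"
    unfolding antidiag_def sum.distrib[symmetric]
    by (intro sum.cong refl) (auto simp: add_divide_distrib Suc_diff_le algebra_simps)
  finally show ?thesis .
qed

text \<open>Termwise differentiation of the power series of e^{2t} e^{t\<Delta>} f(n) replaces f by
  f(n+1) + f(n-1); the prefactor e^{-2t} supplies the remaining -2 f(n).\<close>

lemma heat_has_derivative:
  assumes "f \<in> expb"
  shows "((\<lambda>t. heat t f n) has_real_derivative heat t (Lap f) n) (at t)"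
proof -
  let ?B = "\<lambda>n. f (n + 1) + f (n + (-1))"
  have B: "?B \<in> expb" by (intro expb_add expb_shift assms)
  have eq: "heat t g n = exp (- 2 * t) * (\<Sum>N. antidiag g n N * t ^ N)" if "g \<in> expb" for g t
    using heat_sums(1)[OF that, where n = n and t = t] heat_sums(2)[OF that, where n = n and t = t] suminf_mult[OF heat_sums(2)[OF that, where n = n and t = t], of "exp (- 2 * t)"]
    by (simp add: sums_iff)
  have D: "((\<lambda>t. \<Sum>N. antidiag f n N * t ^ N) has_real_derivative (\<Sum>N. antidiag ?B n N * t ^ N)) (at t)"
    using termdiffs_strong_converges_everywhere[OF heat_sums(2)[OF assms]]
    by (simp add: diffs_antidiag[abs_def])
  have "((\<lambda>t. exp (- 2 * t) * (\<Sum>N. antidiag f n N * t ^ N)) has_real_derivative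
      (heat t ?B n - 2 * heat t f n)) (at t)"
    unfolding eq[OF B] eq[OF assms] by (rule derivative_eq_intros D refl | simp)+
  moreover have "heat t ?B n - 2 * heat t f n = heat t (Lap f) n"
  proof -
    have "heat t (Lap f) n = heat t (\<lambda>n. ?B n - 2 * f n) n"
      by (simp add: discrete_laplacian_def[abs_def] algebra_simps)
    also have "\<dots> = heat t ?B n - 2 * heat t f n"
      using B assms by (simp only: heat_diff expb_cmult heat_cmult)
    finally show ?thesis ..
  qed
  ultimately show ?thesis unfolding eq[OF assms] by simp
qed

lemma heat_deriv_eq:
  assumes "f \<in> expb"
  shows "heat_deriv k t f n = heat t ((Lap ^^ k) f) n"
proof -
  have "(deriv ^^ k) (\<lambda>s. heat s f n) = (\<lambda>s. heat s ((Lap ^^ k) f) n)"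
  proof (induction k)
    case (Suc k)
    have "(deriv ^^ Suc k) (\<lambda>s. heat s f n) = deriv (\<lambda>s. heat s ((Lap ^^ k) f) n)"
      by (simp add: Suc)
    then show ?case
      using DERIV_imp_deriv[OF heat_has_derivative[OF expb_Lap_pow[OF assms]]] by (simp add: fun_eq_iff)
  qed simp
  then show ?thesis by (simp add: heat_deriv_def)
qed

section \<open>Initial value, Taylor expansion, semigroup law and eigenfunctions\<close>

lemma heat_0: "f \<in> expb \<Longrightarrow> heat 0 f = f"
proof
  fix n assume f: "f \<in> expb"
  have "(\<lambda>N. antidiag f n N * 0 ^ N) sums (antidiag f n 0)"
    using powser_sums_zero[of "antidiag f n"] by simp
  with heat_sums(1)[OF f, where n = n and t = 0] show "heat 0 f n = f n"
    by (auto simp: antidiag_def dest: sums_unique2)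
qed

lemma exp_abs_shift:
  assumes "\<bar>c\<bar> = 1"
  shows "exp (iabs (n + c)) \<le> 3 * exp (iabs n)"
proof -
  have "iabs (n + c) \<le> 1 + iabs n" using assms by linarith
  then have "exp (iabs (n + c)) \<le> exp 1 * exp (iabs n)"
    unfolding exp_add[symmetric] by simp
  also have "\<dots> \<le> 3 * exp (iabs n)" by (intro mult_right_mono exp_le) auto
  finally show ?thesis .
qed

text \<open>8 = 3 + 2 + 3, since each neighbour costs a factor e <= 3.\<close>

lemma Lap_bound:
  assumes "\<And>n. \<bar>f n\<bar> \<le> C * exp (iabs n)" "C \<ge> 0"
  shows "\<bar>Lap f n\<bar> \<le> (8 * C) * exp (iabs n)"
proof -
  note 1 = exp_abs_shift[of _ n]
  have "\<bar>f (n + 1)\<bar> \<le> C * (3 * exp (iabs n))" "\<bar>f (n - 1)\<bar> \<le> C * (3 * exp (iabs n))"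
    using order_trans[OF assms(1) mult_left_mono[OF 1 assms(2)], of 1] order_trans[OF assms(1) mult_left_mono[OF 1 assms(2)], of "-1"]
    by auto
  with assms(1)[of n] show ?thesis unfolding discrete_laplacian_def by linarith
qed

lemma Lap_pow_bound:
  assumes "\<And>n. \<bar>f n\<bar> \<le> C * exp (iabs n)" "C \<ge> 0"
  shows "\<bar>(Lap ^^ k) f n\<bar> \<le> (8 ^ k * C) * exp (iabs n)"
proof (induction k arbitrary: n)
  case (Suc k)
  show ?case using Lap_bound[OF Suc] assms(2) by (simp add: mult_ac)
qed (use assms in simp)

text \<open>The flow is entire in time: N applications of \<open>Lap\<close> cost 8^N, so the
  Lagrange remainder is at most a constant times (8 |t|)^N / N!. The purpose is the semigroup
  law.\<close>

lemma heat_Taylor: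
  assumes "f \<in> expb"
  shows "(\<lambda>j. t ^ j / fact j * heat s ((Lap ^^ j) f) n) sums heat (s + t) f n"
proof -
  obtain C where C: "C \<ge> 0" "\<And>n. \<bar>f n\<bar> \<le> C * exp (iabs n)" using expbE[OF assms] by blast
  define K where "K = exp (2 * (\<bar>s\<bar> + \<bar>t\<bar>)) * exp (2 * exp 1 * (\<bar>s\<bar> + \<bar>t\<bar>)) * C * exp (iabs n)"
  have "K \<ge> 0" using C by (simp add: K_def)
  define R where "R N = heat (s + t) f n - (\<Sum>j<N. t ^ j / fact j * heat s ((Lap ^^ j) f) n)" for N
  have R: "\<bar>R N\<bar> \<le> K * ((8 * \<bar>t\<bar>) ^ N / fact N)" for N
  proof -
    have "\<exists>\<xi>. \<bar>\<xi>\<bar> \<le> \<bar>t\<bar> \<and> heat (s + t) f n = (\<Sum>m<N. (heat (s + 0) ((Lap ^^ m) f) n / fact m) * t ^ m) + (heat (s + \<xi>) ((Lap ^^ N) f) n / fact N) * t ^ N"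
    proof (rule Maclaurin_bi_le)
      show "\<forall>m u. m < N \<and> \<bar>u\<bar> \<le> \<bar>t\<bar> \<longrightarrow> ((\<lambda>u. heat (s + u) ((Lap ^^ m) f) n) has_real_derivative heat (s + u) ((Lap ^^ (Suc m)) f) n) (at u)"
      proof (intro allI impI)
        fix m u
        have "((\<lambda>u. heat (u + s) ((Lap ^^ m) f) n) has_real_derivative heat (u + s) (Lap ((Lap ^^ m) f)) n) (at u)"
          by (rule DERIV_shift[THEN iffD1, OF heat_has_derivative[OF expb_Lap_pow[OF assms]]])
        then show "((\<lambda>u. heat (s + u) ((Lap ^^ m) f) n) has_real_derivative heat (s + u) ((Lap ^^ (Suc m)) f) n) (at u)"
          by (simp add: add.commute[of _ s])
      qed
    qed auto
    then obtain \<xi> where xi: "\<bar>\<xi>\<bar> \<le> \<bar>t\<bar>" "R N = (heat (s + \<xi>) ((Lap ^^ N) f) n / fact N) * t ^ N"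
      by (auto simp: R_def mult_ac)
    have "\<bar>heat (s + \<xi>) ((Lap ^^ N) f) n\<bar> \<le> exp (- 2 * (s + \<xi>)) * exp (2 * exp 1 * \<bar>s + \<xi>\<bar>) * (8 ^ N * C) * exp (iabs n)"
      by (rule heat_bound[OF Lap_pow_bound[OF C(2,1)]]) (use C in auto)
    also have "\<dots> \<le> exp (2 * (\<bar>s\<bar> + \<bar>t\<bar>)) * exp (2 * exp 1 * (\<bar>s\<bar> + \<bar>t\<bar>)) * (8 ^ N * C) * exp (iabs n)"
      using xi(1) C by (intro mult_mono mult_nonneg_nonneg) auto
    also have "\<dots> = K * 8 ^ N" by (simp add: K_def)
    finally have "\<bar>heat (s + \<xi>) ((Lap ^^ N) f) n\<bar> \<le> K * 8 ^ N" .
    then show ?thesis unfolding xi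
      by (simp add: abs_mult power_mult_distrib power_abs divide_simps mult_right_mono flip: mult.assoc)
  qed
  have "(\<lambda>N. K * ((8 * \<bar>t\<bar>) ^ N / fact N)) \<longlonglongrightarrow> K * 0"
    by (intro tendsto_mult tendsto_const)
       (use summable_LIMSEQ_zero[OF summable_exp[of "8 * \<bar>t\<bar>"]] in \<open>simp add: field_simps\<close>)
  then have "R \<longlonglongrightarrow> 0"
    by (intro Lim_null_comparison[where g = "\<lambda>N. K * ((8 * \<bar>t\<bar>) ^ N / fact N)" and f = R] always_eventually allI)
       (use R in \<open>simp_all only: real_norm_def mult_zero_right\<close>)
  then have "(\<lambda>N. heat (s + t) f n - R N) \<longlonglongrightarrow> heat (s + t) f n - 0"
    by (intro tendsto_diff tendsto_const)
  then show ?thesis by (simp add: R_def sums_def)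
qed

lemma heat_Taylor_0:
  assumes "f \<in> expb"
  shows "(\<lambda>j. t ^ j / fact j * (Lap ^^ j) f n) sums heat t f n"
  using heat_Taylor[OF assms, of t 0 n] by (simp add: heat_0 expb_Lap_pow assms)

text \<open>The expansion of the flow about time s coincides term by term with the expansion about 0
  applied to \<open>heat s f\<close>, because \<open>Lap\<close> commutes with \<open>heat\<close>.
  This avoids a convolution identity for Bessel functions.\<close>

lemma heat_heat:
  assumes "f \<in> expb"
  shows "heat t (heat s f) = heat (s + t) f"
proof
  fix n
  show "heat t (heat s f) n = heat (s + t) f n"
    using heat_Taylor_0[OF expb_heat[OF assms], of t s n] heat_Taylor[OF assms, of t s n]
    by (auto simp: Lap_pow_heat assms dest: sums_unique2)
qed

text \<open>On an eigenfunction the Taylor series about 0 is an exponential series in t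
  \<mu>.\<close>

lemma heat_eigen:
  assumes "f \<in> expb" "Lap f = (\<lambda>n. \<mu> * f n)"
  shows "heat t f n = exp (t * \<mu>) * f n"
proof -
  have "(Lap ^^ j) f = (\<lambda>n. \<mu> ^ j * f n)" for j
  proof (induction j)
    case (Suc j)
    have "(Lap ^^ Suc j) f = Lap (\<lambda>n. \<mu> ^ j * f n)" by (simp add: Suc)
    also have "\<dots> = (\<lambda>n. \<mu> ^ j * Lap f n)" by (simp add: discrete_laplacian_def fun_eq_iff algebra_simps)
    finally show ?case by (simp add: assms fun_eq_iff)
  qed simp
  then have "(\<lambda>j. (t * \<mu>) ^ j / fact j * f n) sums heat t f n"
    using heat_Taylor_0[OF assms(1), of t n] by (simp add: power_mult_distrib mult_ac)
  moreover have "(\<lambda>j. (t * \<mu>) ^ j / fact j * f n) sums (exp (t * \<mu>) * f n)"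
    using sums_mult2[OF exp_converges[of "t * \<mu>"]] by (simp add: divide_inverse_commute)
  ultimately show ?thesis by (rule sums_unique2)
qed

lemma expb_exp: "\<bar>c\<bar> \<le> 1 \<Longrightarrow> (\<lambda>n. exp (c * real_of_int n)) \<in> expb"
proof (rule expbI[where C = 1])
  fix n assume "\<bar>c\<bar> \<le> 1"
  then have "c * real_of_int n \<le> iabs n"
    using mult_mono[of "\<bar>c\<bar>" 1 "iabs n" "iabs n"] abs_ge_self[of "c * real_of_int n"]
    by (simp add: abs_mult)
  then show "\<bar>exp (c * real_of_int n)\<bar> \<le> 1 * exp (iabs n)" by simp
qed

lemma heat_exp:
  assumes "\<bar>c\<bar> \<le> 1"
  shows "heat t (\<lambda>n. exp (c * real_of_int n)) n = exp (t * (exp c + exp (- c) - 2)) * exp (c * real_of_int n)"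
  by (rule heat_eigen[OF expb_exp[OF assms]])
     (auto simp: discrete_laplacian_def fun_eq_iff algebra_simps exp_add[symmetric] exp_diff exp_minus field_simps)

lemma expb_const: "(\<lambda>n. c) \<in> expb"
  by (rule expbI[where C = "\<bar>c\<bar>"]) (simp add: mult_le_cancel_left1)

lemma heat_const: "heat t (\<lambda>n. c) n = c"
  using heat_eigen[OF expb_const, of c 0 t n] by (simp add: discrete_laplacian_def fun_eq_iff)

section \<open>Smoothing estimates for the heat kernel\<close>

text \<open>Half a Laplacian: two of these give \<open>Lap\<close> up to a shift, so a gain of
  t^{-1/2} for each \<open>grad\<close> becomes a gain of t^{-1} for each
  \<open>Lap\<close>.\<close>

definition grad :: "(int \<Rightarrow> real) \<Rightarrow> int \<Rightarrow> real" where
  "grad f n = f n - f (n - 1)"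

lemma expb_grad [intro]: "f \<in> expb \<Longrightarrow> grad f \<in> expb"
  unfolding grad_def[abs_def] using expb_shift[of f "-1"] by auto

lemma grad_heat: "f \<in> expb \<Longrightarrow> grad (heat t f) = heat t (grad f)"
proof
  fix n assume f: "f \<in> expb"
  have "(\<lambda>n. f (n + (-1))) \<in> expb" using f by blast
  from heat_diff[OF f this, of t n] heat_shift[OF f, of t "-1" n]
  show "grad (heat t f) n = heat t (grad f) n" by (simp add: grad_def[abs_def])
qed

lemma Lap_grad: "Lap f n = grad (grad f) (n + 1)"
  by (simp add: discrete_laplacian_def grad_def)

text \<open>A Poisson variable a of mean t has variance t, hence a / t has variance 1 / t. The
  series \<open>e0\<close>, \<open>e1\<close>, \<open>e2\<close> are its first three moments up to
  the factor e^{-t}; the independent variable b contributes total mass 1.\<close>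

lemma poisson_variance:
  assumes "t > 0"
  shows "((\<lambda>(a, b). poisson2 t (a, b) * (1 - real a / t)\<^sup>2) has_sum 1 / t) UNIV"
proof -
  have e0: "(\<lambda>a. t ^ a / fact a) sums exp t"
    using exp_converges[of t] by (simp add: divide_inverse_commute)
  have e1: "(\<lambda>a. real a * t ^ a / fact a) sums (t * exp t)"
  proof -
    have "(\<lambda>a. real (Suc a) * t ^ Suc a / fact (Suc a)) = (\<lambda>a. t * (t ^ a / fact a))"
      by (simp del: of_nat_Suc add: fun_eq_iff divide_simps)
    then have "(\<lambda>a. real (Suc a) * t ^ Suc a / fact (Suc a)) sums (t * exp t)"
      using sums_mult[OF e0, of t] by simp
    then show ?thesis by (subst (asm) sums_Suc_iff) simp
  qed
  have e2: "(\<lambda>a. (real a)\<^sup>2 * t ^ a / fact a) sums (t * (t * exp t) + t * exp t)"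
  proof -
    have "(\<lambda>a. (real (Suc a))\<^sup>2 * t ^ Suc a / fact (Suc a)) = (\<lambda>a. t * (real a * t ^ a / fact a) + t * (t ^ a / fact a))"
      by (simp add: fun_eq_iff divide_simps power2_eq_square) (simp add: algebra_simps)
    then have "(\<lambda>a. (real (Suc a))\<^sup>2 * t ^ Suc a / fact (Suc a)) sums (t * (t * exp t) + t * exp t)"
      using sums_add[OF sums_mult[OF e1, of t] sums_mult[OF e0, of t]] by simp
    then show ?thesis by (subst (asm) sums_Suc_iff) simp
  qed
  have "(\<lambda>a. exp (- t) * (t ^ a / fact a - 2 / t * (real a * t ^ a / fact a) + 1 / t\<^sup>2 * ((real a)\<^sup>2 * t ^ a / fact a)))
     sums (exp (- t) * (exp t - 2 / t * (t * exp t) + 1 / t\<^sup>2 * (t * (t * exp t) + t * exp t)))"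
    by (intro sums_mult sums_add sums_diff e0 e1 e2)
  also have "(\<lambda>a. exp (- t) * (t ^ a / fact a - 2 / t * (real a * t ^ a / fact a) + 1 / t\<^sup>2 * ((real a)\<^sup>2 * t ^ a / fact a)))
     = (\<lambda>a. exp (- t) * (t ^ a / fact a) * (1 - real a / t)\<^sup>2)"
    using assms by (simp add: fun_eq_iff power2_eq_square field_simps)
  also have "exp (- t) * (exp t - 2 / t * (t * exp t) + 1 / t\<^sup>2 * (t * (t * exp t) + t * exp t)) = 1 / t"
    using assms by (simp add: exp_minus power2_eq_square field_simps)
  finally have 1: "((\<lambda>a. exp (- t) * (t ^ a / fact a) * (1 - real a / t)\<^sup>2) has_sum 1 / t) UNIV"
    using assms by (intro sums_nonneg_imp_has_sum) auto
  have 2: "((\<lambda>b. exp (- t) * (t ^ b / fact b)) has_sum 1) UNIV"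
    using has_sum_cmult_right[OF exp_has_sum[of t], of "exp (- t)"] by (simp add: exp_minus)
  have "((\<lambda>(a, b). exp (- t) * (t ^ a / fact a) * (1 - real a / t)\<^sup>2 * (exp (- t) * (t ^ b / fact b))) has_sum 1 / t * 1) UNIV"
    using assms by (intro has_sum_product_nonneg 1 2) auto
  also have "(\<lambda>(a, b). exp (- t) * (t ^ a / fact a) * (1 - real a / t)\<^sup>2 * (exp (- t) * (t ^ b / fact b)))
     = (\<lambda>(a, b). poisson2 t (a, b) * (1 - real a / t)\<^sup>2)"
    by (auto simp: fun_eq_iff poisson2_def power_add exp_add[symmetric] field_simps)
  finally show ?thesis by simp
qed

text \<open>Summation by parts: replacing a by a + 1 turns the value at n - 1 into the value at n
  with weight a / t, because \<open>poisson2 t (a + 1, b)\<close> times (a + 1) / t is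
  \<open>poisson2 t (a, b)\<close>. The difference thus falls on the measure and not on f.\<close>

lemma grad_heat_has_sum:
  assumes f: "f \<in> expb" and t: "t > 0"
  shows "((\<lambda>(a, b). poisson2 t (a, b) * (1 - real a / t) * f (n - int a + int b)) has_sum grad (heat t f) n) UNIV"
proof -
  let ?g = "\<lambda>(a, b). poisson2 t (a, b) * (real a / t) * f (n - int a + int b)"
  let ?h = "\<lambda>(a::nat, b::nat). (Suc a, b)"
  have g: "?g (?h p) = (\<lambda>(a, b). poisson2 t (a, b) * f (n - 1 - int a + int b)) p" for p
  proof (cases p)
    case (Pair a b)
    have "f (n - int (Suc a) + int b) = f (n - 1 - int a + int b)"
      by (rule arg_cong[where f = f]) simp
    then show ?thesis using t by (simp add: Pair poisson2_def del: of_nat_Suc)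
  qed
  have "(?g has_sum heat t f (n - 1)) (range ?h)"
    by (subst has_sum_reindex) (use heat_has_sum[OF f, of t "n - 1"] g in \<open>auto simp: inj_on_def o_def\<close>)
  then have "(?g has_sum heat t f (n - 1)) UNIV"
  proof (subst has_sum_cong_neutral[where T = "range ?h" and f = ?g and g = ?g])
    fix p assume p: "p \<in> UNIV - range ?h"
    obtain a b where [simp]: "p = (a, b)" by force
    from p have "a = 0" by (cases a) (auto simp: image_iff)
    then show "?g p = 0" by simp
  qed auto
  from has_sum_add[OF heat_has_sum[OF f, of t n] has_sum_cmult_right[OF this, of "-1"]]
  show ?thesis by (simp add: grad_def case_prod_unfold algebra_simps)
qed

lemma exp_plus_minus_le:
  assumes "\<bar>x\<bar> \<le> (1::real)"
  shows "exp x + exp (- x) - 2 \<le> 2 * x\<^sup>2"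
proof -
  have *: "exp x + exp (- x) - 2 \<le> 2 * x\<^sup>2" if "0 \<le> x" "x \<le> 1" for x :: real
  proof -
    have 1: "exp x \<le> 1 + x + x\<^sup>2" using that by (rule exp_bound)
    have 2: "1 + x + x\<^sup>2 / 2 \<le> exp x" using that(1) by (rule exp_lower_Taylor_quadratic)
    \<comment> \<open>Multiplying by the lower Taylor polynomial of e^x turns the wanted upper bound
      1 - x + x^2 for e^{-x} into a polynomial inequality.\<close>
    have "1 \<le> (1 + x + x\<^sup>2 / 2) * (1 - x + x\<^sup>2)"
    proof -
      have "(1 + x + x\<^sup>2 / 2) * (1 - x + x\<^sup>2) = 1 + x\<^sup>2 / 2 + x ^ 3 / 2 + x ^ 4 / 2"
        by (simp add: field_simps power2_eq_square power3_eq_cube power4_eq_xxxx)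
      then show ?thesis using that by simp
    qed
    also have "\<dots> \<le> exp x * (1 - x + x\<^sup>2)"
      using that by (intro mult_right_mono 2) auto
    finally have "exp (- x) \<le> 1 - x + x\<^sup>2"
      by (simp add: exp_minus field_simps)
    with 1 show ?thesis by simp
  qed
  show ?thesis using *[of x] *[of "-x"] assms by (cases "x \<ge> 0") auto
qed

lemma exp_two_le: "exp 2 \<le> (9::real)"
proof -
  have "exp 2 = exp 1 * exp (1::real)" by (simp add: exp_add[symmetric])
  also have "\<dots> \<le> 3 * 3" by (intro mult_mono exp_le) auto
  finally show ?thesis by simp
qed

text \<open>The doubled slope appears because the weight e^{cn} is squared in the gradient estimate.
  For both c and 2c the slope stays within the range of the quadratic bound on e^x + e^{-x} - 2, and
  the growth exponent stays below 2 uniformly in t.\<close>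

lemma slope_facts:
  assumes "t \<ge> 0" "\<bar>c\<bar> \<le> 1 / (2 * sqrt (1 + t))"
  shows "\<bar>2 * c\<bar> \<le> 1" "t * (2 * (2 * c)\<^sup>2) \<le> 2" "t * (2 * c\<^sup>2) \<le> 2"
proof -
  have 1: "\<bar>2 * c\<bar> \<le> 1 / sqrt (1 + t)"
    using mult_left_mono[OF assms(2), of 2] by (simp add: abs_mult)
  also have "\<dots> \<le> 1" using assms by (simp add: divide_le_eq)
  finally show "\<bar>2 * c\<bar> \<le> 1" .
  have "(2 * c)\<^sup>2 \<le> (1 / sqrt (1 + t))\<^sup>2" using power_mono[OF 1 abs_ge_zero, of 2] by simp
  also have "\<dots> = 1 / (1 + t)" using assms by (simp add: power_divide)
  finally have 2: "(2 * c)\<^sup>2 \<le> 1 / (1 + t)" .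
  have "t * (2 * (2 * c)\<^sup>2) \<le> t * (2 * (1 / (1 + t)))" using assms by (intro mult_left_mono 2) auto
  also have "\<dots> \<le> 2" using assms by (simp add: field_simps)
  finally show 3: "t * (2 * (2 * c)\<^sup>2) \<le> 2" .
  have "t * (2 * c\<^sup>2) \<le> t * (2 * (2 * c)\<^sup>2)" using assms by (intro mult_left_mono) (auto simp: power_mult_distrib)
  with 3 show "t * (2 * c\<^sup>2) \<le> 2" by simp
qed

lemma expb_slope:
  assumes "\<bar>c\<bar> \<le> 1" "\<And>m. \<bar>f m\<bar> \<le> B * exp (c * real_of_int m)"
  shows "f \<in> expb"
proof -
  have B: "B \<ge> 0" using assms(2)[of 0] by simp
  show ?thesis
  proof (rule expbI)
    fix n
    have "c * real_of_int n \<le> iabs n"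
      using mult_mono[of "\<bar>c\<bar>" 1 "iabs n" "iabs n"] abs_ge_self[of "c * real_of_int n"] assms(1)
      by (simp add: abs_mult)
    then show "\<bar>f n\<bar> \<le> B * exp (iabs n)"
      using B by (intro order_trans[OF assms(2)] mult_left_mono) auto
  qed
qed

text \<open>Positivity reduces the bound to the eigenfunction e^{cn}, whose growth factor e^{t (e^c
  + e^{-c} - 2)} is at most e^2 <= 9 for admissible slopes.\<close>

lemma heat_slope:
  assumes t: "t \<ge> 0" and c: "\<bar>c\<bar> \<le> 1 / (2 * sqrt (1 + t))"
    and f: "\<And>m. \<bar>f m\<bar> \<le> B * exp (c * real_of_int m)"
  shows "\<bar>heat t f n\<bar> \<le> 9 * B * exp (c * real_of_int n)"
proof -
  note s = slope_facts[OF t c]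
  have c1: "\<bar>c\<bar> \<le> 1" using s(1) by simp
  have B: "B \<ge> 0" using f[of 0] by simp
  have "\<bar>heat t f n\<bar> \<le> heat t (\<lambda>m. B * exp (c * real_of_int m)) n"
    by (intro heat_abs_le t f expb_slope[OF c1 f] expb_cmult expb_exp c1)
  also have "\<dots> = B * (exp (t * (exp c + exp (- c) - 2)) * exp (c * real_of_int n))"
    by (simp add: heat_cmult expb_exp c1 heat_exp)
  also have "\<dots> \<le> B * (exp 2 * exp (c * real_of_int n))"
    using order_trans[OF mult_left_mono[OF exp_plus_minus_le[OF c1] t] s(3)]
    by (intro mult_left_mono mult_right_mono B) auto
  also have "\<dots> \<le> B * (9 * exp (c * real_of_int n))"
    by (intro mult_left_mono mult_right_mono B exp_two_le) auto
  finally show ?thesis by simp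
qed

text \<open>The Poisson score \<open>1 - a / t\<close> has variance \<open>1 / t\<close>; this is the source of all smoothing.\<close>

lemma grad_heat_slope:
  assumes t: "t \<ge> 0" and c: "\<bar>c\<bar> \<le> 1 / (2 * sqrt (1 + t))"
    and f: "\<And>m. \<bar>f m\<bar> \<le> B * exp (c * real_of_int m)"
  shows "\<bar>grad (heat t f) n\<bar> \<le> 72 * B / sqrt (1 + t) * exp (c * real_of_int n)"
proof -
  note s = slope_facts[OF t c]
  have c1: "\<bar>c\<bar> \<le> 1" using s(1) by simp
  have B: "B \<ge> 0" using f[of 0] by simp
  have fe: "f \<in> expb" by (rule expb_slope[OF c1 f])
  show ?thesis
  proof (cases "t \<ge> 1")
    case True
    define K where "K = B * exp (c * real_of_int n)"
    have K: "K \<ge> 0" using B by (simp add: K_def)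
    define r where "r = sqrt t"
    have r: "r > 0" "r * r = t" using True by (auto simp: r_def)
    let ?F = "\<lambda>(a, b). poisson2 t (a, b) * (1 - real a / t) * f (n - int a + int b)"
    let ?G = "\<lambda>(a, b). K * (r / 2) * (poisson2 t (a, b) * (1 - real a / t)\<^sup>2) +
       K / (2 * r) * (poisson2 t (a, b) * exp (2 * c * real_of_int (0 - int a + int b)))"
    have S: "(?G has_sum K * (r / 2) * (1 / t) + K / (2 * r) * heat t (\<lambda>m. exp (2 * c * real_of_int m)) 0) UNIV"
      using has_sum_add[OF has_sum_cmult_right[OF poisson_variance[of t], of "K * (r / 2)"]
          has_sum_cmult_right[OF heat_has_sum[OF expb_exp[OF s(1)], of t 0], of "K / (2 * r)"]] True
      by (simp add: case_prod_unfold)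
    have le: "\<bar>?F p\<bar> \<le> ?G p" for p
    proof (cases p)
      case (Pair a b)
      define x where "x = \<bar>1 - real a / t\<bar>"
      define y where "y = exp (c * (real b - real a))"
      have p0: "poisson2 t (a, b) \<ge> 0" using t by (simp add: poisson2_def)
      have "\<bar>f (n - int a + int b)\<bar> \<le> B * exp (c * real_of_int (n - int a + int b))" by (rule f)
      also have "\<dots> = K * y" by (simp add: K_def y_def algebra_simps exp_add[symmetric])
      finally have f': "\<bar>f (n - int a + int b)\<bar> \<le> K * y" .
      \<comment> \<open>AM-GM with weight r = sqrt t: the score x has second moment 1 / t while the
        second moment of y is bounded, so this weight makes both contributions of order 1 / sqrt
        t.\<close>
      have "0 \<le> (r * x - y)\<^sup>2 / (2 * r)" using r by simp
      also have "\<dots> = r / 2 * x\<^sup>2 + y\<^sup>2 / (2 * r) - x * y"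
        using r by (simp add: power2_eq_square field_simps)
      finally have xy: "x * y \<le> r / 2 * x\<^sup>2 + y\<^sup>2 / (2 * r)" by simp
      have "\<bar>?F p\<bar> = poisson2 t (a, b) * x * \<bar>f (n - int a + int b)\<bar>"
        using p0 Pair by (simp add: abs_mult x_def)
      also have "\<dots> \<le> poisson2 t (a, b) * x * (K * y)"
        using p0 f' by (intro mult_left_mono) (auto simp: x_def)
      also have "\<dots> = poisson2 t (a, b) * K * (x * y)" by simp
      also have "\<dots> \<le> poisson2 t (a, b) * K * (r / 2 * x\<^sup>2 + y\<^sup>2 / (2 * r))"
        using p0 K by (intro mult_left_mono xy) auto
      also have "y\<^sup>2 = exp (2 * c * real_of_int (0 - int a + int b))"
        by (simp add: y_def power2_eq_square exp_add[symmetric] algebra_simps)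
      finally show ?thesis using Pair by (simp add: x_def algebra_simps)
    qed
    have g: "\<bar>grad (heat t f) n\<bar> \<le> K * (r / 2) * (1 / t) + K / (2 * r) * heat t (\<lambda>m. exp (2 * c * real_of_int m)) 0"
    proof -
      have F: "(?F has_sum grad (heat t f) n) UNIV" using grad_heat_has_sum[OF fe] True by simp
      have "\<And>p. ?F p \<le> ?G p" "\<And>p. - ?G p \<le> ?F p" using le abs_le_iff by (smt (verit))+
      then have "grad (heat t f) n \<le> K * (r / 2) * (1 / t) + K / (2 * r) * heat t (\<lambda>m. exp (2 * c * real_of_int m)) 0"
        "- (K * (r / 2) * (1 / t) + K / (2 * r) * heat t (\<lambda>m. exp (2 * c * real_of_int m)) 0) \<le> grad (heat t f) n"
        using has_sum_mono[OF F S] has_sum_mono[OF has_sum_cmult_right[OF S, of "-1"] F] by auto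
      then show ?thesis by linarith
    qed
    have "heat t (\<lambda>m. exp (2 * c * real_of_int m)) 0 \<le> 9"
      using heat_exp[OF s(1), of t 0] order_trans[OF mult_left_mono[OF exp_plus_minus_le[OF s(1)] t] s(2)] exp_two_le
      by (simp add: order_trans[OF _ exp_two_le])
    then have "K / (2 * r) * heat t (\<lambda>m. exp (2 * c * real_of_int m)) 0 \<le> K / (2 * r) * 9"
      using K r by (intro mult_left_mono) auto
    moreover have "K * (r / 2) * (1 / t) = K / (2 * r)" using r True by (simp add: field_simps)
    ultimately have "\<bar>grad (heat t f) n\<bar> \<le> K / (2 * r) + K / (2 * r) * 9" using g by linarith
    also have "\<dots> = 10 * K / (2 * r)" by simp
    also have "\<dots> \<le> 72 * K / sqrt (1 + t)"
    proof -
      have "sqrt (1 + t) \<le> sqrt (4 * t)" using True by (intro real_sqrt_le_mono) auto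
      then have "sqrt (1 + t) \<le> 2 * r" by (simp add: r_def real_sqrt_mult)
      then have "10 * K / (2 * r) \<le> 10 * K / sqrt (1 + t)" using K True by (intro divide_left_mono) (auto simp: r)
      also have "\<dots> \<le> 72 * K / sqrt (1 + t)" using K True by (intro divide_right_mono) auto
      finally show ?thesis .
    qed
    finally show ?thesis by (simp add: K_def)
  next
    case False
    \<comment> \<open>For t < 1 no smoothing is at stake. The two values of the flow cost 9 + 9 * 3
      = 36, and sqrt(1 + t) <= 2 turns this into 72, the constant of the lemma.\<close>
    have "\<bar>grad (heat t f) n\<bar> \<le> \<bar>heat t f n\<bar> + \<bar>heat t f (n - 1)\<bar>" by (simp add: grad_def)
    also have "\<dots> \<le> 9 * B * exp (c * real_of_int n) + 9 * B * exp (c * real_of_int (n - 1))"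
      by (intro add_mono heat_slope[OF t c f])
    also have "exp (c * real_of_int (n - 1)) \<le> exp 1 * exp (c * real_of_int n)"
      unfolding exp_add[symmetric] using c1 by (simp add: algebra_simps)
    also have "exp 1 * exp (c * real_of_int n) \<le> 3 * exp (c * real_of_int n)"
      by (intro mult_right_mono exp_le) auto
    finally have "\<bar>grad (heat t f) n\<bar> \<le> 36 * (B * exp (c * real_of_int n))" using B by (simp add: mult_left_mono)
    also have "\<dots> \<le> (72 / sqrt (1 + t)) * (B * exp (c * real_of_int n))"
    proof (intro mult_right_mono)
      have "sqrt (1 + t) \<le> sqrt 4" using False by (intro real_sqrt_le_mono) auto
      then show "36 \<le> 72 / sqrt (1 + t)" using t by (simp add: field_simps)
    qed (use B in auto)
    finally show ?thesis by simp
  qed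
qed

lemma slope_half:
  assumes "t \<ge> 0" "\<bar>c\<bar> \<le> 1 / (2 * sqrt (1 + t))"
  shows "\<bar>c\<bar> \<le> 1 / (2 * sqrt (1 + t / 2))"
proof -
  have "1 / (2 * sqrt (1 + t)) \<le> 1 / (2 * sqrt (1 + t / 2))"
    using assms(1) by (intro divide_left_mono) auto
  with assms show ?thesis by simp
qed

text \<open>\<open>Lap\<close> is a shifted square of \<open>grad\<close>, and each half of the time
  pays for one gradient. The constant is 72^2, times 2 for replacing 1 + t/2 by 1 + t, times 3 for
  the shift by one.\<close>

lemma heat_Lap_slope:
  assumes t: "t \<ge> 0" and c: "\<bar>c\<bar> \<le> 1 / (2 * sqrt (1 + t))"
    and f: "\<And>m. \<bar>f m\<bar> \<le> B * exp (c * real_of_int m)"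
  shows "\<bar>heat t (Lap f) n\<bar> \<le> 31104 * B / (1 + t) * exp (c * real_of_int n)"
proof -
  define s where "s = t / 2"
  have s: "s \<ge> 0" "\<bar>c\<bar> \<le> 1 / (2 * sqrt (1 + s))" using slope_half[OF t c] t by (auto simp: s_def)
  have B: "B \<ge> 0" using f[of 0] by simp
  have c1: "\<bar>c\<bar> \<le> 1" using slope_facts(1)[OF t c] by simp
  have fe: "f \<in> expb" by (rule expb_slope[OF c1 f])
  have "heat t (Lap f) n = grad (heat s (grad (heat s f))) (n + 1)"
    using fe by (simp add: Lap_heat[symmetric] Lap_grad grad_heat expb_grad expb_heat heat_heat s_def)
  also have "\<bar>\<dots>\<bar> \<le> 72 * (72 * B / sqrt (1 + s)) / sqrt (1 + s) * exp (c * real_of_int (n + 1))"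
    by (intro grad_heat_slope s grad_heat_slope f)
  also have "\<dots> = 5184 * B / (1 + s) * exp (c * real_of_int (n + 1))"
    using s by (simp add: field_simps)
  also have "\<dots> \<le> 10368 * B / (1 + t) * (3 * exp (c * real_of_int n))"
  proof (intro mult_mono)
    show "5184 * B / (1 + s) \<le> 10368 * B / (1 + t)" using B t by (simp add: s_def field_simps)
    have "exp (c * real_of_int (n + 1)) \<le> exp 1 * exp (c * real_of_int n)"
      unfolding exp_add[symmetric] using c1 by (simp add: algebra_simps)
    also have "exp 1 * exp (c * real_of_int n) \<le> 3 * exp (c * real_of_int n)"
      by (intro mult_right_mono exp_le) auto
    finally show "exp (c * real_of_int (n + 1)) \<le> 3 * exp (c * real_of_int n)" .
  qed (use B t in auto)
  finally show ?thesis by simp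
qed

text \<open>Induction on L: half of the time is spent on one Laplacian, the other half on the
  remaining L, and each power of 1 + t/2 costs a factor 2. The slope stays admissible because
  halving the time only enlarges the allowed range.\<close>

lemma heat_Lap_pow_slope:
  "\<exists>C\<ge>0. \<forall>t\<ge>0. \<forall>c f B n. \<bar>c\<bar> \<le> 1 / (2 * sqrt (1 + t)) \<longrightarrow>
     (\<forall>m. \<bar>f m\<bar> \<le> B * exp (c * real_of_int m)) \<longrightarrow>
     \<bar>heat t ((Lap ^^ L) f) n\<bar> \<le> C * B / (1 + t) ^ L * exp (c * real_of_int n)"
proof (induction L)
  case 0
  show ?case by (rule exI[of _ 9]) (auto intro: heat_slope)
next
  case (Suc L)
  then obtain C where C: "C \<ge> 0" and *: "\<And>t c f B n. t \<ge> 0 \<Longrightarrow> \<bar>c\<bar> \<le> 1 / (2 * sqrt (1 + t)) \<Longrightarrow>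
     (\<And>m. \<bar>f m\<bar> \<le> B * exp (c * real_of_int m)) \<Longrightarrow>
     \<bar>heat t ((Lap ^^ L) f) n\<bar> \<le> C * B / (1 + t) ^ L * exp (c * real_of_int n)" by blast
  show ?case
  proof (intro exI[of _ "C * 31104 * 2 ^ Suc L"] conjI allI impI)
    fix t c :: real and f B n
    assume t: "0 \<le> t" and c: "\<bar>c\<bar> \<le> 1 / (2 * sqrt (1 + t))" and "\<forall>m. \<bar>f m\<bar> \<le> B * exp (c * real_of_int m)"
    then have f: "\<And>m. \<bar>f m\<bar> \<le> B * exp (c * real_of_int m)" by blast
    define s where "s = t / 2"
    have s: "s \<ge> 0" "\<bar>c\<bar> \<le> 1 / (2 * sqrt (1 + s))" using slope_half[OF t c] t by (auto simp: s_def)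
    have B: "B \<ge> 0" using f[of 0] by simp
    have c1: "\<bar>c\<bar> \<le> 1" using slope_facts(1)[OF t c] by simp
    have fe: "f \<in> expb" by (rule expb_slope[OF c1 f])
    have "heat t ((Lap ^^ Suc L) f) n = heat s ((Lap ^^ L) (heat s (Lap f))) n"
      using fe by (simp add: Lap_pow_heat expb_Lap expb_Lap_pow heat_heat s_def funpow_swap1)
    also have "\<bar>\<dots>\<bar> \<le> C * (31104 * B / (1 + s)) / (1 + s) ^ L * exp (c * real_of_int n)"
      by (intro * s heat_Lap_slope f)
    also have "\<dots> = C * 31104 * B * (1 / (1 + s)) ^ Suc L * exp (c * real_of_int n)"
      by (simp add: field_simps power_divide)
    also have "\<dots> \<le> C * 31104 * B * (2 / (1 + t)) ^ Suc L * exp (c * real_of_int n)"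
      using B C t by (intro mult_right_mono mult_left_mono power_mono) (auto simp: s_def field_simps)
    finally show "\<bar>heat t ((Lap ^^ Suc L) f) n\<bar> \<le> C * 31104 * 2 ^ Suc L * B / (1 + t) ^ Suc L * exp (c * real_of_int n)"
      by (simp add: power_divide field_simps)
  qed (use C in simp)
qed

text \<open>One extra gradient yields the extra factor 1 / sqrt(1 + t). This is the form suited to
  the point mass, which is a gradient of a bounded function.\<close>

lemma heat_Lap_pow_grad_slope:
  "\<exists>C\<ge>0. \<forall>t\<ge>0. \<forall>c f B n. \<bar>c\<bar> \<le> 1 / (2 * sqrt (1 + t)) \<longrightarrow>
     (\<forall>m. \<bar>f m\<bar> \<le> B * exp (c * real_of_int m)) \<longrightarrow>
     \<bar>heat t ((Lap ^^ L) (grad f)) n\<bar> \<le> C * B / ((1 + t) ^ L * sqrt (1 + t)) * exp (c * real_of_int n)"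
proof -
  obtain C where C: "C \<ge> 0" and *: "\<And>t c f B n. t \<ge> 0 \<Longrightarrow> \<bar>c\<bar> \<le> 1 / (2 * sqrt (1 + t)) \<Longrightarrow>
     (\<And>m. \<bar>f m\<bar> \<le> B * exp (c * real_of_int m)) \<Longrightarrow>
     \<bar>heat t ((Lap ^^ L) f) n\<bar> \<le> C * B / (1 + t) ^ L * exp (c * real_of_int n)"
    using heat_Lap_pow_slope[of L] by blast
  show ?thesis
  proof (intro exI[of _ "C * 144 * 2 ^ L"] conjI allI impI)
    fix t c :: real and f B n
    assume t: "0 \<le> t" and c: "\<bar>c\<bar> \<le> 1 / (2 * sqrt (1 + t))" and "\<forall>m. \<bar>f m\<bar> \<le> B * exp (c * real_of_int m)"
    then have f: "\<And>m. \<bar>f m\<bar> \<le> B * exp (c * real_of_int m)" by blast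
    define s where "s = t / 2"
    have s: "s \<ge> 0" "\<bar>c\<bar> \<le> 1 / (2 * sqrt (1 + s))" using slope_half[OF t c] t by (auto simp: s_def)
    have B: "B \<ge> 0" using f[of 0] by simp
    have c1: "\<bar>c\<bar> \<le> 1" using slope_facts(1)[OF t c] by simp
    have fe: "f \<in> expb" by (rule expb_slope[OF c1 f])
    have "heat t ((Lap ^^ L) (grad f)) n = heat s ((Lap ^^ L) (grad (heat s f))) n"
      using fe by (simp add: Lap_pow_heat expb_grad expb_Lap_pow heat_heat s_def grad_heat)
    also have "\<bar>\<dots>\<bar> \<le> C * (72 * B / sqrt (1 + s)) / (1 + s) ^ L * exp (c * real_of_int n)"
      by (intro * s grad_heat_slope f)
    also have "\<dots> = C * 72 * B * ((1 / (1 + s)) ^ L * (1 / sqrt (1 + s))) * exp (c * real_of_int n)"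
      by (simp add: field_simps power_divide)
    also have "\<dots> \<le> C * 72 * B * ((2 / (1 + t)) ^ L * (2 / sqrt (1 + t))) * exp (c * real_of_int n)"
    proof -
      have "sqrt (1 + t) \<le> sqrt (4 * (1 + s))" using t by (intro real_sqrt_le_mono) (auto simp: s_def)
      also have "sqrt (4 * (1 + s)) = 2 * sqrt (1 + s)" by (subst real_sqrt_mult) simp
      finally have "1 / sqrt (1 + s) \<le> 2 / sqrt (1 + t)" using t s by (simp add: divide_simps)
      then show ?thesis
      using B C t by (intro mult_right_mono mult_left_mono mult_mono power_mono) (auto simp: s_def field_simps)
    qed
    finally show "\<bar>heat t ((Lap ^^ L) (grad f)) n\<bar> \<le> C * 144 * 2 ^ L * B / ((1 + t) ^ L * sqrt (1 + t)) * exp (c * real_of_int n)"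
      by (simp add: power_divide field_simps)
  qed (use C in simp)
qed

section \<open>Pointwise bounds for the kernel of a power of the Laplacian times the
  semigroup\<close>

definition delta :: "int \<Rightarrow> real" where "delta n = (if n = 0 then 1 else 0)"

text \<open>The convolution kernel of \<Delta>^L e^{t\<Delta>}, equivalently the L-th time
  derivative of the heat kernel.\<close>

definition lap_kernel :: "nat \<Rightarrow> real \<Rightarrow> int \<Rightarrow> real" where
  "lap_kernel L t = heat t ((Lap ^^ L) delta)"

lemma expb_delta: "delta \<in> expb"
  by (rule expbI[where C = 1]) (simp add: delta_def)

text \<open>The point mass is the gradient of either half-line step function. The sign of n decides
  which one is used, so that an exponential of matching slope dominates the step function and decays
  at n.\<close>

lemma lap_kernel_exp_bound:
  "\<exists>C\<ge>0. \<forall>t\<ge>0. \<forall>n. \<bar>lap_kernel L t n\<bar> \<le>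
     C / ((1 + t) ^ L * sqrt (1 + t)) * exp (- iabs n / (2 * sqrt (1 + t)))"
proof -
  obtain C where C: "C \<ge> 0" and *: "\<And>t c f B n. t \<ge> 0 \<Longrightarrow> \<bar>c\<bar> \<le> 1 / (2 * sqrt (1 + t)) \<Longrightarrow>
     (\<And>m. \<bar>f m\<bar> \<le> B * exp (c * real_of_int m)) \<Longrightarrow>
     \<bar>heat t ((Lap ^^ L) (grad f)) n\<bar> \<le> C * B / ((1 + t) ^ L * sqrt (1 + t)) * exp (c * real_of_int n)"
    using heat_Lap_pow_grad_slope[of L] by blast
  show ?thesis
  proof (intro exI[of _ C] conjI allI impI)
    fix t :: real and n :: int assume t: "0 \<le> t"
    define c where "c = 1 / (2 * sqrt (1 + t))"
    have c: "c \<ge> 0" using t by (simp add: c_def)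
    show "\<bar>lap_kernel L t n\<bar> \<le> C / ((1 + t) ^ L * sqrt (1 + t)) * exp (- iabs n / (2 * sqrt (1 + t)))"
    proof (cases "n \<le> 0")
      case True
      \<comment> \<open>This step function lies below e^{cm} with c >= 0, and e^{cm} decays towards
        negative m, where n lies.\<close>
      let ?f = "\<lambda>m::int. if m \<ge> 0 then 1 else 0 :: real"
      have d: "delta = grad ?f" by (auto simp: delta_def grad_def fun_eq_iff)
      have "\<bar>lap_kernel L t n\<bar> \<le> C * 1 / ((1 + t) ^ L * sqrt (1 + t)) * exp (c * real_of_int n)"
        unfolding lap_kernel_def d
      proof (rule *[OF t])
        show "\<bar>?f m\<bar> \<le> 1 * exp (c * real_of_int m)" for m
          using mult_nonneg_nonneg[OF c, of "real_of_int m"] mult_nonneg_nonpos[OF c, of "real_of_int m"] by auto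
      qed (use c in \<open>auto simp: c_def\<close>)
      then show ?thesis using True by (simp add: c_def)
    next
      case False
      \<comment> \<open>The previous step function minus 1: the gradient is the same, but now |f|
        lies below e^{-cm}, which decays towards positive m.\<close>
      let ?f = "\<lambda>m::int. if m < 0 then - 1 else 0 :: real"
      have d: "delta = grad ?f" by (auto simp: delta_def grad_def fun_eq_iff)
      have "\<bar>lap_kernel L t n\<bar> \<le> C * 1 / ((1 + t) ^ L * sqrt (1 + t)) * exp (- c * real_of_int n)"
        unfolding lap_kernel_def d
      proof (rule *[OF t])
        show "\<bar>?f m\<bar> \<le> 1 * exp (- c * real_of_int m)" for m
          using mult_nonneg_nonneg[OF c, of "real_of_int m"] mult_nonneg_nonpos[OF c, of "real_of_int m"] by auto
      qed (use c in \<open>auto simp: c_def\<close>)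
      then show ?thesis using False by (simp add: c_def)
    qed
  qed (use C in simp)
qed

text \<open>The inequality ln y <= y - 1 at y = (1 + x) / M. The constant is the value of (1 + x)^M
  e^{-x} at its critical point 1 + x = M.\<close>

lemma exp_minus_le_powr:
  assumes "M > 0" "x \<ge> (0::real)"
  shows "exp (- x) \<le> exp (1 - M + M * ln M) * (1 + x) powr (- M)"
proof -
  have "ln ((1 + x) / M) \<le> (1 + x) / M - 1" using assms by (intro ln_le_minus_one) auto
  then have "M * ln ((1 + x) / M) \<le> M * ((1 + x) / M - 1)" using assms by (intro mult_left_mono) auto
  then have "M * ln (1 + x) \<le> 1 + x - M + M * ln M" using assms by (simp add: ln_div right_diff_distrib)
  then have "exp (- x) \<le> exp (1 - M + M * ln M + (- M * ln (1 + x)))" by simp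
  also have "\<dots> = exp (1 - M + M * ln M) * (1 + x) powr (- M)"
    using assms unfolding exp_add by (simp add: powr_def)
  finally show ?thesis .
qed

lemma powr_le_exp:
  assumes "M > 0" "x \<ge> (0::real)"
  shows "(1 + x) powr M \<le> exp (1 - M + M * ln M) * exp x"
proof -
  have "(1 + x) powr M > 0" using assms by simp
  then show ?thesis
    using exp_minus_le_powr[OF assms] by (simp add: exp_minus powr_minus field_simps)
qed

text \<open>The exponential is traded for an arbitrary power. \<open>M\<close> stays free so that
  later sums over the integers converge and their weights can be made to cancel; the homogeneous
  form in sqrt(1 + t) and |n| keeps powers easy to combine.\<close>

lemma lap_kernel_bound:
  assumes M: "M > 0"
  shows "\<exists>C\<ge>0. \<forall>t\<ge>0. \<forall>n. \<bar>lap_kernel L t n\<bar> \<le>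
     C * sqrt (1 + t) powr (M - 1 - 2 * real L) * (sqrt (1 + t) + iabs n) powr (- M)"
proof -
  obtain C where C: "C \<ge> 0" and *: "\<And>t n. t \<ge> 0 \<Longrightarrow> \<bar>lap_kernel L t n\<bar> \<le>
     C / ((1 + t) ^ L * sqrt (1 + t)) * exp (- iabs n / (2 * sqrt (1 + t)))"
    using lap_kernel_exp_bound[of L] by blast
  define D where "D = exp (1 - M + M * ln M)"
  show ?thesis
  proof (intro exI[of _ "C * D * 2 powr M"] conjI allI impI)
    fix t :: real and n :: int assume t: "0 \<le> t"
    define r where "r = sqrt (1 + t)"
    define x where "x = iabs n / (2 * r)"
    have r: "r > 0" "1 + t = r\<^sup>2" using t by (auto simp: r_def)
    have x: "x \<ge> 0" using r by (simp add: x_def)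
    have "\<bar>lap_kernel L t n\<bar> \<le> C / ((1 + t) ^ L * r) * exp (- x)"
      using *[OF t, of n] by (simp add: r_def x_def)
    also have "\<dots> \<le> C / ((1 + t) ^ L * r) * (D * ((r + iabs n) / (2 * r)) powr (- M))"
    proof (intro mult_left_mono)
      have "(r + iabs n) / (2 * r) \<le> 1 + x" using r by (simp add: x_def field_simps)
      then have "(1 + x) powr (- M) \<le> ((r + iabs n) / (2 * r)) powr (- M)"
        using r M by (intro powr_mono2') auto
      then have "D * (1 + x) powr (- M) \<le> D * ((r + iabs n) / (2 * r)) powr (- M)"
        by (intro mult_left_mono) (auto simp: D_def)
      with order_trans[OF exp_minus_le_powr[OF M x], folded D_def]
      show "exp (- x) \<le> D * ((r + iabs n) / (2 * r)) powr (- M)"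
        by blast
    qed (use C r t in auto)
    also have "((r + iabs n) / (2 * r)) powr (- M) = (r + iabs n) powr (- M) * 2 powr M * r powr M"
      using r by (simp add: powr_divide powr_mult powr_minus field_simps)
    also have "C / ((1 + t) ^ L * r) = C * r powr (- 1 - 2 * real L)"
    proof -
      have "(1 + t) ^ L * r = r powr (2 * real L) * r powr 1"
      proof -
        have "r powr (2 * real L) = r powr real (2 * L)" by simp
        also have "\<dots> = (1 + t) ^ L" unfolding r(2) power_mult[symmetric] using r(1) by (rule powr_realpow)
        finally show ?thesis using r(1) by simp
      qed
      also have "\<dots> = r powr (1 + 2 * real L)" by (subst powr_add[symmetric]) (simp add: add.commute)
      finally have e: "(1 + t) ^ L * r = r powr (1 + 2 * real L)" .
      have "- 1 - 2 * real L = - (1 + 2 * real L)" by simp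
      then show ?thesis unfolding e by (simp only: powr_minus divide_inverse)
    qed
    finally have "\<bar>lap_kernel L t n\<bar> \<le> C * r powr (- 1 - 2 * real L) * (D * ((r + iabs n) powr (- M) * 2 powr M * r powr M))" .
    also have "\<dots> = C * D * 2 powr M * (r powr M * r powr (- 1 - 2 * real L)) * (r + iabs n) powr (- M)"
      by simp
    also have "r powr M * r powr (- 1 - 2 * real L) = r powr (M - 1 - 2 * real L)"
      by (simp add: powr_add[symmetric] algebra_simps)
    finally show "\<bar>lap_kernel L t n\<bar> \<le> C * D * 2 powr M * sqrt (1 + t) powr (M - 1 - 2 * real L) * (sqrt (1 + t) + iabs n) powr (- M)"
      by (simp add: r_def)
  qed (use C in \<open>simp add: D_def\<close>)
qed

lemma lap_kernel_Suc: "lap_kernel (Suc L) t = Lap (lap_kernel L t)"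
  by (simp add: lap_kernel_def Lap_heat expb_Lap_pow expb_delta)

lemma lap_kernel_0: "lap_kernel 0 t = heat_kernel t"
proof
  fix n
  have "infsum (\<lambda>j. heat_kernel t (n - j) * delta j) UNIV = infsum (\<lambda>j. heat_kernel t (n - j) * delta j) {0}"
    by (rule infsum_cong_neutral) (auto simp: delta_def)
  then show "lap_kernel 0 t n = heat_kernel t n" by (simp add: lap_kernel_def heat_def delta_def)
qed

lemma lap_kernel_has_sum:
  assumes f: "f \<in> expb"
  shows "((\<lambda>j. lap_kernel L t (n - j) * f j) has_sum heat t ((Lap ^^ L) f) n) UNIV"
proof (induction L arbitrary: n)
  case 0
  show ?case using heat_has_sum_kernel(1)[OF f, of t n] heat_eq[OF f, of t n] by (simp add: lap_kernel_0)
next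
  case (Suc L)
  have "((\<lambda>j. lap_kernel L t (n + 1 - j) * f j + (- 2) * (lap_kernel L t (n - j) * f j) + lap_kernel L t (n - 1 - j) * f j)
    has_sum (heat t ((Lap ^^ L) f) (n + 1) + (- 2) * heat t ((Lap ^^ L) f) n + heat t ((Lap ^^ L) f) (n - 1))) UNIV"
    by (intro has_sum_add has_sum_cmult_right Suc)
  moreover have "lap_kernel L t (n + 1 - j) * f j + (- 2) * (lap_kernel L t (n - j) * f j) + lap_kernel L t (n - 1 - j) * f j
     = lap_kernel (Suc L) t (n - j) * f j" for j
    by (simp add: lap_kernel_Suc discrete_laplacian_def algebra_simps)
  moreover have "heat t ((Lap ^^ L) f) (n + 1) + (- 2) * heat t ((Lap ^^ L) f) n + heat t ((Lap ^^ L) f) (n - 1)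
     = heat t ((Lap ^^ Suc L) f) n"
    using Lap_heat[OF expb_Lap_pow[OF f, of L], of t] by (simp add: discrete_laplacian_def fun_eq_iff)
  ultimately show ?case by simp
qed

section \<open>Mixed norms and the integral Minkowski inequality\<close>

lemma ennpowr_top [simp]: "ennpowr \<infinity> a = \<infinity>" "ennpowr top a = top"
  by (auto simp: ennpowr_def)

lemma ennpowr_ennreal [simp]: "x \<ge> 0 \<Longrightarrow> ennpowr (ennreal x) a = ennreal (x powr a)"
  by (simp add: ennpowr_def)

lemma ennpowr_0 [simp]: "ennpowr 0 a = 0"
  by (simp add: ennpowr_def)

lemma ennpowr_measurable [measurable]: "(\<lambda>x. ennpowr x a) \<in> borel_measurable borel"
  unfolding ennpowr_def by measurable

lemma ennpowr_mono: "x \<le> y \<Longrightarrow> a \<ge> 0 \<Longrightarrow> ennpowr x a \<le> ennpowr y a"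
  by (cases x; cases y) (auto simp: powr_mono2 top_unique)

lemma ennpowr_one [simp]: "ennpowr x 1 = x"
  by (cases x) auto

lemma ennpowr_ennpowr: "ennpowr (ennpowr x a) b = ennpowr x (a * b)"
  by (cases x) (auto simp: powr_powr)

lemma ennpowr_cmult: "c \<ge> 0 \<Longrightarrow> ennpowr (ennreal c * x) a = ennreal (c powr a) * ennpowr x a"
  by (cases x; cases "c = 0") (auto simp: powr_mult ennreal_mult[symmetric] ennreal_mult_top)

lemma ennpowr_eq_0 [simp]: "ennpowr x a = 0 \<longleftrightarrow> x = 0"
  by (cases x) (auto simp: ennreal_eq_0_iff)

lemma ennpowr_less_top [simp]: "ennpowr x a < top \<longleftrightarrow> x < top"
  by (cases x) auto

lemma ennreal_mult_divide_cancel: "r > 0 \<Longrightarrow> ennreal r * (x / ennreal r) = x"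
  by (cases x) (auto simp: divide_ennreal ennreal_mult[symmetric] ennreal_top_divide ennreal_mult_top)

text \<open>Convexity: x^P lies above its tangent at c. The constant term is moved to the right
  because all quantities live in [0, \<infinity>], where subtraction is awkward.\<close>

lemma ennpowr_tangent:
  assumes P: "P \<ge> 1" and c: "c \<ge> 0"
  shows "ennreal (P * c powr (P - 1)) * x \<le> ennpowr x P + ennreal ((P - 1) * c powr P)"
proof (cases x)
  case (real r)
  have "P * c powr (P - 1) * r \<le> r powr P + (P - 1) * c powr P"
  proof (cases "c = 0 \<or> r = 0")
    case False
    with c real have pos: "c > 0" "r > 0" by auto
    have "(r powr P) powr (1 / P) * (c powr P) powr (1 - 1 / P) \<le> 1 / P * (r powr P) + (1 - 1 / P) * (c powr P)"
      using P pos by (intro Youngs_inequality_0) auto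
    also have "(r powr P) powr (1 / P) = r" using P pos by (simp add: powr_powr)
    also have "(c powr P) powr (1 - 1 / P) = c powr (P - 1)" using P pos by (simp add: powr_powr right_diff_distrib)
    finally have "P * (r * c powr (P - 1)) \<le> P * (1 / P * (r powr P) + (1 - 1 / P) * (c powr P))"
      using P by (intro mult_left_mono) auto
    also have "\<dots> = r powr P + (P - 1) * c powr P" using P by (simp add: field_simps)
    finally show ?thesis by (simp add: mult_ac)
  qed (use P c real in auto)
  then show ?thesis
    using real P c by (simp add: ennreal_mult[symmetric] ennreal_plus[symmetric] del: ennreal_plus)
qed simp

text \<open>Jensen's inequality for a measure of total mass r: the tangent bound is integrated with
  the point of tangency at the mean value of h.\<close>

lemma nn_jensen:
  assumes h[measurable]: "h \<in> borel_measurable N" and R: "emeasure N (space N) = ennreal r" "r > 0" and P: "P \<ge> 1"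
  shows "ennpowr (\<integral>\<^sup>+y. h y \<partial>N) P \<le> ennreal (r powr (P - 1)) * (\<integral>\<^sup>+y. ennpowr (h y) P \<partial>N)"
proof (cases "\<integral>\<^sup>+y. ennpowr (h y) P \<partial>N")
  case (real v)
  \<comment> \<open>Finite mass and finite P-th moment force a finite integral, so that the mean c =
    s / r used as point of tangency is a real number.\<close>
  have "x \<le> 1 + ennpowr x P" for x :: ennreal
  proof (cases x)
    case (real u)
    have "u \<le> 1 + u powr P"
    proof (cases "u \<le> 1")
      case False
      then have "u powr 1 \<le> u powr P" using P by (intro powr_mono) auto
      with False show ?thesis by simp
    next
      case True
      with powr_ge_zero[of u P] show ?thesis by linarith
    qed
    with real show ?thesis by (simp add: ennreal_plus[symmetric] flip: ennreal_1 del: ennreal_plus)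
  qed simp
  then have "(\<integral>\<^sup>+y. h y \<partial>N) \<le> (\<integral>\<^sup>+y. 1 + ennpowr (h y) P \<partial>N)" by (intro nn_integral_mono)
  also have "\<dots> = ennreal r + ennreal v" using real R by (subst nn_integral_add) auto
  finally have "(\<integral>\<^sup>+y. h y \<partial>N) \<noteq> top"
    by (auto simp: top_unique)
  then obtain s where s: "(\<integral>\<^sup>+y. h y \<partial>N) = ennreal s" "s \<ge> 0" by (cases "\<integral>\<^sup>+y. h y \<partial>N") auto
  define c where "c = s / r"
  have c: "c \<ge> 0" "s = c * r" using s R by (auto simp: c_def)
  have "(\<integral>\<^sup>+y. ennreal (P * c powr (P - 1)) * h y \<partial>N) \<le> (\<integral>\<^sup>+y. ennpowr (h y) P + ennreal ((P - 1) * c powr P) \<partial>N)"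
    by (intro nn_integral_mono ennpowr_tangent P c)
  then have "ennreal (P * c powr (P - 1)) * ennreal s \<le> ennreal v + ennreal ((P - 1) * c powr P) * ennreal r"
    using s R real by (simp add: nn_integral_cmult nn_integral_add)
  then have "P * c powr (P - 1) * s \<le> v + (P - 1) * c powr P * r"
    using P c s R real by (simp add: ennreal_mult[symmetric] ennreal_plus[symmetric] del: ennreal_plus)
  moreover have "c powr (P - 1) * s = c powr P * r"
  proof (cases "c = 0")
    case False
    then have "c powr P = c powr (P - 1) * c" using c by (simp add: powr_mult_base[symmetric] mult.commute)
        (simp add: powr_diff)
    then show ?thesis using c by simp
  qed (use c in simp)
  ultimately have "c powr P * r \<le> v" by (simp add: algebra_simps)
  then have "c powr P * r * r powr (P - 1) \<le> v * r powr (P - 1)" by (intro mult_right_mono) auto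
  also have "c powr P * r * r powr (P - 1) = s powr P"
    using R c by (simp add: powr_mult powr_diff)
  finally have "s powr P \<le> r powr (P - 1) * v" by (simp add: mult.commute)
  then show ?thesis using s real R by (simp add: ennreal_mult[symmetric])
qed (use R in \<open>simp add: ennreal_mult_top\<close>)

lemma enn2real_ge_1: "1 \<le> p \<Longrightarrow> p \<noteq> \<infinity> \<Longrightarrow> 1 \<le> enn2real p"
  by (cases p) (auto simp flip: ennreal_1)

lemma Lnorm_le_iff:
  assumes "1 \<le> p" "p \<noteq> \<infinity>"
  shows "Lnorm M p g \<le> R \<longleftrightarrow> (\<integral>\<^sup>+x. ennpowr (g x) (enn2real p) \<partial>M) \<le> ennpowr R (enn2real p)"
proof -
  define P where "P = enn2real p"
  have P: "P \<ge> 1" using enn2real_ge_1[OF assms] by (simp add: P_def)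
  have "ennpowr I (1 / P) \<le> R \<longleftrightarrow> I \<le> ennpowr R P" for I
  proof
    assume "ennpowr I (1 / P) \<le> R"
    from ennpowr_mono[OF this, of P] P show "I \<le> ennpowr R P" by (simp add: ennpowr_ennpowr)
  next
    assume "I \<le> ennpowr R P"
    from ennpowr_mono[OF this, of "1 / P"] P show "ennpowr I (1 / P) \<le> R" by (simp add: ennpowr_ennpowr)
  qed
  then show ?thesis using assms by (simp add: Lnorm_def P_def)
qed

lemma Lnorm_finite_iff:
  assumes "p \<noteq> \<infinity>"
  shows "Lnorm M p g < \<infinity> \<longleftrightarrow> (\<integral>\<^sup>+x. ennpowr (g x) (enn2real p) \<partial>M) < \<infinity>"
  using assms by (simp add: Lnorm_def)

lemma Lnorm_AE_mono:
  assumes "f \<in> borel_measurable M" "AE x in M. f x \<le> g x" "1 \<le> p"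
  shows "Lnorm M p f \<le> Lnorm M p g"
proof (cases "p = \<infinity>")
  case False
  then have "enn2real p \<ge> 1" using enn2real_ge_1 assms(3) by auto
  with assms(2) have "(\<integral>\<^sup>+x. ennpowr (f x) (enn2real p) \<partial>M) \<le> (\<integral>\<^sup>+x. ennpowr (g x) (enn2real p) \<partial>M)"
    by (intro nn_integral_mono_AE) (auto elim!: eventually_mono intro: ennpowr_mono)
  then show ?thesis using False by (auto simp: Lnorm_def intro: ennpowr_mono)
qed (use assms in \<open>simp add: Lnorm_def esssup_AE_mono\<close>)

lemma Lnorm_mono:
  assumes "f \<in> borel_measurable M" "\<And>x. x \<in> space M \<Longrightarrow> f x \<le> g x" "1 \<le> p"
  shows "Lnorm M p f \<le> Lnorm M p g"
  using assms by (intro Lnorm_AE_mono AE_I2)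

lemma Lnorm_cmult_le:
  assumes [measurable]: "f \<in> borel_measurable M" and p: "1 \<le> p" and c: "c \<ge> 0"
  shows "Lnorm M p (\<lambda>x. ennreal c * f x) \<le> ennreal c * Lnorm M p f"
proof (cases "p = \<infinity>")
  case True
  have "AE x in M. ennreal c * f x \<le> ennreal c * esssup M f"
    using esssup_AE[of f M] by eventually_elim (rule mult_left_mono, auto)
  then show ?thesis using True by (auto simp: Lnorm_def)
next
  case False
  have "(\<integral>\<^sup>+x. ennpowr (ennreal c * f x) (enn2real p) \<partial>M) = ennreal (c powr enn2real p) * (\<integral>\<^sup>+x. ennpowr (f x) (enn2real p) \<partial>M)"
    using c by (simp add: ennpowr_cmult nn_integral_cmult)
  also have "\<dots> \<le> ennreal (c powr enn2real p) * ennpowr (Lnorm M p f) (enn2real p)"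
    using Lnorm_le_iff[OF p False, of M f "Lnorm M p f"] by (intro mult_left_mono) auto
  also have "\<dots> = ennpowr (ennreal c * Lnorm M p f) (enn2real p)" using c by (simp add: ennpowr_cmult)
  finally show ?thesis by (simp add: Lnorm_le_iff[OF p False])
qed

lemma Lnorm_add_finite:
  assumes [measurable]: "f \<in> borel_measurable M" "g \<in> borel_measurable M" and p: "1 \<le> p"
    and "Lnorm M p f < \<infinity>" "Lnorm M p g < \<infinity>"
  shows "Lnorm M p (\<lambda>x. f x + g x) < \<infinity>"
proof (cases "p = \<infinity>")
  case True
  have "AE x in M. f x + g x \<le> esssup M f + esssup M g"
    using esssup_AE[of f M] esssup_AE[of g M] by eventually_elim (rule add_mono)
  then have "esssup M (\<lambda>x. f x + g x) \<le> esssup M f + esssup M g" by (intro esssup_I) auto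
  also have "\<dots> < \<infinity>" using assms True by (simp add: Lnorm_def)
  finally show ?thesis using True by (simp add: Lnorm_def)
next
  case False
  define P where "P = enn2real p"
  have P: "P \<ge> 1" using enn2real_ge_1[OF p False] by (simp add: P_def)
  have le: "ennpowr (a + b) P \<le> ennreal (2 powr P) * (ennpowr a P + ennpowr b P)" for a b :: ennreal
  proof -
    have "a + b \<le> ennreal 2 * max a b" by (auto simp: max_def mult_2 intro: add_mono)
    then have "ennpowr (a + b) P \<le> ennpowr (ennreal 2 * max a b) P" using P by (intro ennpowr_mono) auto
    also have "\<dots> = ennreal (2 powr P) * ennpowr (max a b) P" by (subst ennpowr_cmult) auto
    also have "\<dots> \<le> ennreal (2 powr P) * (ennpowr a P + ennpowr b P)"
      by (intro mult_left_mono) (auto simp: max_def)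
    finally show ?thesis .
  qed
  have "(\<integral>\<^sup>+x. ennpowr (f x + g x) P \<partial>M) \<le> (\<integral>\<^sup>+x. ennreal (2 powr P) * (ennpowr (f x) P + ennpowr (g x) P) \<partial>M)"
    by (intro nn_integral_mono le)
  also have "\<dots> = ennreal (2 powr P) * ((\<integral>\<^sup>+x. ennpowr (f x) P \<partial>M) + (\<integral>\<^sup>+x. ennpowr (g x) P \<partial>M))"
    by (simp add: nn_integral_cmult nn_integral_add)
  also have "\<dots> < \<infinity>"
    using assms(4,5)[unfolded Lnorm_finite_iff[OF False]] by (simp add: P_def ennreal_mult_less_top)
  finally show ?thesis by (subst Lnorm_finite_iff[OF False]) (simp add: P_def)
qed

text \<open>A proof without duality. With h = g / \<rho> and the measure \<rho> dN of mass r, Jensen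
  gives (integral of g)^P <= r^{P-1} times the integral of h^P \<rho>; integrating in x and
  exchanging the integrals leaves r^P.\<close>

lemma Lnorm_Minkowski:
  assumes "sigma_finite_measure M" "sigma_finite_measure N" and p: "1 \<le> p"
    and g[measurable]: "case_prod g \<in> borel_measurable (M \<Otimes>\<^sub>M N)" and [measurable]: "\<rho> \<in> borel_measurable N"
    and le: "\<And>y. y \<in> space N \<Longrightarrow> Lnorm M p (\<lambda>x. g x y) \<le> \<rho> y"
  shows "Lnorm M p (\<lambda>x. \<integral>\<^sup>+y. g x y \<partial>N) \<le> (\<integral>\<^sup>+y. \<rho> y \<partial>N)"
proof -
  interpret M: sigma_finite_measure M by fact
  interpret N: sigma_finite_measure N by fact
  interpret pair_sigma_finite M N ..
  show ?thesis
  proof (cases "p = \<infinity>")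
    case True
    have "AE y in N. AE x in M. g x y \<le> \<rho> y"
    proof (rule AE_I2)
      fix y assume "y \<in> space N"
      from le[OF this] esssup_AE[of "\<lambda>x. g x y" M] True show "AE x in M. g x y \<le> \<rho> y"
        by (auto simp: Lnorm_def elim!: eventually_mono)
    qed
    then have "AE x in M. AE y in N. g x y \<le> \<rho> y" by (subst AE_commute) measurable
    then have "AE x in M. (\<integral>\<^sup>+y. g x y \<partial>N) \<le> (\<integral>\<^sup>+y. \<rho> y \<partial>N)"
      by (auto elim!: eventually_mono intro: nn_integral_mono_AE)
    then show ?thesis using True by (auto simp: Lnorm_def)
  next
    case False
    define P where "P = enn2real p"
    have P: "P \<ge> 1" using enn2real_ge_1[OF p False] by (simp add: P_def)
    have le': "(\<integral>\<^sup>+x. ennpowr (g x y) P \<partial>M) \<le> ennpowr (\<rho> y) P" if "y \<in> space N" for y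
      using le[OF that] unfolding Lnorm_le_iff[OF p False] P_def .
    \<comment> \<open>Where \<rho> vanishes the quotient g / \<rho> is meaningless, but there g
      vanishes for almost every x; exchanging the order of the quantifiers makes this usable at
      fixed x.\<close>
    have "AE y in N. AE x in M. \<rho> y = 0 \<longrightarrow> g x y = 0"
    proof (rule AE_I2)
      fix y assume y: "y \<in> space N"
      have "\<rho> y = 0 \<Longrightarrow> AE x in M. g x y = 0"
      proof -
        assume "\<rho> y = 0"
        with le'[OF y] have "(\<integral>\<^sup>+x. ennpowr (g x y) P \<partial>M) = 0" by simp
        then show ?thesis using y by (subst (asm) nn_integral_0_iff_AE) auto
      qed
      then show "AE x in M. \<rho> y = 0 \<longrightarrow> g x y = 0" by auto
    qed
    then have zero: "AE x in M. AE y in N. \<rho> y = 0 \<longrightarrow> g x y = 0" by (subst AE_commute) measurable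
    show ?thesis
    proof (cases "(\<integral>\<^sup>+y. \<rho> y \<partial>N)")
      case (real r)
      then have fin: "AE y in N. \<rho> y \<noteq> \<infinity>" by (intro nn_integral_PInf_AE) auto
      show ?thesis
      proof (cases "r = 0")
        case True
        with real have "(\<integral>\<^sup>+y. \<rho> y \<partial>N) = 0" by simp
        then have rho0: "AE y in N. \<rho> y = 0" by (subst (asm) nn_integral_0_iff_AE) auto
        from zero have "AE x in M. (\<integral>\<^sup>+y. g x y \<partial>N) \<le> 0"
        proof (eventually_elim)
          case (elim x)
          with rho0 have "AE y in N. g x y \<le> 0" by auto
          from nn_integral_mono_AE[OF this] show ?case by simp
        qed
        from Lnorm_AE_mono[OF _ this p] have "Lnorm M p (\<lambda>x. \<integral>\<^sup>+y. g x y \<partial>N) \<le> Lnorm M p (\<lambda>x. 0)" by simp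
        also have "\<dots> = 0" using False by (simp add: Lnorm_def)
        finally show ?thesis by simp
      next
        case False
        then have r: "r > 0" using real by simp
        \<comment> \<open>A real-valued version of \<rho>, equal to it almost everywhere because its
          integral is finite.\<close>
        define \<rho>' where "\<rho>' y = ennreal (enn2real (\<rho> y))" for y
        define h where "h x y = (if \<rho>' y = 0 then 0 else g x y / \<rho>' y)" for x y
        \<comment> \<open>The weight \<rho>^{1-P} that remains when \<rho> h^P is expressed through
          g^P.\<close>
        define w where "w y = (if \<rho>' y = 0 then 0 else ennreal (enn2real (\<rho> y) powr (1 - P)))" for y
        have [measurable]: "\<rho>' \<in> borel_measurable N" unfolding \<rho>'_def by measurable
        have [measurable]: "w \<in> borel_measurable N" unfolding w_def by measurable
        have [measurable]: "case_prod h \<in> borel_measurable (M \<Otimes>\<^sub>M N)" unfolding h_def by measurable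
        have "(\<integral>\<^sup>+y. \<rho>' y \<partial>N) = (\<integral>\<^sup>+y. \<rho> y \<partial>N)"
          by (intro nn_integral_cong_AE) (use fin in \<open>auto simp: \<rho>'_def ennreal_enn2real_if elim!: eventually_mono\<close>)
        then have R: "emeasure (density N \<rho>') (space (density N \<rho>')) = ennreal r"
          using real by (simp add: emeasure_density cong: nn_integral_cong)
        have gh: "AE x in M. (\<integral>\<^sup>+y. g x y \<partial>N) = (\<integral>\<^sup>+y. h x y \<partial>density N \<rho>')"
          using zero AE_space
        proof eventually_elim
          case (elim x)
          have "AE y in N. g x y = \<rho>' y * h x y"
            using elim(1) fin
          proof eventually_elim
            case (elim y)
            then show ?case
              by (cases "\<rho> y") (auto simp: \<rho>'_def h_def ennreal_eq_0_iff ennreal_mult_divide_cancel)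
          qed
          then show ?case using elim(2) by (subst nn_integral_density) (auto intro: nn_integral_cong_AE)
        qed
        have hw: "\<rho>' y * ennpowr (h x y) P = w y * ennpowr (g x y) P" for x y
        proof (cases "enn2real (\<rho> y) = 0")
          case False
          define u where "u = enn2real (\<rho> y)"
          have u: "u > 0" using False by (simp add: u_def less_le)
          have "h x y = ennreal (1 / u) * g x y"
            using u by (simp add: h_def \<rho>'_def u_def[symmetric] divide_ennreal_def inverse_ennreal inverse_eq_divide mult.commute)
          then have "ennreal u * ennpowr (h x y) P = ennreal (u * (1 / u) powr P) * ennpowr (g x y) P"
            using u by (simp add: ennpowr_cmult ennreal_mult mult.assoc)
          also have "u * (1 / u) powr P = u powr (1 - P)"
            using u by (simp add: powr_diff powr_divide)
          finally show ?thesis using u by (simp add: w_def \<rho>'_def u_def[symmetric])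
        qed (simp add: \<rho>'_def w_def)
        have "(\<integral>\<^sup>+x. ennpowr (\<integral>\<^sup>+y. g x y \<partial>N) P \<partial>M) = (\<integral>\<^sup>+x. ennpowr (\<integral>\<^sup>+y. h x y \<partial>density N \<rho>') P \<partial>M)"
          by (intro nn_integral_cong_AE) (use gh in \<open>auto elim!: eventually_mono\<close>)
        also have "\<dots> \<le> (\<integral>\<^sup>+x. ennreal (r powr (P - 1)) * (\<integral>\<^sup>+y. ennpowr (h x y) P \<partial>density N \<rho>') \<partial>M)"
          by (intro nn_integral_mono nn_jensen[OF _ R r P]) measurable
        also have "\<dots> = ennreal (r powr (P - 1)) * (\<integral>\<^sup>+x. (\<integral>\<^sup>+y. w y * ennpowr (g x y) P \<partial>N) \<partial>M)"
        proof -
          have "(\<integral>\<^sup>+y. ennpowr (h x y) P \<partial>density N \<rho>') = (\<integral>\<^sup>+y. w y * ennpowr (g x y) P \<partial>N)" if "x \<in> space M" for x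
            using that by (subst nn_integral_density) (auto simp: hw)
          then show ?thesis by (subst nn_integral_cmult[symmetric]) (auto cong: nn_integral_cong)
        qed
        also have "(\<integral>\<^sup>+x. (\<integral>\<^sup>+y. w y * ennpowr (g x y) P \<partial>N) \<partial>M) = (\<integral>\<^sup>+y. (\<integral>\<^sup>+x. w y * ennpowr (g x y) P \<partial>M) \<partial>N)"
          by (rule Fubini'[symmetric]) measurable
        also have "\<dots> \<le> (\<integral>\<^sup>+y. \<rho>' y \<partial>N)"
        proof (intro nn_integral_mono_AE)
          show "AE y in N. (\<integral>\<^sup>+x. w y * ennpowr (g x y) P \<partial>M) \<le> \<rho>' y"
            using fin AE_space
          proof eventually_elim
            case (elim y)
            have "(\<integral>\<^sup>+x. w y * ennpowr (g x y) P \<partial>M) = w y * (\<integral>\<^sup>+x. ennpowr (g x y) P \<partial>M)"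
              using elim by (intro nn_integral_cmult) measurable
            also have "\<dots> \<le> w y * ennpowr (\<rho> y) P" using elim by (intro mult_left_mono le') auto
            also have "\<dots> \<le> \<rho>' y"
              using elim by (cases "\<rho> y")
                (auto simp: w_def \<rho>'_def ennreal_mult[symmetric] powr_add[symmetric])
            finally show ?case .
          qed
        qed
        also have "(\<integral>\<^sup>+y. \<rho>' y \<partial>N) = ennreal r" using R by (simp add: emeasure_density cong: nn_integral_cong)
        also have "ennreal (r powr (P - 1)) * ennreal r = ennpowr (ennreal r) P"
          using r by (simp add: ennreal_mult[symmetric] powr_diff)
        finally have "(\<integral>\<^sup>+x. ennpowr (\<integral>\<^sup>+y. g x y \<partial>N) P \<partial>M) \<le> ennpowr (\<integral>\<^sup>+y. \<rho> y \<partial>N) P"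
          using real by (simp add: mult_left_mono)
        then show ?thesis using \<open>p \<noteq> \<infinity>\<close> by (subst Lnorm_le_iff[OF p]) (auto simp: P_def)
      qed
    qed simp
  qed
qed

lemma sigma_finite_count_int: "sigma_finite_measure (count_space (UNIV :: 'a::countable set))"
  by (rule sigma_finite_measure_count_space)

text \<open>Minkowski's inequality in the form used throughout: u is only dominated pointwise by an
  integral. Measurability in y for each n is enough because the integers are countable.\<close>

lemma lp_norm_le_integral:
  assumes "sigma_finite_measure N" and p: "1 \<le> p"
    and G: "\<And>n. (\<lambda>y. G y n) \<in> borel_measurable N" and rho: "\<rho> \<in> borel_measurable N"
    and u: "\<And>n. ennreal \<bar>u n\<bar> \<le> (\<integral>\<^sup>+y. G y n \<partial>N)"
    and le: "\<And>y. y \<in> space N \<Longrightarrow> Lnorm (count_space UNIV) p (G y) \<le> \<rho> y"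
  shows "lp_norm p u \<le> (\<integral>\<^sup>+y. \<rho> y \<partial>N)"
proof -
  have "lp_norm p u \<le> Lnorm (count_space UNIV) p (\<lambda>n. \<integral>\<^sup>+y. G y n \<partial>N)"
    unfolding lp_norm_def by (intro Lnorm_mono u p) auto
  also have "\<dots> \<le> (\<integral>\<^sup>+y. \<rho> y \<partial>N)"
  proof (rule Lnorm_Minkowski[OF sigma_finite_count_int assms(1) p _ rho])
    show "(\<lambda>(n, y). G y n) \<in> borel_measurable (count_space UNIV \<Otimes>\<^sub>M N)"
      by (rule measurable_pair_measure_countable1) (use G in auto)
  qed (use le in simp)
  finally show ?thesis .
qed

lemma lp_norm_measurable:
  assumes p: "1 \<le> p" and F[measurable]: "\<And>n. (\<lambda>t. F t n) \<in> borel_measurable M"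
  shows "(\<lambda>t. lp_norm p (F t)) \<in> borel_measurable M"
proof (cases "p = \<infinity>")
  case True
  then show ?thesis by (simp add: lp_norm_infinity[unfolded infinity_ennreal_def])
next
  case False
  interpret sigma_finite_measure "count_space (UNIV::int set)" by (rule sigma_finite_count_int)
  have "(\<lambda>(t, n). ennpowr (ennreal \<bar>F t n\<bar>) (enn2real p)) \<in> borel_measurable (M \<Otimes>\<^sub>M count_space UNIV)"
    using measurable_compose_countable[of "\<lambda>n x. ennpowr (ennreal \<bar>F (fst x) n\<bar>) (enn2real p)" "M \<Otimes>\<^sub>M count_space UNIV" borel snd]
    by (simp add: case_prod_unfold)
  then show ?thesis using False unfolding lp_norm_def Lnorm_def
    by (auto intro!: measurable_compose[OF _ ennpowr_measurable] borel_measurable_nn_integral)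
qed

lemma lp_norm_cmult_le: "1 \<le> p \<Longrightarrow> lp_norm p (\<lambda>n. c * u n) \<le> ennreal \<bar>c\<bar> * lp_norm p u"
  unfolding lp_norm_def using Lnorm_cmult_le[of "\<lambda>n. ennreal \<bar>u n\<bar>" "count_space UNIV" p "\<bar>c\<bar>"]
  by (simp add: abs_mult ennreal_mult)

lemma lp_norm_shift: "1 \<le> p \<Longrightarrow> lp_norm p (\<lambda>n. u (n + c)) = lp_norm p u"
proof (cases "p = \<infinity>")
  case True
  have "range (\<lambda>n. ennreal \<bar>u (n + c)\<bar>) = range (\<lambda>n. ennreal \<bar>u n\<bar>)"
    by (auto simp: image_iff) (metis diff_add_cancel)
  with True show ?thesis by (simp add: lp_norm_infinity[unfolded infinity_ennreal_def])
next
  case False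
  have "(\<integral>\<^sup>+n. ennpowr (ennreal \<bar>u (n + c)\<bar>) (enn2real p) \<partial>count_space UNIV) =
     (\<integral>\<^sup>+n. ennpowr (ennreal \<bar>u n\<bar>) (enn2real p) \<partial>count_space UNIV)"
    by (rule nn_integral_bij_count_space[where g = "\<lambda>n. n + c"])
       (rule bij_betwI[where g = "\<lambda>n. n - c"], auto)
  with False show ?thesis by (simp add: lp_norm_def Lnorm_def)
qed

lemma abs_le_lp_norm:
  assumes p: "1 \<le> p"
  shows "ennreal \<bar>u n\<bar> \<le> lp_norm p u"
proof (cases "p = \<infinity>")
  case True
  then show ?thesis by (auto simp: lp_norm_infinity[unfolded infinity_ennreal_def] intro: SUP_upper)
next
  case False
  define P where "P = enn2real p"
  have P: "P \<ge> 1" using enn2real_ge_1[OF p False] by (simp add: P_def)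
  have "ennpowr (ennreal \<bar>u n\<bar>) P = (\<integral>\<^sup>+m. ennpowr (ennreal \<bar>u m\<bar>) P * indicator {n} m \<partial>count_space UNIV)"
    by (subst nn_integral_indicator_singleton) auto
  also have "\<dots> \<le> (\<integral>\<^sup>+m. ennpowr (ennreal \<bar>u m\<bar>) P \<partial>count_space UNIV)"
    by (intro nn_integral_mono) (auto simp: indicator_def)
  finally have "ennpowr (ennpowr (ennreal \<bar>u n\<bar>) P) (1 / P)
    \<le> ennpowr (\<integral>\<^sup>+m. ennpowr (ennreal \<bar>u m\<bar>) P \<partial>count_space UNIV) (1 / P)"
    by (rule ennpowr_mono) (use P in simp)
  also have "\<dots> = lp_norm p u" using False by (simp add: lp_norm_def Lnorm_def P_def)
  finally show ?thesis unfolding ennpowr_ennpowr using P by simp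
qed

section \<open>The measure dt/t and its invariance under dilations\<close>

lemma space_dt [simp]: "space dt_over_t = {0<..}"
  by (simp add: dt_over_t_def space_restrict_space)

lemma measurable_dt [measurable (raw)]:
  "f \<in> borel_measurable borel \<Longrightarrow> f \<in> borel_measurable dt_over_t"
  unfolding dt_over_t_def by (simp add: measurable_restrict_space1)

lemma sigma_finite_dt: "sigma_finite_measure dt_over_t"
proof -
  interpret sigma_finite_measure "restrict_space lborel {0::real<..}"
    by (rule sigma_finite_measure_restrict_space) (auto intro: lborel.sigma_finite_measure_axioms)
  show ?thesis unfolding dt_over_t_def
    by (subst sigma_finite_iff_density_finite) (auto intro!: measurable_restrict_space1)
qed

lemma nn_integral_dt:
  assumes [measurable]: "f \<in> borel_measurable borel"
  shows "(\<integral>\<^sup>+t. f t \<partial>dt_over_t) = (\<integral>\<^sup>+t\<in>{0<..}. ennreal (1 / t) * f t \<partial>lborel)"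
  unfolding dt_over_t_def
  by (subst nn_integral_density) (auto intro!: measurable_restrict_space1 simp: nn_integral_restrict_space)

lemma nn_integral_dt_scale:
  assumes f[measurable]: "f \<in> borel_measurable borel" and c: "c > 0"
  shows "(\<integral>\<^sup>+t. f (c * t) \<partial>dt_over_t) = (\<integral>\<^sup>+t. f t \<partial>dt_over_t)"
proof -
  have "(\<integral>\<^sup>+t. f t \<partial>dt_over_t) = ennreal \<bar>c\<bar> * (\<integral>\<^sup>+t. ennreal (1 / (0 + c * t)) * f (0 + c * t) * indicator {0<..} (0 + c * t) \<partial>lborel)"
    unfolding nn_integral_dt[OF f] using c by (intro nn_integral_real_affine) auto
  also have "\<dots> = (\<integral>\<^sup>+t. ennreal \<bar>c\<bar> * (ennreal (1 / (0 + c * t)) * f (0 + c * t) * indicator {0<..} (0 + c * t)) \<partial>lborel)"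
    by (rule nn_integral_cmult[symmetric]) measurable
  also have "\<dots> = (\<integral>\<^sup>+t\<in>{0<..}. ennreal (1 / t) * f (c * t) \<partial>lborel)"
  proof (rule nn_integral_cong)
    fix t
    show "ennreal \<bar>c\<bar> * (ennreal (1 / (0 + c * t)) * f (0 + c * t) * indicator {0<..} (0 + c * t)) =
       ennreal (1 / t) * f (c * t) * indicator {0<..} t"
    proof (cases "t > 0")
      case True
      then have "ennreal \<bar>c\<bar> * ennreal (1 / (c * t)) = ennreal (1 / t)"
        using c by (simp add: ennreal_mult[symmetric])
      with True c show ?thesis by (simp add: mult.assoc[symmetric])
    qed (use c in \<open>auto simp: zero_less_mult_iff\<close>)
  qed
  also have "\<dots> = (\<integral>\<^sup>+t. f (c * t) \<partial>dt_over_t)" by (rule nn_integral_dt[symmetric]) measurable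
  finally show ?thesis ..
qed

lemma Lnorm_dt_scale:
  assumes f[measurable]: "f \<in> borel_measurable borel" and c: "c > 0" and q: "1 \<le> q"
  shows "Lnorm dt_over_t q (\<lambda>t. f (c * t)) \<le> Lnorm dt_over_t q f"
proof (cases "q = \<infinity>")
  case True
  define A where "A = esssup dt_over_t f"
  \<comment> \<open>The essential supremum is handled by applying the invariance of the integral to
    the indicator of the exceptional set where f exceeds A.\<close>
  let ?h = "\<lambda>t. indicator {t. f t > A} t :: ennreal"
  have "AE t in dt_over_t. f t \<le> A" unfolding A_def by (rule esssup_AE)
  then have "(\<integral>\<^sup>+t. ?h t \<partial>dt_over_t) = 0"
    by (subst nn_integral_0_iff_AE) (auto elim!: eventually_mono simp: indicator_def)
  then have "(\<integral>\<^sup>+t. ?h (c * t) \<partial>dt_over_t) = 0"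
    using nn_integral_dt_scale[of ?h c] c by simp
  then have "AE t in dt_over_t. ?h (c * t) = 0"
    by (subst (asm) nn_integral_0_iff_AE) auto
  then have "AE t in dt_over_t. f (c * t) \<le> A"
    by (auto elim!: eventually_mono simp: indicator_def not_less split: if_splits)
  then show ?thesis using True by (auto simp: Lnorm_def A_def)
next
  case False
  then show ?thesis using nn_integral_dt_scale[of "\<lambda>t. ennpowr (f t) (enn2real q)" c] c
    by (simp add: Lnorm_def)
qed

section \<open>Semigroup estimates in \<open>\<ell>\<^sup>p\<close>\<close>

lemma has_sum_nn_integral:
  fixes h :: "'a \<Rightarrow> real"
  assumes "(h has_sum S) UNIV" "\<And>x. h x \<ge> 0"
  shows "(\<integral>\<^sup>+x. ennreal (h x) \<partial>count_space UNIV) = ennreal S"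
proof -
  have "(\<lambda>x. norm (h x)) summable_on UNIV"
    using has_sum_imp_summable[OF assms(1)] assms(2) by simp
  then have s: "Infinite_Set_Sum.abs_summable_on h UNIV"
    using abs_summable_equivalent by blast
  show ?thesis
    using nn_integral_conv_infsetsum[OF s] infsetsum_infsum[OF s] infsumI[OF assms(1)] assms(2) by simp
qed

lemma has_sum_abs_le_nn_integral:
  fixes h :: "'a \<Rightarrow> real"
  assumes "(h has_sum S) UNIV"
  shows "ennreal \<bar>S\<bar> \<le> (\<integral>\<^sup>+x. ennreal \<bar>h x\<bar> \<partial>count_space UNIV)"
proof -
  have s: "(\<lambda>x. \<bar>h x\<bar>) summable_on UNIV"
    using has_sum_imp_summable[OF assms] summable_on_iff_abs_summable_on_real by fastforce
  have "\<bar>S\<bar> \<le> infsum (\<lambda>x. \<bar>h x\<bar>) UNIV"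
    using norm_infsum_bound[of h UNIV] s infsumI[OF assms] by simp
  moreover have "(\<integral>\<^sup>+x. ennreal \<bar>h x\<bar> \<partial>count_space UNIV) = ennreal (infsum (\<lambda>x. \<bar>h x\<bar>) UNIV)"
    by (intro has_sum_nn_integral has_sum_infsum s) auto
  ultimately show ?thesis by (simp add: ennreal_leI)
qed

text \<open>Young's inequality with K in l^1: Minkowski over the translates of f, whose norms all
  agree.\<close>

lemma lp_norm_conv:
  assumes p: "1 \<le> p" and g: "\<And>n. ((\<lambda>j. K (n - j) * f j) has_sum g n) UNIV"
  shows "lp_norm p g \<le> (\<integral>\<^sup>+j. ennreal \<bar>K j\<bar> \<partial>count_space UNIV) * lp_norm p f"
proof -
  have "lp_norm p g \<le> (\<integral>\<^sup>+j. ennreal \<bar>K j\<bar> * lp_norm p f \<partial>count_space UNIV)"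
  proof (rule lp_norm_le_integral[OF sigma_finite_count_int p, where G = "\<lambda>j n. ennreal \<bar>K j\<bar> * ennreal \<bar>f (n - j)\<bar>"])
    fix n
    have "ennreal \<bar>g n\<bar> \<le> (\<integral>\<^sup>+j. ennreal \<bar>K (n - j) * f j\<bar> \<partial>count_space UNIV)"
      by (rule has_sum_abs_le_nn_integral[OF g])
    also have "\<dots> = (\<integral>\<^sup>+j. ennreal \<bar>K (n - (n - j)) * f (n - j)\<bar> \<partial>count_space UNIV)"
      by (rule nn_integral_bij_count_space[symmetric]) (rule bij_betwI[where g = "\<lambda>j. n - j"], auto)
    finally show "ennreal \<bar>g n\<bar> \<le> (\<integral>\<^sup>+j. ennreal \<bar>K j\<bar> * ennreal \<bar>f (n - j)\<bar> \<partial>count_space UNIV)"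
      by (simp add: abs_mult ennreal_mult)
  next
    fix j
    have "Lnorm (count_space UNIV) p (\<lambda>n. ennreal \<bar>K j\<bar> * ennreal \<bar>f (n - j)\<bar>)
      \<le> ennreal \<bar>K j\<bar> * lp_norm p (\<lambda>n. f (n + (- j)))"
      unfolding lp_norm_def by (simp add: Lnorm_cmult_le[OF _ p])
    then show "Lnorm (count_space UNIV) p (\<lambda>n. ennreal \<bar>K j\<bar> * ennreal \<bar>f (n - j)\<bar>) \<le> ennreal \<bar>K j\<bar> * lp_norm p f"
      unfolding lp_norm_shift[OF p] .
  qed auto
  also have "\<dots> = (\<integral>\<^sup>+j. ennreal \<bar>K j\<bar> \<partial>count_space UNIV) * lp_norm p f"
    by (rule nn_integral_multc) simp
  finally show ?thesis .
qed

text \<open>The heat kernel is nonnegative and has mass 1, as the flow fixes constants; hence the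
  flow is a contraction.\<close>

lemma lp_norm_heat:
  assumes p: "1 \<le> p" and t: "t \<ge> 0" and f: "f \<in> expb"
  shows "lp_norm p (heat t f) \<le> lp_norm p f"
proof -
  have K: "heat_kernel t j \<ge> 0" for j by (rule heat_kernel_nonneg[OF t])
  have "((\<lambda>j. heat_kernel t (0 - j) * 1) has_sum heat t (\<lambda>_. 1) 0) UNIV"
    using lap_kernel_has_sum[OF expb_const, of 0 t 0 1] by (simp add: lap_kernel_0)
  then have "(\<integral>\<^sup>+j. ennreal (heat_kernel t (- j)) \<partial>count_space UNIV) = 1"
    using has_sum_nn_integral[of "\<lambda>j. heat_kernel t (- j)" 1] K by (simp add: heat_const)
  moreover have "(\<integral>\<^sup>+j. ennreal (heat_kernel t (- j)) \<partial>count_space UNIV) = (\<integral>\<^sup>+j. ennreal (heat_kernel t j) \<partial>count_space UNIV)"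
    by (rule nn_integral_bij_count_space) (rule bij_betwI[where g = uminus], auto)
  ultimately have 1: "(\<integral>\<^sup>+j. ennreal \<bar>heat_kernel t j\<bar> \<partial>count_space UNIV) = 1" using K by simp
  have "lp_norm p (heat t f) \<le> (\<integral>\<^sup>+j. ennreal \<bar>heat_kernel t j\<bar> \<partial>count_space UNIV) * lp_norm p f"
    using lap_kernel_has_sum[OF f, of 0 t] by (intro lp_norm_conv p) (simp add: lap_kernel_0)
  then show ?thesis by (simp add: 1)
qed

lemma lp_norm_heat_antimono:
  assumes p: "1 \<le> p" and "0 \<le> r" "r \<le> s" and f: "f \<in> expb"
  shows "lp_norm p (heat s f) \<le> lp_norm p (heat r f)"
  using lp_norm_heat[OF p, of "s - r" "heat r f"] assms by (simp add: heat_heat expb_heat)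

lemma lp_norm_heat_measurable:
  assumes "1 \<le> p" "f \<in> expb"
  shows "(\<lambda>t. lp_norm p (heat t f)) \<in> borel_measurable borel"
proof (rule lp_norm_measurable[OF assms(1)])
  fix n
  have "continuous_on UNIV (\<lambda>t. heat t f n)"
    by (rule DERIV_continuous_on[OF DERIV_subset[OF heat_has_derivative[OF assms(2)]]]) simp
  then show "(\<lambda>t. heat t f n) \<in> borel_measurable borel" by (rule borel_measurable_continuous_onI)
qed

lemma heat_measurable: "f \<in> expb \<Longrightarrow> (\<lambda>t. heat t f n) \<in> borel_measurable borel"
  by (rule borel_measurable_continuous_onI, rule DERIV_continuous_on[OF DERIV_subset[OF heat_has_derivative]]) auto

text \<open>Comparison with the telescoping series of \<open>(a + j)\<^sup>-\<^sup>c\<close>.\<close>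

lemma nn_integral_powr_nat:
  assumes a: "a > 0" and c: "c > 0"
  shows "(\<integral>\<^sup>+j. ennreal ((a + real j) powr (- 1 - c)) \<partial>count_space (UNIV :: nat set)) \<le> ennreal (a powr (- 1 - c) + a powr (- c) / c)"
proof -
  define F where "F j = (a + real j) powr (- c) / c" for j
  have F: "(a + real (Suc j)) powr (- 1 - c) \<le> F j - F (Suc j)" for j
  proof -
    have "\<exists>z. a + real j < z \<and> z < a + real (Suc j) \<and>
      (a + real (Suc j)) powr (- c) / c - (a + real j) powr (- c) / c = (a + real (Suc j) - (a + real j)) * (- (z powr (- c - 1)))"
    proof (rule MVT2)
      fix x assume "a + real j \<le> x" "x \<le> a + real (Suc j)"
      then have "x > 0" using a by simp
      then show "((\<lambda>x. x powr (- c) / c) has_real_derivative - (x powr (- c - 1))) (at x)"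
        using c by (auto intro!: derivative_eq_intros)
    qed simp
    then obtain z where z: "a + real j < z" "z < a + real (Suc j)" "F (Suc j) - F j = - (z powr (- c - 1))"
      by (auto simp: F_def)
    have "(a + real (Suc j)) powr (- c - 1) \<le> z powr (- c - 1)"
      using z a c by (intro powr_mono2') auto
    moreover have e: "- c - 1 = - 1 - c" by simp
    ultimately show ?thesis using z(3) unfolding e by linarith
  qed
  have "F \<longlonglongrightarrow> 0 / c" unfolding F_def
    by (intro tendsto_divide tendsto_neg_powr filterlim_tendsto_add_at_top[OF tendsto_const filterlim_real_sequentially])
       (use c in auto)
  from telescope_sums'[OF this] have T: "(\<lambda>j. F j - F (Suc j)) sums (F 0)" by simp
  let ?g = "\<lambda>j. (a + real (Suc j)) powr (- 1 - c)"
  have sg: "summable ?g"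
    by (rule summable_comparison_test'[OF sums_summable[OF T], of 0]) (use F in auto)
  have "suminf ?g \<le> F 0"
    using suminf_le[OF F sg sums_summable[OF T]] sums_unique[OF T] by simp
  have "(\<integral>\<^sup>+j. ennreal ((a + real j) powr (- 1 - c)) \<partial>count_space (UNIV :: nat set)) = (\<Sum>j. ennreal ((a + real j) powr (- 1 - c)))"
    by (rule nn_integral_count_space_nat)
  also have "\<dots> = ennreal (a powr (- 1 - c)) + (\<Sum>j. ennreal (?g j))"
    by (subst suminf_offset[where i = 1]) (auto simp: add.commute)
  also have "(\<Sum>j. ennreal (?g j)) = ennreal (suminf ?g)" by (rule suminf_ennreal2) (use sg in auto)
  also have "ennreal (a powr (- 1 - c)) + ennreal (suminf ?g) \<le> ennreal (a powr (- 1 - c)) + ennreal (F 0)"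
    using \<open>suminf ?g \<le> F 0\<close> by (intro add_left_mono ennreal_leI)
  also have "\<dots> = ennreal (a powr (- 1 - c) + a powr (- c) / c)" using c by (simp add: F_def)
  finally show ?thesis .
qed

lemma nn_integral_powr_int:
  assumes c: "c > 0"
  shows "\<exists>D\<ge>0. \<forall>a\<ge>1. (\<integral>\<^sup>+j. ennreal ((a + iabs j) powr (- 1 - c)) \<partial>count_space UNIV) \<le> ennreal (D * a powr (- c))"
proof (intro exI[of _ "2 * (1 + 1 / c)"] conjI allI impI)
  fix a :: real assume a: "a \<ge> 1"
  let ?f = "\<lambda>j::int. ennreal ((a + iabs j) powr (- 1 - c))"
  let ?N = "(\<integral>\<^sup>+j. ennreal ((a + real j) powr (- 1 - c)) \<partial>count_space (UNIV :: nat set))"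
  \<comment> \<open>Since a >= 1, the first term of the one-sided sum is absorbed into the power
    a^{-c} of its tail.\<close>
  have "a powr (- 1 - c) \<le> a powr (- c)" using a by (intro powr_mono) auto
  then have N: "?N \<le> ennreal ((1 + 1 / c) * a powr (- c))"
    by (intro order_trans[OF nn_integral_powr_nat[of a c] ennreal_leI]) (use a c in \<open>auto simp: algebra_simps\<close>)
  have 1: "(\<integral>\<^sup>+j. ?f j * indicator {0..} j \<partial>count_space UNIV) = ?N"
  proof -
    have "?N = (\<integral>\<^sup>+j. ?f (int j) \<partial>count_space UNIV)" by simp
    also have "\<dots> = (\<integral>\<^sup>+j. ?f j \<partial>count_space {0..})"
      by (rule nn_integral_bij_count_space) (rule bij_betwI[where g = nat], auto)
    finally show ?thesis by (simp add: nn_integral_count_space_indicator)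
  qed
  have 2: "(\<integral>\<^sup>+j. ?f j * indicator {..0} j \<partial>count_space UNIV) = ?N"
  proof -
    have "?N = (\<integral>\<^sup>+j. ?f (- int j) \<partial>count_space UNIV)" by simp
    also have "\<dots> = (\<integral>\<^sup>+j. ?f j \<partial>count_space {..0})"
      by (rule nn_integral_bij_count_space) (rule bij_betwI[where g = "\<lambda>j. nat (- j)"], auto)
    finally show ?thesis by (simp add: nn_integral_count_space_indicator)
  qed
  have "(\<integral>\<^sup>+j. ?f j \<partial>count_space UNIV) \<le> (\<integral>\<^sup>+j. ?f j * indicator {0..} j + ?f j * indicator {..0} j \<partial>count_space UNIV)"
    by (intro nn_integral_mono) (auto simp: indicator_def)
  also have "\<dots> = ?N + ?N" by (subst nn_integral_add) (auto simp: 1 2)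
  also have "\<dots> \<le> ennreal ((1 + 1 / c) * a powr (- c)) + ennreal ((1 + 1 / c) * a powr (- c))"
    by (intro add_mono N)
  also have "\<dots> = ennreal (2 * (1 + 1 / c) * a powr (- c))"
    using c by (simp flip: ennreal_plus)
  finally show "(\<integral>\<^sup>+j. ?f j \<partial>count_space UNIV) \<le> ennreal (2 * (1 + 1 / c) * a powr (- c))" .
qed (use c in simp)

text \<open>The l^1 norm of the kernel of \<Delta> e^{t\<Delta>}: with r = sqrt(1 + t) and M = 2 the
  kernel bound is C r^{-1} (r + |n|)^{-2}, and summing over n gains another r^{-1}.\<close>

lemma lp_norm_heat_Lap:
  assumes p: "1 \<le> p"
  shows "\<exists>C\<ge>0. \<forall>t>0. \<forall>f\<in>expb. lp_norm p (heat t (Lap f)) \<le> ennreal (C / t) * lp_norm p f"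
proof -
  obtain C where C: "C \<ge> 0" and K: "\<And>t n. t \<ge> 0 \<Longrightarrow> \<bar>lap_kernel 1 t n\<bar> \<le>
     C * sqrt (1 + t) powr (2 - 1 - 2 * real 1) * (sqrt (1 + t) + iabs n) powr (- 2)"
    using lap_kernel_bound[of 2 1] by auto
  obtain D where D: "D \<ge> 0" and S: "\<And>a. a \<ge> 1 \<Longrightarrow> (\<integral>\<^sup>+j. ennreal ((a + iabs j) powr (- 1 - 1)) \<partial>count_space UNIV) \<le> ennreal (D * a powr (- 1))"
    using nn_integral_powr_int[of 1] by auto
  show ?thesis
  proof (intro exI[of _ "C * D"] conjI allI impI ballI)
    fix t :: real and f assume t: "0 < t" and f: "f \<in> expb"
    define r where "r = sqrt (1 + t)"
    have r: "r \<ge> 1" "r * r = 1 + t" using t by (auto simp: r_def)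
    have "(\<integral>\<^sup>+j. ennreal \<bar>lap_kernel 1 t j\<bar> \<partial>count_space UNIV) \<le>
       (\<integral>\<^sup>+j. ennreal (C * r powr (- 1)) * ennreal ((r + iabs j) powr (- 1 - 1)) \<partial>count_space UNIV)"
      using K[of t] t C by (intro nn_integral_mono) (auto simp: r_def ennreal_mult[symmetric] intro!: ennreal_leI)
    also have "\<dots> = ennreal (C * r powr (- 1)) * (\<integral>\<^sup>+j. ennreal ((r + iabs j) powr (- 1 - 1)) \<partial>count_space UNIV)"
      by (rule nn_integral_cmult) simp
    also have "\<dots> \<le> ennreal (C * r powr (- 1)) * ennreal (D * r powr (- 1))"
      by (intro mult_left_mono S r) auto
    also have "\<dots> = ennreal (C * D / (1 + t))"
      using C D r by (simp add: ennreal_mult[symmetric] powr_minus_divide field_simps)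
    also have "\<dots> \<le> ennreal (C * D / t)" using C D t by (intro ennreal_leI divide_left_mono) auto
    finally have "(\<integral>\<^sup>+j. ennreal \<bar>lap_kernel 1 t j\<bar> \<partial>count_space UNIV) \<le> ennreal (C * D / t)" .
    then have "(\<integral>\<^sup>+j. ennreal \<bar>lap_kernel 1 t j\<bar> \<partial>count_space UNIV) * lp_norm p f \<le> ennreal (C * D / t) * lp_norm p f"
      by (rule mult_right_mono) simp
    moreover have "lp_norm p (heat t (Lap f)) \<le> (\<integral>\<^sup>+j. ennreal \<bar>lap_kernel 1 t j\<bar> \<partial>count_space UNIV) * lp_norm p f"
      using lap_kernel_has_sum[OF f, of 1 t] by (intro lp_norm_conv p) simp
    ultimately show "lp_norm p (heat t (Lap f)) \<le> ennreal (C * D / t) * lp_norm p f" by (rule order_trans[rotated])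
  qed (use C D in simp)
qed

section \<open>Powers of the difference operator and their norms\<close>

definition hdiff :: "real \<Rightarrow> (int \<Rightarrow> real) \<Rightarrow> int \<Rightarrow> real" where
  "hdiff \<tau> g m = heat \<tau> g m - g m"

lemma expb_hdiff [intro]: "f \<in> expb \<Longrightarrow> hdiff \<tau> f \<in> expb"
  unfolding hdiff_def[abs_def] by (intro expb_diff expb_heat)

lemma expb_hdiff_pow [intro]: "f \<in> expb \<Longrightarrow> (hdiff \<tau> ^^ k) f \<in> expb"
  by (induction k) auto

lemma heat_hdiff: "f \<in> expb \<Longrightarrow> heat t (hdiff \<tau> f) = hdiff \<tau> (heat t f)"
  by (auto simp: hdiff_def[abs_def] fun_eq_iff heat_diff expb_heat heat_heat add.commute)

lemma heat_hdiff_pow: "f \<in> expb \<Longrightarrow> heat t ((hdiff \<tau> ^^ k) f) = (hdiff \<tau> ^^ k) (heat t f)"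
proof (induction k)
  case (Suc k)
  then show ?case by (simp add: heat_hdiff expb_hdiff_pow)
qed simp

lemma Lap_hdiff: "f \<in> expb \<Longrightarrow> Lap (hdiff \<tau> f) = hdiff \<tau> (Lap f)"
  using Lap_heat[of f \<tau>] by (auto simp: hdiff_def fun_eq_iff discrete_laplacian_def algebra_simps)

lemma Lap_hdiff_pow: "f \<in> expb \<Longrightarrow> Lap ((hdiff \<tau> ^^ k) f) = (hdiff \<tau> ^^ k) (Lap f)"
proof (induction k)
  case (Suc k)
  then show ?case by (simp add: Lap_hdiff expb_hdiff_pow)
qed simp

lemma Lap_pow_hdiff_pow: "f \<in> expb \<Longrightarrow> (Lap ^^ l) ((hdiff \<tau> ^^ k) f) = (hdiff \<tau> ^^ k) ((Lap ^^ l) f)"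
  by (induction l) (auto simp: Lap_hdiff_pow expb_Lap_pow)

lemma hdiff_commute: "f \<in> expb \<Longrightarrow> hdiff s (hdiff t f) = hdiff t (hdiff s f)"
  unfolding hdiff_def[abs_def] by (auto simp: fun_eq_iff heat_diff expb_heat heat_heat add.commute)

lemma hdiff_pow_commute1: "f \<in> expb \<Longrightarrow> hdiff s ((hdiff t ^^ k) f) = (hdiff t ^^ k) (hdiff s f)"
proof (induction k)
  case (Suc k)
  then show ?case using hdiff_commute[where s = s and t = t and f = "(hdiff t ^^ k) f"] by (simp add: expb_hdiff_pow)
qed simp

lemma hdiff_pow_commute: "f \<in> expb \<Longrightarrow> (hdiff s ^^ j) ((hdiff t ^^ k) f) = (hdiff t ^^ k) ((hdiff s ^^ j) f)"
proof (induction j)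
  case (Suc j)
  then show ?case using hdiff_pow_commute1[where s = s and t = t and k = k and f = "(hdiff s ^^ j) f"] by (simp add: expb_hdiff_pow)
qed simp

lemma hdiff_le_nn_integral:
  assumes f: "f \<in> expb" and \<tau>: "\<tau> \<ge> 0"
  shows "ennreal \<bar>hdiff \<tau> f n\<bar> \<le> (\<integral>\<^sup>+r\<in>{0<..<\<tau>}. ennreal \<bar>heat r (Lap f) n\<bar> \<partial>lborel)"
proof -
  have "has_bochner_integral lborel (\<lambda>r. indicator {0..\<tau>} r *\<^sub>R heat r (Lap f) n) (heat \<tau> f n - heat 0 f n)"
  proof (rule has_bochner_integral_FTC_Icc[OF \<tau>])
    show "((\<lambda>r. heat r f n) has_vector_derivative heat r (Lap f) n) (at r within {0..\<tau>})" for r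
      using has_field_derivative_at_within[OF heat_has_derivative[OF f]]
      by (simp add: has_real_derivative_iff_has_vector_derivative)
    show "continuous_on {0..\<tau>} (\<lambda>r. heat r (Lap f) n)"
      by (rule DERIV_continuous_on[OF DERIV_subset[OF heat_has_derivative]]) (use f in auto)
  qed
  then have i: "integrable lborel (\<lambda>r. indicator {0..\<tau>} r *\<^sub>R heat r (Lap f) n)"
    and e: "(\<integral>r. indicator {0..\<tau>} r *\<^sub>R heat r (Lap f) n \<partial>lborel) = hdiff \<tau> f n"
    using f by (auto simp: has_bochner_integral_iff heat_0 hdiff_def)
  have "ennreal \<bar>hdiff \<tau> f n\<bar> \<le> (\<integral>\<^sup>+r. ennreal (norm (indicator {0..\<tau>} r *\<^sub>R heat r (Lap f) n)) \<partial>lborel)"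
    using integral_norm_bound_ennreal[OF i] unfolding e real_norm_def .
  also have "\<dots> = (\<integral>\<^sup>+r\<in>{0<..<\<tau>}. ennreal \<bar>heat r (Lap f) n\<bar> \<partial>lborel)"
  proof (rule nn_integral_cong_AE)
    have "AE r in lborel. r \<noteq> 0 \<and> r \<noteq> \<tau>" by (intro AE_conjI AE_lborel_singleton)
    then show "AE r in lborel. ennreal (norm (indicator {0..\<tau>} r *\<^sub>R heat r (Lap f) n)) =
       ennreal \<bar>heat r (Lap f) n\<bar> * indicator {0<..<\<tau>} r"
      by eventually_elim (auto simp: indicator_def)
  qed
  finally show ?thesis .
qed

lemma lp_norm_hdiff:
  assumes p: "1 \<le> p" and f: "f \<in> expb" and \<tau>: "\<tau> \<ge> 0"
  shows "lp_norm p (hdiff \<tau> f) \<le> (\<integral>\<^sup>+r\<in>{0<..<\<tau>}. lp_norm p (heat r (Lap f)) \<partial>lborel)"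
proof (rule lp_norm_le_integral[OF lborel.sigma_finite_measure_axioms p])
  note [measurable] = heat_measurable[OF expb_Lap[OF f]] lp_norm_heat_measurable[OF p expb_Lap[OF f]]
  show "(\<lambda>r. ennreal \<bar>heat r (Lap f) n\<bar> * indicator {0<..<\<tau>} r) \<in> borel_measurable lborel" for n by measurable
  show "(\<lambda>r. lp_norm p (heat r (Lap f)) * indicator {0<..<\<tau>} r) \<in> borel_measurable lborel" by measurable
  show "Lnorm (count_space UNIV) p (\<lambda>n. ennreal \<bar>heat r (Lap f) n\<bar> * indicator {0<..<\<tau>} r) \<le> lp_norm p (heat r (Lap f)) * indicator {0<..<\<tau>} r" for r
    using Lnorm_cmult_le[of "\<lambda>n. ennreal \<bar>heat r (Lap f) n\<bar>" "count_space UNIV" p "indicator {0<..<\<tau>} r"] p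
    by (auto simp: lp_norm_def mult.commute indicator_def)
qed (rule hdiff_le_nn_integral[OF f \<tau>])

lemma nn_integral_powr_0:
  assumes b: "b > 0" and x: "x \<ge> 0"
  shows "(\<integral>\<^sup>+s\<in>{0<..<x}. ennreal (s powr (b - 1)) \<partial>lborel) = ennreal (x powr b / b)"
proof -
  have "((\<lambda>s. s powr (b - 1)) has_integral (x powr (b - 1 + 1) / (b - 1 + 1))) {0..x}"
    using b x by (intro has_integral_powr_from_0) auto
  moreover have "x powr (b - 1 + 1) / (b - 1 + 1) = x powr b / b" by simp
  ultimately have "((\<lambda>s. s powr (b - 1)) has_integral (x powr b / b)) {0..x}" by (simp only:)
  then have "((\<lambda>s. if s \<in> {0..x} then s powr (b - 1) else 0) has_integral (x powr b / b)) UNIV"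
    by (subst has_integral_restrict_UNIV)
  from nn_integral_has_integral_lborel[OF _ _ this]
  have "(\<integral>\<^sup>+s. ennreal (if s \<in> {0..x} then s powr (b - 1) else 0) \<partial>lborel) = ennreal (x powr b / b)" by simp
  moreover have "(\<integral>\<^sup>+s. ennreal (if s \<in> {0..x} then s powr (b - 1) else 0) \<partial>lborel) = (\<integral>\<^sup>+s\<in>{0<..<x}. ennreal (s powr (b - 1)) \<partial>lborel)"
  proof (rule nn_integral_cong_AE)
    have "AE r in lborel. r \<noteq> 0 \<and> r \<noteq> x" by (intro AE_conjI AE_lborel_singleton)
    then show "AE s in lborel. ennreal (if s \<in> {0..x} then s powr (b - 1) else 0) = ennreal (s powr (b - 1)) * indicator {0<..<x} s"
      by eventually_elim (auto simp: indicator_def)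
  qed
  ultimately show ?thesis by simp
qed

lemma nn_integral_powr_inf:
  assumes b: "b > 0" and x: "x > 0"
  shows "(\<integral>\<^sup>+s\<in>{x<..}. ennreal (s powr (- 1 - b)) \<partial>lborel) = ennreal (x powr (- b) / b)"
proof -
  have "((\<lambda>s. s powr (- 1 - b)) has_integral - (x powr (- 1 - b + 1)) / (- 1 - b + 1)) {x..}"
    using b x by (intro has_integral_powr_to_inf) auto
  moreover have "- (x powr (- 1 - b + 1)) / (- 1 - b + 1) = x powr (- b) / b"
    by (simp add: minus_divide_left[symmetric])
  ultimately have "((\<lambda>s. s powr (- 1 - b)) has_integral (x powr (- b) / b)) {x..}" by (simp only:)
  then have "((\<lambda>s. if s \<in> {x..} then s powr (- 1 - b) else 0) has_integral (x powr (- b) / b)) UNIV"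
    by (subst has_integral_restrict_UNIV)
  from nn_integral_has_integral_lborel[OF _ _ this]
  have "(\<integral>\<^sup>+s. ennreal (if s \<in> {x..} then s powr (- 1 - b) else 0) \<partial>lborel) = ennreal (x powr (- b) / b)" by simp
  moreover have "(\<integral>\<^sup>+s. ennreal (if s \<in> {x..} then s powr (- 1 - b) else 0) \<partial>lborel) = (\<integral>\<^sup>+s\<in>{x<..}. ennreal (s powr (- 1 - b)) \<partial>lborel)"
  proof (rule nn_integral_cong_AE)
    have "AE r in lborel. r \<noteq> x" by (intro AE_lborel_singleton)
    then show "AE s in lborel. ennreal (if s \<in> {x..} then s powr (- 1 - b) else 0) = ennreal (s powr (- 1 - b)) * indicator {x<..} s"
      by eventually_elim (auto simp: indicator_def)
  qed
  ultimately show ?thesis by simp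
qed

lemma sets_less_pair [measurable]:
  "{x :: real \<times> real. snd x < fst x} \<in> sets (borel \<Otimes>\<^sub>M borel)"
  "{x :: real \<times> real. fst x < snd x} \<in> sets (borel \<Otimes>\<^sub>M borel)"
  unfolding borel_prod by (intro borel_open open_Collect_less continuous_intros)+

lemma nn_integral_Ioo_measurable [measurable]:
  fixes A :: "real \<Rightarrow> ennreal"
  assumes [measurable]: "A \<in> borel_measurable borel"
  shows "(\<lambda>\<tau>. \<integral>\<^sup>+r\<in>{0<..<\<tau>}. A r \<partial>lborel) \<in> borel_measurable borel"
proof -
  have e: "(\<lambda>\<tau>. \<integral>\<^sup>+r\<in>{0<..<\<tau>}. A r \<partial>lborel) =
    (\<lambda>\<tau>. \<integral>\<^sup>+r. A r * (indicator {0<..} r * indicator {x. snd x < fst x} (\<tau>, r)) \<partial>lborel)"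
    by (intro ext nn_integral_cong) (auto simp: indicator_def)
  show ?thesis unfolding e by measurable
qed

text \<open>The square is cut along its diagonal. Where s < r, \<phi>(r + s) <= \<phi>(r) and the
  s-integral over (0, r) is r^b / b; the other triangle is symmetric. This merges two time
  parameters into one.\<close>

lemma nn_integral_antimono_square:
  fixes \<phi> :: "real \<Rightarrow> ennreal"
  assumes [measurable]: "\<phi> \<in> borel_measurable borel" and anti: "\<And>r s. 0 < r \<Longrightarrow> r \<le> s \<Longrightarrow> \<phi> s \<le> \<phi> r"
    and a: "a > 0" and b: "b > 0"
  shows "(\<integral>\<^sup>+r\<in>{0<..<T}. ennreal (r powr (a - 1)) * (\<integral>\<^sup>+s\<in>{0<..<T}. ennreal (s powr (b - 1)) * \<phi> (r + s) \<partial>lborel) \<partial>lborel)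
    \<le> ennreal (1 / a + 1 / b) * (\<integral>\<^sup>+r\<in>{0<..<T}. ennreal (r powr (a + b - 1)) * \<phi> r \<partial>lborel)" (is "?L \<le> _ * ?R")
proof -
  define A where "A r s = ennreal (r powr (a - 1)) * ennreal (s powr (b - 1)) * \<phi> r * (indicator {0<..} s * indicator {x. snd x < fst x} (r, s)) * indicator {0<..<T} r" for r s :: real
  define B where "B r s = ennreal (r powr (a - 1)) * ennreal (s powr (b - 1)) * \<phi> s * (indicator {0<..} r * indicator {x. fst x < snd x} (r, s)) * indicator {0<..<T} s" for r s :: real
  have [measurable]: "(\<lambda>(r, s). A r s) \<in> borel_measurable (borel \<Otimes>\<^sub>M borel)" "(\<lambda>(r, s). B r s) \<in> borel_measurable (borel \<Otimes>\<^sub>M borel)"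
  proof -
    show "(\<lambda>(r, s). A r s) \<in> borel_measurable (borel \<Otimes>\<^sub>M borel)" "(\<lambda>(r, s). B r s) \<in> borel_measurable (borel \<Otimes>\<^sub>M borel)"
      unfolding A_def B_def case_prod_unfold prod.collapse by measurable
  qed
  have "?L = (\<integral>\<^sup>+r. (\<integral>\<^sup>+s. ennreal (r powr (a - 1)) * ennreal (s powr (b - 1)) * \<phi> (r + s) * indicator {0<..<T} s * indicator {0<..<T} r \<partial>lborel) \<partial>lborel)"
    by (auto intro!: nn_integral_cong simp: nn_integral_cmult[symmetric] nn_integral_multc[symmetric] mult_ac)
  also have "\<dots> \<le> (\<integral>\<^sup>+r. (\<integral>\<^sup>+s. A r s + B r s \<partial>lborel) \<partial>lborel)"
  proof (rule nn_integral_mono)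
    fix r :: real
    have "AE s in lborel. s \<noteq> r" by (rule AE_lborel_singleton)
    then show "(\<integral>\<^sup>+s. ennreal (r powr (a - 1)) * ennreal (s powr (b - 1)) * \<phi> (r + s) * indicator {0<..<T} s * indicator {0<..<T} r \<partial>lborel) \<le> (\<integral>\<^sup>+s. A r s + B r s \<partial>lborel)"
    proof (intro nn_integral_mono_AE, eventually_elim)
      case (elim s)
      show ?case
      proof (cases "r \<in> {0<..<T} \<and> s \<in> {0<..<T}")
        case True
        consider "s < r" | "r < s" using elim by linarith
        then show ?thesis
        proof cases
          case 1
          then have "\<phi> (r + s) \<le> \<phi> r" using True by (intro anti) auto
          then have "ennreal (r powr (a - 1)) * ennreal (s powr (b - 1)) * \<phi> (r + s) \<le> ennreal (r powr (a - 1)) * ennreal (s powr (b - 1)) * \<phi> r"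
            by (intro mult_left_mono) auto
          then show ?thesis using True 1 by (simp add: A_def B_def)
        next
          case 2
          then have "\<phi> (r + s) \<le> \<phi> s" using True by (intro anti) auto
          then have "ennreal (r powr (a - 1)) * ennreal (s powr (b - 1)) * \<phi> (r + s) \<le> ennreal (r powr (a - 1)) * ennreal (s powr (b - 1)) * \<phi> s"
            by (intro mult_left_mono) auto
          then show ?thesis using True 2 by (simp add: A_def B_def)
        qed
      qed auto
    qed
  qed
  also have "\<dots> = (\<integral>\<^sup>+r. (\<integral>\<^sup>+s. A r s \<partial>lborel) \<partial>lborel) + (\<integral>\<^sup>+r. (\<integral>\<^sup>+s. B r s \<partial>lborel) \<partial>lborel)"
    by (subst nn_integral_add[symmetric]) (auto intro!: nn_integral_cong nn_integral_add)
  also have "(\<integral>\<^sup>+r. (\<integral>\<^sup>+s. B r s \<partial>lborel) \<partial>lborel) = (\<integral>\<^sup>+s. (\<integral>\<^sup>+r. B r s \<partial>lborel) \<partial>lborel)"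
    by (rule lborel_pair.Fubini') simp
  also have "(\<integral>\<^sup>+r. (\<integral>\<^sup>+s. A r s \<partial>lborel) \<partial>lborel) = ennreal (1 / b) * ?R"
  proof -
    have "(\<integral>\<^sup>+s. A r s \<partial>lborel) = ennreal (1 / b) * (ennreal (r powr (a + b - 1)) * \<phi> r * indicator {0<..<T} r)" for r
    proof (cases "r \<in> {0<..<T}")
      case True
      have "(\<integral>\<^sup>+s. A r s \<partial>lborel) = (\<integral>\<^sup>+s. (ennreal (r powr (a - 1)) * \<phi> r) * (ennreal (s powr (b - 1)) * indicator {0<..<r} s) \<partial>lborel)"
        using True by (intro nn_integral_cong) (auto simp: A_def mult_ac indicator_def)
      also have "\<dots> = (ennreal (r powr (a - 1)) * \<phi> r) * ennreal (r powr b / b)"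
        using True b by (subst nn_integral_cmult) (auto simp: nn_integral_powr_0)
      also have "\<dots> = ennreal (r powr (a - 1)) * ennreal (r powr b / b) * \<phi> r" by (simp add: mult_ac)
      also have "ennreal (r powr (a - 1)) * ennreal (r powr b / b) = ennreal (1 / b) * ennreal (r powr (a + b - 1))"
        using b by (simp add: ennreal_mult[symmetric] powr_add[symmetric] algebra_simps)
      finally show ?thesis using True by (simp add: mult_ac)
    qed (simp add: A_def)
    then show ?thesis by (simp add: nn_integral_cmult)
  qed
  also have "(\<integral>\<^sup>+s. (\<integral>\<^sup>+r. B r s \<partial>lborel) \<partial>lborel) = ennreal (1 / a) * ?R"
  proof -
    have "(\<integral>\<^sup>+r. B r s \<partial>lborel) = ennreal (1 / a) * (ennreal (s powr (a + b - 1)) * \<phi> s * indicator {0<..<T} s)" for s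
    proof (cases "s \<in> {0<..<T}")
      case True
      have "(\<integral>\<^sup>+r. B r s \<partial>lborel) = (\<integral>\<^sup>+r. (ennreal (s powr (b - 1)) * \<phi> s) * (ennreal (r powr (a - 1)) * indicator {0<..<s} r) \<partial>lborel)"
        using True by (intro nn_integral_cong) (auto simp: B_def mult_ac indicator_def)
      also have "\<dots> = (ennreal (s powr (b - 1)) * \<phi> s) * ennreal (s powr a / a)"
        using True a by (subst nn_integral_cmult) (auto simp: nn_integral_powr_0)
      also have "\<dots> = ennreal (s powr (b - 1)) * ennreal (s powr a / a) * \<phi> s" by (simp add: mult_ac)
      also have "ennreal (s powr (b - 1)) * ennreal (s powr a / a) = ennreal (1 / a) * ennreal (s powr (a + b - 1))"
        using a by (simp add: ennreal_mult[symmetric] powr_add[symmetric] algebra_simps)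
      finally show ?thesis using True by (simp add: mult_ac)
    qed (simp add: B_def)
    then show ?thesis by (simp add: nn_integral_cmult)
  qed
  also have "ennreal (1 / b) * ?R + ennreal (1 / a) * ?R = ennreal (1 / a + 1 / b) * ?R"
    using a b by (simp add: distrib_right add.commute)
  finally show ?thesis .
qed

text \<open>Induction on l: one difference is written as a time integral by the fundamental theorem
  of calculus, and the resulting double integral is merged by monotonicity with exponents a = l + 1
  and b = 1. The operators commute, so the new difference can be moved inside.\<close>

lemma lp_norm_hdiff_pow:
  assumes p: "1 \<le> p"
  shows "\<exists>C\<ge>0. \<forall>f\<in>expb. \<forall>\<tau>\<ge>0. lp_norm p ((hdiff \<tau> ^^ Suc l) f)
     \<le> ennreal C * (\<integral>\<^sup>+r\<in>{0<..<\<tau>}. ennreal (r powr real l) * lp_norm p (heat r ((Lap ^^ Suc l) f)) \<partial>lborel)"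
proof (induction l)
  case 0
  have eq: "(\<integral>\<^sup>+r\<in>{0<..<\<tau>}. lp_norm p (heat r (Lap f)) \<partial>lborel) = (\<integral>\<^sup>+r\<in>{0<..<\<tau>}. ennreal (r powr real 0) * lp_norm p (heat r (Lap f)) \<partial>lborel)" for f \<tau>
    by (intro nn_integral_cong) (auto simp: indicator_def)
  show ?case
    by (rule exI[of _ 1]) (use lp_norm_hdiff[OF p] eq in simp)
next
  case (Suc l)
  then obtain C where C: "C \<ge> 0" and IH: "\<And>f \<tau>. f \<in> expb \<Longrightarrow> \<tau> \<ge> 0 \<Longrightarrow> lp_norm p ((hdiff \<tau> ^^ Suc l) f)
     \<le> ennreal C * (\<integral>\<^sup>+r\<in>{0<..<\<tau>}. ennreal (r powr real l) * lp_norm p (heat r ((Lap ^^ Suc l) f)) \<partial>lborel)"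
    by blast
  show ?case
  proof (intro exI[of _ "C * (1 / (real l + 1) + 1)"] conjI ballI allI impI)
    fix f \<tau> assume f: "f \<in> expb" and \<tau>: "(0::real) \<le> \<tau>"
    define w where "w = (Lap ^^ Suc l) f"
    have w: "w \<in> expb" unfolding w_def by (intro expb_Lap_pow f)
    define \<phi> where "\<phi> r = lp_norm p (heat r (Lap w))" for r
    have m[measurable]: "\<phi> \<in> borel_measurable borel"
      unfolding \<phi>_def by (rule lp_norm_heat_measurable[OF p expb_Lap[OF w]])
    have "lp_norm p ((hdiff \<tau> ^^ Suc (Suc l)) f) = lp_norm p ((hdiff \<tau> ^^ Suc l) (hdiff \<tau> f))"
      by (simp only: funpow_Suc_right o_def)
    also have "\<dots> \<le> ennreal C * (\<integral>\<^sup>+r\<in>{0<..<\<tau>}. ennreal (r powr real l) * lp_norm p (heat r ((Lap ^^ Suc l) (hdiff \<tau> f))) \<partial>lborel)"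
      by (intro IH expb_hdiff f \<tau>)
    also have "\<dots> \<le> ennreal C * (\<integral>\<^sup>+r\<in>{0<..<\<tau>}. ennreal (r powr real l) * (\<integral>\<^sup>+s\<in>{0<..<\<tau>}. ennreal (s powr (1 - 1)) * \<phi> (r + s) \<partial>lborel) \<partial>lborel)"
    proof (intro mult_left_mono nn_integral_mono)
      fix r :: real
      show "ennreal (r powr real l) * lp_norm p (heat r ((Lap ^^ Suc l) (hdiff \<tau> f))) * indicator {0<..<\<tau>} r
        \<le> ennreal (r powr real l) * (\<integral>\<^sup>+s\<in>{0<..<\<tau>}. ennreal (s powr (1 - 1)) * \<phi> (r + s) \<partial>lborel) * indicator {0<..<\<tau>} r"
      proof (cases "r \<in> {0<..<\<tau>}")
        case True
        have "heat r ((Lap ^^ Suc l) (hdiff \<tau> f)) = hdiff \<tau> (heat r w)"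
          unfolding w_def 
          using Lap_pow_hdiff_pow[OF f, where l = "Suc l" and \<tau> = \<tau> and k = 1]
            heat_hdiff[OF expb_Lap_pow[OF f], where t = r and \<tau> = \<tau> and k1 = "Suc l"] by simp
        then have "lp_norm p (heat r ((Lap ^^ Suc l) (hdiff \<tau> f))) \<le> (\<integral>\<^sup>+s\<in>{0<..<\<tau>}. lp_norm p (heat s (Lap (heat r w))) \<partial>lborel)"
          using lp_norm_hdiff[OF p expb_heat[OF w] \<tau>] by simp
        also have "\<dots> = (\<integral>\<^sup>+s\<in>{0<..<\<tau>}. ennreal (s powr (1 - 1)) * \<phi> (r + s) \<partial>lborel)"
          using w by (intro nn_integral_cong) (auto simp: \<phi>_def Lap_heat heat_heat expb_Lap indicator_def)
        finally show ?thesis using True by (simp add: mult_left_mono)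
      qed simp
    qed auto
    also have "\<dots> \<le> ennreal C * (ennreal (1 / (real l + 1) + 1 / 1) * (\<integral>\<^sup>+r\<in>{0<..<\<tau>}. ennreal (r powr (real l + 1 + 1 - 1)) * \<phi> r \<partial>lborel))"
    proof (intro mult_left_mono)
      have "\<phi> s \<le> \<phi> r" if "0 < r" "r \<le> s" for r s
        unfolding \<phi>_def using that w by (intro lp_norm_heat_antimono p) auto
      from nn_integral_antimono_square[OF m this, of "real l + 1" 1 \<tau>]
      show "(\<integral>\<^sup>+r\<in>{0<..<\<tau>}. ennreal (r powr real l) * (\<integral>\<^sup>+s\<in>{0<..<\<tau>}. ennreal (s powr (1 - 1)) * \<phi> (r + s) \<partial>lborel) \<partial>lborel) \<le>
        ennreal (1 / (real l + 1) + 1 / 1) * (\<integral>\<^sup>+r\<in>{0<..<\<tau>}. ennreal (r powr (real l + 1 + 1 - 1)) * \<phi> r \<partial>lborel)" by simp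
    qed auto
    also have "\<dots> = ennreal (C * (1 / (real l + 1) + 1)) * (\<integral>\<^sup>+r\<in>{0<..<\<tau>}. ennreal (r powr real (Suc l)) * lp_norm p (heat r ((Lap ^^ Suc (Suc l)) f)) \<partial>lborel)"
      using C by (simp add: \<phi>_def w_def ennreal_mult mult.assoc add.commute)
    finally show "lp_norm p ((hdiff \<tau> ^^ Suc (Suc l)) f) \<le> ennreal (C * (1 / (real l + 1) + 1)) *
      (\<integral>\<^sup>+r\<in>{0<..<\<tau>}. ennreal (r powr real (Suc l)) * lp_norm p (heat r ((Lap ^^ Suc (Suc l)) f)) \<partial>lborel)" .
  qed (use C in simp)
qed

text \<open>A superposition of dilations has norm at most its total weight, by Minkowski and the
  invariance of dt/t. Positivity of \<open>c y\<close> is asked only where \<open>w\<close> is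
  nonzero, since y runs over the whole line.\<close>

lemma Lnorm_Mellin:
  assumes [measurable]: "w \<in> borel_measurable borel" "c \<in> borel_measurable borel" "G \<in> borel_measurable borel"
    and c: "\<And>y. w y \<noteq> 0 \<Longrightarrow> c y > (0::real)" and w: "\<And>y. w y \<ge> (0::real)" and q: "1 \<le> q"
  shows "Lnorm dt_over_t q (\<lambda>t. \<integral>\<^sup>+y. ennreal (w y) * G (c y * t) \<partial>lborel) \<le> (\<integral>\<^sup>+y. ennreal (w y) \<partial>lborel) * Lnorm dt_over_t q G"
proof -
  have id: "(\<lambda>t. t) \<in> borel_measurable dt_over_t" by (rule measurable_dt) simp
  have [measurable]: "fst \<in> borel_measurable (dt_over_t \<Otimes>\<^sub>M lborel)"
    by (rule measurable_compose[OF measurable_fst id])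
  have "Lnorm dt_over_t q (\<lambda>t. \<integral>\<^sup>+y. ennreal (w y) * G (c y * t) \<partial>lborel) \<le> (\<integral>\<^sup>+y. ennreal (w y) * Lnorm dt_over_t q G \<partial>lborel)"
  proof (rule Lnorm_Minkowski[OF sigma_finite_dt lborel.sigma_finite_measure_axioms q])
    show "(\<lambda>(t, y). ennreal (w y) * G (c y * t)) \<in> borel_measurable (dt_over_t \<Otimes>\<^sub>M lborel)"
      unfolding case_prod_unfold by measurable
    fix y
    show "Lnorm dt_over_t q (\<lambda>t. ennreal (w y) * G (c y * t)) \<le> ennreal (w y) * Lnorm dt_over_t q G"
    proof (cases "w y = 0")
      case True
      then show ?thesis using Lnorm_cmult_le[of "\<lambda>t. 0" dt_over_t q 0] q by simp
    next
      case False
      have "Lnorm dt_over_t q (\<lambda>t. ennreal (w y) * G (c y * t)) \<le> ennreal (w y) * Lnorm dt_over_t q (\<lambda>t. G (c y * t))"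
        by (intro Lnorm_cmult_le q w measurable_dt) measurable
      also have "\<dots> \<le> ennreal (w y) * Lnorm dt_over_t q G"
        by (intro mult_left_mono Lnorm_dt_scale q c False) auto
      finally show ?thesis .
    qed
  qed simp
  also have "\<dots> = (\<integral>\<^sup>+y. ennreal (w y) \<partial>lborel) * Lnorm dt_over_t q G" by (rule nn_integral_multc) simp
  finally show ?thesis .
qed

section \<open>Weighted spaces\<close>

lemma expb_poly:
  assumes "\<And>n. \<bar>f n\<bar> \<le> C * (1 + iabs n) powr M" and M: "M > 0"
  shows "f \<in> expb"
proof (rule expbI)
  fix n
  define D where "D = exp (1 - M + M * ln M)"
  have C: "C \<ge> 0" using assms(1)[of 0] by simp
  have "(1 + iabs n) powr M \<le> D * exp (iabs n)"
    unfolding D_def by (intro powr_le_exp M) simp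
  then have "C * (1 + iabs n) powr M \<le> C * (D * exp (iabs n))"
    using C by (intro mult_left_mono)
  with assms(1)[of n] show "\<bar>f n\<bar> \<le> (C * D) * exp (iabs n)" by simp
qed

lemma measurable_wmeasure [measurable]: "(f :: int \<Rightarrow> ennreal) \<in> borel_measurable wmeasure"
  by (simp add: wmeasure_def point_measure_def)

lemma Lnorm_wmeasure_finite_iff:
  assumes "q \<noteq> \<infinity>"
  shows "Lnorm wmeasure q h < \<infinity> \<longleftrightarrow>
    (\<integral>\<^sup>+n. ennreal (1 / (1 + iabs n)) * ennpowr (h n) (enn2real q) \<partial>count_space UNIV) < \<infinity>"
  unfolding Lnorm_finite_iff[OF assms] wmeasure_def point_measure_def
  by (subst nn_integral_density) auto

lemma AE_wmeasure: "(AE x in wmeasure. P x) \<longleftrightarrow> (\<forall>x. P x)"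
proof -
  have "ennreal (1 / (1 + iabs x)) > 0" for x
    by (simp add: add_pos_nonneg)
  then show ?thesis
    unfolding wmeasure_def point_measure_def
    by (subst AE_density) (auto simp: AE_count_space)
qed

lemma Lnorm_wmeasure_top: "Lnorm wmeasure \<infinity> h = (SUP n. h n)"
  using esssup_eq_SUP[OF measurable_wmeasure AE_wmeasure] by (simp add: Lnorm_def)

lemma Lnorm_wmeasure_le:
  assumes "\<And>n. h n \<le> ennreal c * g n" "c \<ge> 0" "Lnorm wmeasure q g < \<infinity>" "1 \<le> q"
  shows "Lnorm wmeasure q h < \<infinity>"
proof -
  have "Lnorm wmeasure q h \<le> Lnorm wmeasure q (\<lambda>n. ennreal c * g n)"
    using assms by (intro Lnorm_mono) auto
  also have "\<dots> \<le> ennreal c * Lnorm wmeasure q g" using assms by (intro Lnorm_cmult_le) auto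
  also have "\<dots> < \<infinity>" using assms(3) by (simp add: ennreal_mult_less_top)
  finally show ?thesis .
qed

lemma Lnorm_wmeasure_pointwise:
  assumes q: "1 \<le> q" and fin: "Lnorm wmeasure q (\<lambda>n. ennreal (g n)) < \<infinity>" and g: "\<And>n. g n \<ge> 0"
  shows "\<exists>C\<ge>0. \<forall>n. g n \<le> C * (1 + iabs n)"
proof (cases "q = \<infinity>")
  case True
  define S where "S = (SUP n. ennreal (g n))"
  have "S < \<infinity>" using fin True Lnorm_wmeasure_top unfolding S_def by metis
  then obtain C where C: "S = ennreal C" "C \<ge> 0" by (cases S) auto
  have "ennreal (g n) \<le> ennreal C" for n unfolding C(1)[symmetric] S_def by (rule SUP_upper) simp
  then have "g n \<le> C" for n using C(2) by simp
  moreover have "C \<ge> 0" by (rule C)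
  ultimately show ?thesis
    by (intro exI[of _ C]) (auto intro: order_trans[OF _ mult_left_mono[of 1 _ C, simplified]])
next
  case False
  define Q where "Q = enn2real q"
  have Q: "Q \<ge> 1" using enn2real_ge_1[OF q False] by (simp add: Q_def)
  let ?I = "(\<integral>\<^sup>+n. ennreal (1 / (1 + iabs n)) * ennpowr (ennreal (g n)) Q \<partial>count_space UNIV)"
  have "?I < \<infinity>" using fin unfolding Lnorm_wmeasure_finite_iff[OF False] Q_def .
  then obtain I where I: "?I = ennreal I" "I \<ge> 0" by (cases ?I) auto
  have "g n \<le> (1 + I) * (1 + iabs n)" for n
  proof -
    have "ennreal (1 / (1 + iabs n)) * ennpowr (ennreal (g n)) Q
      = (\<integral>\<^sup>+m. ennreal (1 / (1 + iabs m)) * ennpowr (ennreal (g m)) Q * indicator {n} m \<partial>count_space UNIV)"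
      by (subst nn_integral_indicator_singleton) auto
    also have "\<dots> \<le> ?I" by (intro nn_integral_mono) (auto simp: indicator_def)
    finally have "1 / (1 + iabs n) * g n powr Q \<le> I"
      using I g by (simp add: ennreal_mult[symmetric])
    then have "g n powr Q \<le> I * (1 + iabs n)" by (simp add: field_simps)
    also have "\<dots> \<le> (1 + I) * (1 + iabs n)" by (intro mult_right_mono) auto
    also have "\<dots> \<le> ((1 + I) * (1 + iabs n)) powr Q"
    proof -
      have "1 * 1 \<le> (1 + I) * (1 + iabs n)" using I by (intro mult_mono) auto
      then show ?thesis using Q powr_mono[of 1 Q "(1 + I) * (1 + iabs n)"] by simp
    qed
    finally show ?thesis using Q g I powr_less_mono2[of Q "(1 + I) * (1 + iabs n)" "g n"]
      by (smt (verit, best) mult_nonneg_nonneg abs_ge_zero)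
  qed
  then show ?thesis using I by (intro exI[of _ "1 + I"]) auto
qed

text \<open>The weight (1 + |n|)^{-\<alpha>} replaces 1 / (1 + |n|^\<alpha>): the two are
  comparable, and exponents of the former simply add.\<close>

definition wnorm :: "real \<Rightarrow> ennreal \<Rightarrow> (int \<Rightarrow> real) \<Rightarrow> ennreal" where
  "wnorm \<alpha> q f = Lnorm wmeasure q (\<lambda>n. ennreal (\<bar>f n\<bar> * (1 + iabs n) powr (- \<alpha>)))"

lemma one_plus_powr:
  assumes "x \<ge> (0::real)" "a > 0"
  shows "1 + x powr a \<le> 2 * (1 + x) powr a" "(1 + x) powr a \<le> 2 powr a * (1 + x powr a)"
proof -
  have "x powr a \<le> (1 + x) powr a" using assms by (intro powr_mono2) auto
  moreover have "1 \<le> (1 + x) powr a" using assms by (intro ge_one_powr_ge_zero) auto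
  ultimately show "1 + x powr a \<le> 2 * (1 + x) powr a" by simp
  have "(1 + x) powr a \<le> (2 * max 1 x) powr a" using assms by (intro powr_mono2) auto
  also have "\<dots> = 2 powr a * max 1 x powr a" using assms by (simp add: powr_mult)
  also have "max 1 x powr a \<le> 1 + x powr a" by (auto simp: max_def)
  finally show "(1 + x) powr a \<le> 2 powr a * (1 + x powr a)" by simp
qed

lemma weighted_lq_iff:
  assumes q: "1 \<le> q" and a: "\<alpha> > 0"
  shows "(\<lambda>n. f n / (1 + iabs n powr \<alpha>)) \<in> weighted_lq q \<longleftrightarrow> wnorm \<alpha> q f < \<infinity>"
proof -
  have p: "1 + iabs n powr \<alpha> > 0" for n by (simp add: add_pos_nonneg)
  have p': "(1 + iabs n) powr \<alpha> > 0" for n by (simp add: add_pos_nonneg)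
  have 1: "ennreal (\<bar>f n\<bar> * (1 + iabs n) powr (- \<alpha>)) \<le> ennreal 2 * ennreal \<bar>f n / (1 + iabs n powr \<alpha>)\<bar>" for n
  proof -
    have "\<bar>f n\<bar> * (1 + iabs n powr \<alpha>) \<le> \<bar>f n\<bar> * (2 * (1 + iabs n) powr \<alpha>)"
      using one_plus_powr(1)[of "iabs n" \<alpha>] a by (intro mult_left_mono) auto
    then have "\<bar>f n\<bar> * (1 + iabs n) powr (- \<alpha>) \<le> 2 * (\<bar>f n\<bar> / (1 + iabs n powr \<alpha>))"
      using p[of n] p'[of n] by (simp add: powr_minus_divide field_simps)
    then have "ennreal (\<bar>f n\<bar> * (1 + iabs n) powr (- \<alpha>)) \<le> ennreal (2 * (\<bar>f n\<bar> / (1 + iabs n powr \<alpha>)))"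
      by (rule ennreal_leI)
    also have "\<dots> = ennreal 2 * ennreal \<bar>f n / (1 + iabs n powr \<alpha>)\<bar>"
      using p[of n] by (subst ennreal_mult) (auto simp: abs_divide)
    finally show ?thesis .
  qed
  have 2: "ennreal \<bar>f n / (1 + iabs n powr \<alpha>)\<bar> \<le> ennreal (2 powr \<alpha>) * ennreal (\<bar>f n\<bar> * (1 + iabs n) powr (- \<alpha>))" for n
  proof -
    have "\<bar>f n\<bar> * (1 + iabs n) powr \<alpha> \<le> \<bar>f n\<bar> * (2 powr \<alpha> * (1 + iabs n powr \<alpha>))"
      using one_plus_powr(2)[of "iabs n" \<alpha>] a by (intro mult_left_mono) auto
    then have "\<bar>f n\<bar> / (1 + iabs n powr \<alpha>) \<le> 2 powr \<alpha> * (\<bar>f n\<bar> * (1 + iabs n) powr (- \<alpha>))"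
      using p[of n] p'[of n] by (simp add: powr_minus_divide field_simps)
    then have "ennreal \<bar>f n / (1 + iabs n powr \<alpha>)\<bar> \<le> ennreal (2 powr \<alpha> * (\<bar>f n\<bar> * (1 + iabs n) powr (- \<alpha>)))"
      using p[of n] by (intro ennreal_leI) (simp add: abs_divide)
    also have "\<dots> = ennreal (2 powr \<alpha>) * ennreal (\<bar>f n\<bar> * (1 + iabs n) powr (- \<alpha>))"
      by (rule ennreal_mult) auto
    finally show ?thesis .
  qed
  show ?thesis unfolding weighted_lq_def wnorm_def mem_Collect_eq
    using Lnorm_wmeasure_le[OF 1 _ _ q] Lnorm_wmeasure_le[OF 2 _ _ q] by auto
qed

text \<open>The polynomial growth extracted here places every function of the space in
  \<open>expb\<close>, where the semigroup calculus is available.\<close>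

lemma wnorm_poly:
  assumes q: "1 \<le> q" and fin: "wnorm \<alpha> q f < \<infinity>"
  shows "\<exists>C\<ge>0. \<forall>n. \<bar>f n\<bar> \<le> C * (1 + iabs n) powr (\<alpha> + 1)"
proof -
  obtain C where C: "C \<ge> 0" "\<And>n. \<bar>f n\<bar> * (1 + iabs n) powr (- \<alpha>) \<le> C * (1 + iabs n)"
    using Lnorm_wmeasure_pointwise[OF q fin[unfolded wnorm_def]] by auto
  have "\<bar>f n\<bar> \<le> C * (1 + iabs n) powr (\<alpha> + 1)" for n
  proof -
    have p: "(1 + iabs n) powr \<alpha> > 0" by (simp add: add_pos_nonneg)
    have "\<bar>f n\<bar> = (\<bar>f n\<bar> * (1 + iabs n) powr (- \<alpha>)) * (1 + iabs n) powr \<alpha>"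
      using p by (simp add: powr_minus)
    also have "\<dots> \<le> (C * (1 + iabs n)) * (1 + iabs n) powr \<alpha>"
      by (intro mult_right_mono C) auto
    finally show ?thesis by (simp add: powr_add mult_ac)
  qed
  with C show ?thesis by blast
qed

lemma wnorm_expb: "1 \<le> q \<Longrightarrow> \<alpha> > 0 \<Longrightarrow> wnorm \<alpha> q f < \<infinity> \<Longrightarrow> f \<in> expb"
  using wnorm_poly[of q \<alpha> f] by (auto intro: expb_poly[where M = "\<alpha> + 1"])

text \<open>The density 1 / (1 + |n|) turns the Q-th power into the summable (1 +
  |n|)^{-1-\<gamma>Q}. This handles the part of the fractional integral that is bounded uniformly in
  n.\<close>

lemma Lnorm_wmeasure_powr:
  assumes q: "1 \<le> q" and g: "\<gamma> > 0"
  shows "Lnorm wmeasure q (\<lambda>n. ennreal ((1 + iabs n) powr (- \<gamma>))) < \<infinity>"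
proof (cases "q = \<infinity>")
  case True
  have "(1 + iabs n) powr (- \<gamma>) \<le> 1" for n using g by (simp add: powr_minus_divide ge_one_powr_ge_zero)
  then have "Lnorm wmeasure \<infinity> (\<lambda>n. ennreal ((1 + iabs n) powr (- \<gamma>))) \<le> 1"
    unfolding Lnorm_wmeasure_top by (intro SUP_least) simp
  then show ?thesis using True by (auto elim: le_less_trans)
next
  case False
  define Q where "Q = enn2real q"
  have Q: "Q \<ge> 1" using enn2real_ge_1[OF q False] by (simp add: Q_def)
  obtain D where D: "D \<ge> 0" and S: "\<And>a. a \<ge> 1 \<Longrightarrow> (\<integral>\<^sup>+j. ennreal ((a + iabs j) powr (- 1 - \<gamma> * Q)) \<partial>count_space UNIV) \<le> ennreal (D * a powr (- (\<gamma> * Q)))"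
    using nn_integral_powr_int[of "\<gamma> * Q"] g Q by auto
  have "ennreal (1 / (1 + iabs n)) * ennpowr (ennreal ((1 + iabs n) powr (- \<gamma>))) Q = ennreal ((1 + iabs n) powr (- 1 - \<gamma> * Q))" for n
  proof -
    let ?y = "1 + iabs n"
    have "1 / ?y * (?y powr (- \<gamma>)) powr Q = ?y powr (- 1) * ?y powr (- \<gamma> * Q)"
      unfolding powr_powr by (simp add: powr_minus_divide[of ?y 1])
    also have "\<dots> = ?y powr (- 1 + - \<gamma> * Q)" by (rule powr_add[symmetric])
    finally show ?thesis by (simp add: ennreal_mult[symmetric])
  qed
  then have "(\<integral>\<^sup>+n. ennreal (1 / (1 + iabs n)) * ennpowr (ennreal ((1 + iabs n) powr (- \<gamma>))) Q \<partial>count_space UNIV) < \<infinity>"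
    using S[of 1] by (auto elim: le_less_trans)
  then show ?thesis unfolding Lnorm_wmeasure_finite_iff[OF False] Q_def .
qed

text \<open>At times comparable to (1 + |n|)^2 the kernel at n - j decays like a power of sqrt(1 +
  t) + |n - j|, which is at least half of 1 + |n| + |j|. This is the resulting majorant, symmetric
  in n and j.\<close>

definition spread :: "real \<Rightarrow> (int \<Rightarrow> real) \<Rightarrow> int \<Rightarrow> ennreal" where
  "spread M f n = (\<integral>\<^sup>+j. ennreal ((1 + iabs n + iabs j) powr (- M) * \<bar>f j\<bar>) \<partial>count_space UNIV)"

text \<open>A weighted Schur test; \<open>M\<close> is chosen so that the exponents of \<open>1 + \<bar>n\<bar>\<close> left by Jensen's
  inequality cancel.\<close>

lemma Lnorm_spread:
  assumes q: "1 \<le> q" and a: "\<alpha> > 0" and fin: "wnorm \<alpha> q f < \<infinity>"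
  shows "\<exists>M>0. Lnorm wmeasure q (\<lambda>n. ennreal ((1 + iabs n) powr (M - 1 - \<alpha>)) * spread M f n) < \<infinity>"
proof (cases "q = \<infinity>")
  case True
  define A where "A = enn2real (wnorm \<alpha> q f)"
  have A0: "A \<ge> 0" by (simp add: A_def)
  have wA: "wnorm \<alpha> q f = ennreal A" using fin by (simp add: A_def ennreal_enn2real_if)
  have A: "\<bar>f j\<bar> \<le> A * (1 + iabs j) powr \<alpha>" for j
  proof -
    have "ennreal (\<bar>f j\<bar> * (1 + iabs j) powr (- \<alpha>)) \<le> ennreal A"
      unfolding wA[symmetric] True wnorm_def Lnorm_wmeasure_top by (rule SUP_upper) simp
    then have "\<bar>f j\<bar> * (1 + iabs j) powr (- \<alpha>) \<le> A" using A0 by simp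
    moreover have "(1 + iabs j) powr \<alpha> > 0" by (simp add: add_pos_nonneg)
    ultimately show ?thesis by (simp add: powr_minus field_simps)
  qed
  obtain D where D: "D \<ge> 0" and S: "\<And>a. a \<ge> 1 \<Longrightarrow> (\<integral>\<^sup>+j. ennreal ((a + iabs j) powr (- 1 - 1)) \<partial>count_space UNIV) \<le> ennreal (D * a powr (- 1))"
    using nn_integral_powr_int[of 1] by auto
  \<comment> \<open>With M = \<alpha> + 2 the growth (1 + |j|)^\<alpha> leaves the summable exponent
    -2; the sum is of size (1 + |n|)^{-1} and cancels the prefactor (1 +
    |n|)^{M-1-\<alpha>}.\<close>
  have "ennreal ((1 + iabs n) powr (\<alpha> + 2 - 1 - \<alpha>)) * spread (\<alpha> + 2) f n \<le> ennreal (A * D)" for n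
  proof -
    have "spread (\<alpha> + 2) f n \<le> (\<integral>\<^sup>+j. ennreal A * ennreal ((1 + iabs n + iabs j) powr (- 1 - 1)) \<partial>count_space UNIV)"
      unfolding spread_def
    proof (intro nn_integral_mono)
      fix j
      let ?x = "1 + iabs n + iabs j"
      have "\<bar>f j\<bar> \<le> A * ?x powr \<alpha>"
        using A0 a by (intro order_trans[OF A] mult_left_mono powr_mono2) auto
      then have "?x powr (- (\<alpha> + 2)) * \<bar>f j\<bar> \<le> ?x powr (- (\<alpha> + 2)) * (A * ?x powr \<alpha>)" by (intro mult_left_mono) auto
      also have "\<dots> = A * ?x powr (- (\<alpha> + 2) + \<alpha>)" unfolding powr_add by simp
      finally show "ennreal (?x powr (- (\<alpha> + 2)) * \<bar>f j\<bar>) \<le> ennreal A * ennreal (?x powr (- 1 - 1))"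
        using A0 by (simp add: ennreal_mult[symmetric] ennreal_leI)
    qed
    also have "\<dots> = ennreal A * (\<integral>\<^sup>+j. ennreal ((1 + iabs n + iabs j) powr (- 1 - 1)) \<partial>count_space UNIV)"
      by (rule nn_integral_cmult) simp
    also have "\<dots> \<le> ennreal A * ennreal (D * (1 + iabs n) powr (- 1))"
      by (intro mult_left_mono S) auto
    finally have "ennreal ((1 + iabs n) powr (\<alpha> + 2 - 1 - \<alpha>)) * spread (\<alpha> + 2) f n \<le>
      ennreal ((1 + iabs n) powr (\<alpha> + 2 - 1 - \<alpha>)) * (ennreal A * ennreal (D * (1 + iabs n) powr (- 1)))"
      by (intro mult_left_mono) auto
    also have "\<dots> = ennreal (A * D)"
    proof -
      have "ennreal (y powr (\<alpha> + 2 - 1 - \<alpha>)) * (ennreal A * ennreal (D * y powr (- 1))) = ennreal (A * D)" if "y > 0" for y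
        using that A0 D by (simp add: ennreal_mult[symmetric] powr_minus_divide)
      from this[of "1 + iabs n"] show ?thesis by (simp add: add_pos_nonneg del: ennreal_plus)
    qed
    finally show ?thesis .
  qed
  then have "Lnorm wmeasure q (\<lambda>n. ennreal ((1 + iabs n) powr (\<alpha> + 2 - 1 - \<alpha>)) * spread (\<alpha> + 2) f n) \<le> ennreal (A * D)"
    unfolding True Lnorm_wmeasure_top by (intro SUP_least)
  then show ?thesis using a by (intro exI[of _ "\<alpha> + 2"]) (auto elim: le_less_trans)
next
  case False
  define Q where "Q = enn2real q"
  have Q: "Q \<ge> 1" using enn2real_ge_1[OF q False] by (simp add: Q_def)
  \<comment> \<open>The solution of -1 + (M - 1 - \<alpha>) Q - (M - 1)(Q - 1) = 0. It also gives
    -(M - 1) = -1 - \<alpha> Q, so the sum over n reproduces the weight of the norm of f.\<close>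
  define M where "M = \<alpha> * Q + 2"
  have aQ: "\<alpha> * Q > 0" using a Q by simp
  have M: "M > 2" using aQ by (simp add: M_def)
  let ?X = "\<lambda>n j. 1 + iabs n + iabs j"
  obtain D where D: "D \<ge> 0" and S: "\<And>a. a \<ge> 1 \<Longrightarrow> (\<integral>\<^sup>+j. ennreal ((a + iabs j) powr (- 1 - (M - 1))) \<partial>count_space UNIV) \<le> ennreal (D * a powr (- (M - 1)))"
    using nn_integral_powr_int[of "M - 1"] M by auto
  have S': "(\<integral>\<^sup>+j. ennreal (?X n j powr (- M)) \<partial>count_space UNIV) \<le> ennreal (D * (1 + iabs n) powr (- (M - 1)))" for n
    using S[of "1 + iabs n"] by simp
  have step: "ennreal (1 / (1 + iabs n)) * ennpowr (ennreal ((1 + iabs n) powr (M - 1 - \<alpha>)) * spread M f n) Q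
    \<le> ennreal (D powr (Q - 1)) * (\<integral>\<^sup>+j. ennreal (?X n j powr (- M)) * ennreal (\<bar>f j\<bar> powr Q) \<partial>count_space UNIV)" for n
  proof -
    let ?N = "density (count_space UNIV) (\<lambda>j. ennreal (?X n j powr (- M)))"
    let ?y = "1 + iabs n"
    define r where "r = enn2real (\<integral>\<^sup>+j. ennreal (?X n j powr (- M)) \<partial>count_space UNIV)"
    have r: "(\<integral>\<^sup>+j. ennreal (?X n j powr (- M)) \<partial>count_space UNIV) = ennreal r"
      using le_less_trans[OF S' ennreal_less_top] by (simp add: r_def ennreal_enn2real_if less_top)
    have r_le: "r \<le> D * ?y powr (- (M - 1))" using S'[of n] D unfolding r by (subst (asm) ennreal_le_iff) auto
    have "r \<noteq> 0"
    proof
      assume "r = 0"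
      with r have "(\<integral>\<^sup>+j. ennreal (?X n j powr (- M)) \<partial>count_space UNIV) = 0" by simp
      then have "ennreal (?X n 0 powr (- M)) = 0"
        by (subst (asm) nn_integral_0_iff_AE) (auto simp: AE_count_space)
      then show False by (simp add: ennreal_eq_0_iff powr_def split: if_splits)
    qed
    then have r0: "r > 0" by (simp add: r_def less_le)
    have R: "emeasure ?N (space ?N) = ennreal r" using r by (simp add: emeasure_density cong: nn_integral_cong)
    have "spread M f n = (\<integral>\<^sup>+j. ennreal \<bar>f j\<bar> \<partial>?N)"
      unfolding spread_def by (subst nn_integral_density) (auto simp: ennreal_mult)
    then have "ennpowr (spread M f n) Q \<le> ennreal (r powr (Q - 1)) * (\<integral>\<^sup>+j. ennpowr (ennreal \<bar>f j\<bar>) Q \<partial>?N)"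
      using nn_jensen[OF _ R r0 Q, of "\<lambda>j. ennreal \<bar>f j\<bar>"] by simp
    also have "(\<integral>\<^sup>+j. ennpowr (ennreal \<bar>f j\<bar>) Q \<partial>?N) = (\<integral>\<^sup>+j. ennreal (?X n j powr (- M)) * ennreal (\<bar>f j\<bar> powr Q) \<partial>count_space UNIV)" (is "_ = ?F")
      by (subst nn_integral_density) auto
    finally have 1: "ennpowr (spread M f n) Q \<le> ennreal (r powr (Q - 1)) * ?F" .
    have "r powr (Q - 1) \<le> (D * ?y powr (- (M - 1))) powr (Q - 1)" using r_le r0 Q by (intro powr_mono2) auto
    also have "\<dots> = D powr (Q - 1) * ?y powr (- (M - 1) * (Q - 1))" using D by (simp add: powr_mult powr_powr)
    finally have 2: "r powr (Q - 1) \<le> D powr (Q - 1) * ?y powr (- (M - 1) * (Q - 1))" .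
    have "ennreal (1 / ?y) * ennpowr (ennreal (?y powr (M - 1 - \<alpha>)) * spread M f n) Q
      = ennreal (1 / ?y) * (ennreal (?y powr ((M - 1 - \<alpha>) * Q)) * ennpowr (spread M f n) Q)"
      by (subst ennpowr_cmult) (auto simp: powr_powr)
    also have "\<dots> \<le> ennreal (1 / ?y) * (ennreal (?y powr ((M - 1 - \<alpha>) * Q)) * (ennreal (D powr (Q - 1) * ?y powr (- (M - 1) * (Q - 1))) * ?F))"
      using order_trans[OF 1 mult_right_mono[OF ennreal_leI[OF 2]]] by (intro mult_left_mono) auto
    also have "\<dots> = ennreal (1 / ?y * (?y powr ((M - 1 - \<alpha>) * Q) * (D powr (Q - 1) * ?y powr (- (M - 1) * (Q - 1))))) * ?F"
    proof -
      have g: "ennreal u * (ennreal v * (ennreal x * X)) = ennreal (u * (v * x)) * X" if "u \<ge> 0" "v \<ge> 0" "x \<ge> 0" for u v x X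
        using that by (simp add: ennreal_mult mult.assoc)
      show ?thesis by (rule g) (use D in auto)
    qed
    also have "1 / ?y * (?y powr ((M - 1 - \<alpha>) * Q) * (D powr (Q - 1) * ?y powr (- (M - 1) * (Q - 1)))) = D powr (Q - 1)"
    proof -
      have "1 / ?y = ?y powr (- 1)" by (simp add: powr_minus_divide)
      then have "1 / ?y * (?y powr ((M - 1 - \<alpha>) * Q) * (D powr (Q - 1) * ?y powr (- (M - 1) * (Q - 1)))) =
        D powr (Q - 1) * ?y powr (- 1 + (M - 1 - \<alpha>) * Q + - (M - 1) * (Q - 1))"
        unfolding powr_add by simp
      also have "- 1 + (M - 1 - \<alpha>) * Q + - (M - 1) * (Q - 1) = 0" by (simp add: M_def algebra_simps)
      finally show ?thesis by simp
    qed
    finally show ?thesis .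
  qed
  have "(\<integral>\<^sup>+n. ennreal (1 / (1 + iabs n)) * ennpowr (ennreal ((1 + iabs n) powr (M - 1 - \<alpha>)) * spread M f n) Q \<partial>count_space UNIV)
    \<le> (\<integral>\<^sup>+n. ennreal (D powr (Q - 1)) * (\<integral>\<^sup>+j. ennreal (?X n j powr (- M)) * ennreal (\<bar>f j\<bar> powr Q) \<partial>count_space UNIV) \<partial>count_space UNIV)"
    by (intro nn_integral_mono step)
  also have "\<dots> = ennreal (D powr (Q - 1)) * (\<integral>\<^sup>+n. (\<integral>\<^sup>+j. ennreal (?X n j powr (- M)) * ennreal (\<bar>f j\<bar> powr Q) \<partial>count_space UNIV) \<partial>count_space UNIV)"
    by (rule nn_integral_cmult) simp
  also have "(\<integral>\<^sup>+n. (\<integral>\<^sup>+j. ennreal (?X n j powr (- M)) * ennreal (\<bar>f j\<bar> powr Q) \<partial>count_space UNIV) \<partial>count_space UNIV)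
    = (\<integral>\<^sup>+j. (\<integral>\<^sup>+n. ennreal (?X n j powr (- M)) * ennreal (\<bar>f j\<bar> powr Q) \<partial>count_space UNIV) \<partial>count_space UNIV)"
  proof -
    interpret pair_sigma_finite "count_space (UNIV :: int set)" "count_space (UNIV :: int set)"
      by (intro pair_sigma_finite.intro sigma_finite_count_int)
    show ?thesis by (rule Fubini'[symmetric]) (auto intro: measurable_pair_measure_countable1)
  qed
  also have "\<dots> \<le> (\<integral>\<^sup>+j. ennreal D * (ennreal (1 / (1 + iabs j)) * ennpowr (ennreal (\<bar>f j\<bar> * (1 + iabs j) powr (- \<alpha>))) Q) \<partial>count_space UNIV)"
  proof (intro nn_integral_mono)
    fix j
    let ?y = "1 + iabs j"
    have "(\<integral>\<^sup>+n. ennreal (?X n j powr (- M)) * ennreal (\<bar>f j\<bar> powr Q) \<partial>count_space UNIV) = (\<integral>\<^sup>+n. ennreal (?X j n powr (- M)) \<partial>count_space UNIV) * ennreal (\<bar>f j\<bar> powr Q)"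
      by (subst nn_integral_multc) (auto simp: add_ac)
    also have "\<dots> \<le> ennreal (D * ?y powr (- (M - 1))) * ennreal (\<bar>f j\<bar> powr Q)" by (intro mult_right_mono S') auto
    also have "\<dots> = ennreal (D * (?y powr (- (M - 1)) * \<bar>f j\<bar> powr Q))" using D by (simp add: ennreal_mult[symmetric] mult_ac)
    also have "?y powr (- (M - 1)) * \<bar>f j\<bar> powr Q = 1 / ?y * (\<bar>f j\<bar> * ?y powr (- \<alpha>)) powr Q"
    proof -
      have "1 / ?y = ?y powr (- 1)" by (simp add: powr_minus_divide)
      then have "1 / ?y * (\<bar>f j\<bar> * ?y powr (- \<alpha>)) powr Q = ?y powr (- 1) * (\<bar>f j\<bar> powr Q * ?y powr (- \<alpha> * Q))"
        by (simp add: powr_mult powr_powr)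
      also have "\<dots> = \<bar>f j\<bar> powr Q * ?y powr (- 1 + - \<alpha> * Q)" unfolding powr_add by simp
      also have "- 1 + - \<alpha> * Q = - (M - 1)" by (simp add: M_def)
      finally show ?thesis by simp
    qed
    also have "ennreal (D * (1 / ?y * (\<bar>f j\<bar> * ?y powr (- \<alpha>)) powr Q)) = ennreal D * (ennreal (1 / ?y) * ennpowr (ennreal (\<bar>f j\<bar> * ?y powr (- \<alpha>))) Q)"
      using D by (subst ennpowr_ennreal) (auto simp: ennreal_mult[symmetric])
    finally show "(\<integral>\<^sup>+n. ennreal (?X n j powr (- M)) * ennreal (\<bar>f j\<bar> powr Q) \<partial>count_space UNIV) \<le> ennreal D * (ennreal (1 / ?y) * ennpowr (ennreal (\<bar>f j\<bar> * ?y powr (- \<alpha>))) Q)" .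
  qed
  also have "\<dots> = ennreal D * (\<integral>\<^sup>+j. ennreal (1 / (1 + iabs j)) * ennpowr (ennreal (\<bar>f j\<bar> * (1 + iabs j) powr (- \<alpha>))) Q \<partial>count_space UNIV)"
    by (rule nn_integral_cmult) simp
  also have "ennreal (D powr (Q - 1)) * \<dots> < \<infinity>"
    using fin[unfolded wnorm_def Lnorm_wmeasure_finite_iff[OF False]]
    by (simp add: ennreal_mult_less_top Q_def del: ennpowr_ennreal)
  finally have "Lnorm wmeasure q (\<lambda>n. ennreal ((1 + iabs n) powr (M - 1 - \<alpha>)) * spread M f n) < \<infinity>"
    unfolding Lnorm_wmeasure_finite_iff[OF False] Q_def by (simp add: mult_left_mono)
  then show ?thesis using M by (intro exI[of _ M]) auto
qed

text \<open>The interval from (1 + |n|)^2 to (2 + |n|)^2 has dt/t-mass comparable to 1 / (1 + |n|),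
  the weight of the atom n, and these intervals overlap at most twice. A sequence dominated on its
  intervals by b therefore inherits the norm of b.\<close>

lemma Lnorm_wmeasure_dt:
  assumes q: "1 \<le> q" and [measurable]: "b \<in> borel_measurable borel" and fin: "Lnorm dt_over_t q b < \<infinity>"
    and ab: "\<And>n t. (1 + iabs n)\<^sup>2 < t \<Longrightarrow> t < (2 + iabs n)\<^sup>2 \<Longrightarrow> a n \<le> b t"
  shows "Lnorm wmeasure q a < \<infinity>"
proof -
  define I where "I n = {(1 + iabs n)\<^sup>2 <..< (2 + iabs n)\<^sup>2}" for n
  have [measurable]: "I n \<in> sets borel" for n by (simp add: I_def)
  have len: "(2 + iabs n)\<^sup>2 - (1 + iabs n)\<^sup>2 = 3 + 2 * iabs n" for n
    by (simp add: power2_eq_square algebra_simps)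
  have eI: "emeasure lborel (I n) = ennreal (3 + 2 * iabs n)" for n
    unfolding I_def using len[of n] by (subst emeasure_lborel_Ioo) auto
  have Ipos: "t > 0" if "t \<in> I n" for t n
    using that zero_le_power2[of "1 + iabs n"] unfolding I_def greaterThanLessThan_iff by linarith
  show ?thesis
  proof (cases "q = \<infinity>")
    case True
    define B where "B = esssup dt_over_t b"
    have "AE t in dt_over_t. b t \<le> B" unfolding B_def by (rule esssup_AE)
    then have ae: "AE t in lborel. 0 < t \<longrightarrow> b t \<le> B"
      unfolding dt_over_t_def by (subst (asm) AE_density)
        (auto simp: AE_restrict_space_iff measurable_restrict_space1 elim!: eventually_mono)
    have "a n \<le> B" for n
    proof (rule ccontr)
      assume "\<not> a n \<le> B"
      then have "b t > B" if "t \<in> I n" for t using ab[of n t] that by (auto simp: I_def)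
      \<comment> \<open>For the sup norm it suffices that each interval has positive length: an
        essential bound must be attained somewhere on it.\<close>
      with ae have "AE t in lborel. t \<notin> I n" using Ipos by (auto elim!: eventually_mono simp: not_le[symmetric])
      then have "emeasure lborel (I n) = 0" by (subst (asm) AE_iff_measurable[OF _ refl]) auto
      then show False unfolding eI by (simp add: ennreal_eq_0_iff)
    qed
    then have "Lnorm wmeasure q a \<le> B" unfolding True Lnorm_wmeasure_top by (intro SUP_least)
    also have "B < \<infinity>" using fin True by (simp add: B_def Lnorm_def)
    finally show ?thesis .
  next
    case False
    define Q where "Q = enn2real q"
    have Q: "Q \<ge> 1" using enn2real_ge_1[OF q False] by (simp add: Q_def)
    define F where "F t = ennreal (1 / t) * ennpowr (b t) Q" for t
    have [measurable]: "F \<in> borel_measurable borel" unfolding F_def by measurable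
    have 1: "ennreal (1 / (1 + iabs n)) * ennpowr (a n) Q \<le> ennreal 2 * (\<integral>\<^sup>+t. F t * indicator (I n) t \<partial>lborel)" for n
    proof -
      let ?x = "iabs n"
      \<comment> \<open>The length 3 + 2x of the interval times the least value of 1/t on it is at
        least half the weight 1 / (1 + x).\<close>
      have "1 / (1 + ?x) \<le> 2 * (1 / (2 + ?x)\<^sup>2 * (3 + 2 * ?x))"
      proof -
        have "(2 + x)\<^sup>2 \<le> 2 * (3 + 2 * x) * (1 + x)" if "x \<ge> 0" for x :: real
          using that mult_nonneg_nonneg[OF that that] by (simp add: power2_eq_square algebra_simps)
        from this[of ?x] have "(2 + ?x)\<^sup>2 \<le> 2 * (3 + 2 * ?x) * (1 + ?x)" by simp
        then show ?thesis by (simp add: field_simps)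
      qed
      then have "ennreal (1 / (1 + ?x)) * ennpowr (a n) Q \<le> ennreal (2 * (1 / (2 + ?x)\<^sup>2 * (3 + 2 * ?x))) * ennpowr (a n) Q"
        by (intro mult_right_mono ennreal_leI) auto
      also have "ennreal (2 * (1 / (2 + ?x)\<^sup>2 * (3 + 2 * ?x))) = ennreal 2 * (ennreal (1 / (2 + ?x)\<^sup>2) * emeasure lborel (I n))"
      proof -
        have g: "ennreal (2 * (u * v)) = ennreal 2 * (ennreal u * ennreal v)" if "u \<ge> 0" "v \<ge> 0" for u v
          using that by (simp add: ennreal_mult)
        show ?thesis unfolding eI by (rule g) auto
      qed
      also have "\<dots> * ennpowr (a n) Q = ennreal 2 * (ennreal (1 / (2 + ?x)\<^sup>2) * ennpowr (a n) Q * emeasure lborel (I n))"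
        by (simp only: mult_ac)
      also have "ennreal (1 / (2 + ?x)\<^sup>2) * ennpowr (a n) Q * emeasure lborel (I n) = (\<integral>\<^sup>+t. ennreal (1 / (2 + ?x)\<^sup>2) * ennpowr (a n) Q * indicator (I n) t \<partial>lborel)"
        by (subst nn_integral_cmult_indicator) auto
      also have "\<dots> \<le> (\<integral>\<^sup>+t. F t * indicator (I n) t \<partial>lborel)"
      proof (intro nn_integral_mono)
        fix t
        show "ennreal (1 / (2 + ?x)\<^sup>2) * ennpowr (a n) Q * indicator (I n) t \<le> F t * indicator (I n) t"
        proof (cases "t \<in> I n")
          case True
          then have "t < (2 + ?x)\<^sup>2" "t > 0" using Ipos by (auto simp: I_def)
          moreover have "a n \<le> b t" using True by (intro ab) (auto simp: I_def)
          ultimately have "ennreal (1 / (2 + ?x)\<^sup>2) * ennpowr (a n) Q \<le> F t"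
            unfolding F_def using Q by (intro mult_mono ennreal_leI ennpowr_mono divide_left_mono) auto
          then show ?thesis by (intro mult_right_mono) auto
        qed simp
      qed
      finally show ?thesis by (simp add: mult_left_mono)
    qed
    have 2: "(\<integral>\<^sup>+n. indicator (I n) t \<partial>count_space UNIV) \<le> ennreal 2 * indicator {0<..} t" for t :: real
    proof (cases "\<exists>n. t \<in> I n")
      case True
      then obtain n where n: "t \<in> I n" by blast
      \<comment> \<open>The interval depends on |n| alone and intervals for different |n| are
        disjoint, so at most n and -n share a point.\<close>
      have "{m. t \<in> I m} \<subseteq> {\<bar>n\<bar>, - \<bar>n\<bar>}"
      proof
        fix m assume "m \<in> {m. t \<in> I m}"
        then have m: "t \<in> I m" by simp
        have "(1 + iabs m)\<^sup>2 < (2 + iabs n)\<^sup>2" "(1 + iabs n)\<^sup>2 < (2 + iabs m)\<^sup>2"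
          using n m unfolding I_def greaterThanLessThan_iff by linarith+
        then have "1 + iabs m < 2 + iabs n" "1 + iabs n < 2 + iabs m"
          by (auto dest!: power_less_imp_less_base)
        then have "\<bar>m\<bar> = \<bar>n\<bar>" by linarith
        then show "m \<in> {\<bar>n\<bar>, - \<bar>n\<bar>}" by auto
      qed
      then have "emeasure (count_space UNIV) {m. t \<in> I m} \<le> emeasure (count_space UNIV) {\<bar>n\<bar>, - \<bar>n\<bar>}"
        by (rule emeasure_mono) simp
      also have "\<dots> \<le> 2" by (subst emeasure_count_space_finite) (auto simp: card_insert_if)
      finally have "(\<integral>\<^sup>+m. indicator {m. t \<in> I m} m \<partial>count_space UNIV) \<le> (2::ennreal)" by simp
      moreover have "indicator {m. t \<in> I m} m = (indicator (I m) t :: ennreal)" for m by (simp add: indicator_def)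
      ultimately show ?thesis using Ipos[OF n] by simp
    next
      case False
      then have "(\<integral>\<^sup>+n. indicator (I n) t \<partial>count_space UNIV) = (0::ennreal)" by (simp add: indicator_def)
      then show ?thesis by simp
    qed
    interpret pair_sigma_finite "count_space (UNIV :: int set)" "lborel :: real measure"
      by (intro pair_sigma_finite.intro sigma_finite_count_int lborel.sigma_finite_measure_axioms)
    have [measurable]: "(\<lambda>(n, t). F t * indicator (I n) t) \<in> borel_measurable (count_space UNIV \<Otimes>\<^sub>M lborel)"
      by (rule measurable_pair_measure_countable1) auto
    have "(\<integral>\<^sup>+n. ennreal (1 / (1 + iabs n)) * ennpowr (a n) Q \<partial>count_space UNIV)
      \<le> (\<integral>\<^sup>+n. ennreal 2 * (\<integral>\<^sup>+t. F t * indicator (I n) t \<partial>lborel) \<partial>count_space UNIV)"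
      by (intro nn_integral_mono 1)
    also have "\<dots> = ennreal 2 * (\<integral>\<^sup>+n. (\<integral>\<^sup>+t. F t * indicator (I n) t \<partial>lborel) \<partial>count_space UNIV)"
      by (rule nn_integral_cmult) simp
    also have "(\<integral>\<^sup>+n. (\<integral>\<^sup>+t. F t * indicator (I n) t \<partial>lborel) \<partial>count_space UNIV) = (\<integral>\<^sup>+t. (\<integral>\<^sup>+n. F t * indicator (I n) t \<partial>count_space UNIV) \<partial>lborel)"
      by (rule Fubini'[symmetric]) simp
    also have "\<dots> \<le> (\<integral>\<^sup>+t. ennreal 2 * (F t * indicator {0<..} t) \<partial>lborel)"
    proof (intro nn_integral_mono)
      fix t
      have "(\<integral>\<^sup>+n. F t * indicator (I n) t \<partial>count_space UNIV) = F t * (\<integral>\<^sup>+n. indicator (I n) t \<partial>count_space UNIV)"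
        by (rule nn_integral_cmult) simp
      also have "\<dots> \<le> F t * (ennreal 2 * indicator {0<..} t)" by (intro mult_left_mono 2) auto
      finally show "(\<integral>\<^sup>+n. F t * indicator (I n) t \<partial>count_space UNIV) \<le> ennreal 2 * (F t * indicator {0<..} t)" by (simp add: mult_ac)
    qed
    also have "\<dots> = ennreal 2 * (\<integral>\<^sup>+t. ennpowr (b t) Q \<partial>dt_over_t)"
      by (subst nn_integral_dt) (auto simp: F_def nn_integral_cmult)
    also have "ennreal 2 * \<dots> < \<infinity>"
      using fin[unfolded Lnorm_finite_iff[OF False]] by (simp add: Q_def ennreal_mult_less_top)
    finally show ?thesis unfolding Lnorm_wmeasure_finite_iff[OF False] Q_def by (simp add: mult_left_mono)
  qed
qed

text \<open>Hardy's inequality, with the outer integral discretised at the scales \<open>(1 + \<bar>n\<bar>)\<^sup>2\<close>.\<close>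

lemma Lnorm_wmeasure_Hardy:
  assumes q: "1 \<le> q" and A: "A > 0" and [measurable]: "\<phi> \<in> borel_measurable borel"
    and fin: "Lnorm dt_over_t q (\<lambda>t. ennreal (t powr B) * \<phi> t) < \<infinity>"
  shows "Lnorm wmeasure q (\<lambda>n. ennreal ((1 + iabs n) powr (- (2 * A))) *
     (\<integral>\<^sup>+r\<in>{0<..<(1 + iabs n)\<^sup>2}. ennreal (r powr (A + B - 1)) * \<phi> r \<partial>lborel)) < \<infinity>"
proof -
  define G where "G t = ennreal (t powr B) * \<phi> t" for t
  have [measurable]: "G \<in> borel_measurable borel" unfolding G_def by measurable
  \<comment> \<open>The substitution r = y t turns the Hardy average over (0, t) into a
    superposition of dilations with this weight, whose mass is 1/A.\<close>
  define w where "w y = y powr (A - 1) * indicator {0<..<1} y" for y :: real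
  have [measurable]: "w \<in> borel_measurable borel" unfolding w_def by measurable
  \<comment> \<open>The factor 4^A accounts for t < (2 + |n|)^2 <= 4 (1 + |n|)^2.\<close>
  define b where "b t = ennreal (4 powr A) * (\<integral>\<^sup>+y. ennreal (w y) * G (y * t) \<partial>lborel)" for t
  have [measurable]: "b \<in> borel_measurable borel" unfolding b_def by measurable
  have wint: "(\<integral>\<^sup>+y. ennreal (w y) \<partial>lborel) = ennreal (1 / A)"
    using nn_integral_powr_0[OF A, of 1] by (simp add: w_def ennreal_mult ennreal_indicator)
  have "Lnorm dt_over_t q (\<lambda>t. \<integral>\<^sup>+y. ennreal (w y) * G (y * t) \<partial>lborel) \<le> (\<integral>\<^sup>+y. ennreal (w y) \<partial>lborel) * Lnorm dt_over_t q G"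
    by (rule Lnorm_Mellin[OF _ _ _ _ _ q]) (auto simp: w_def indicator_def split: if_splits)
  also have "\<dots> < \<infinity>" using fin unfolding wint by (simp add: G_def[abs_def] ennreal_mult_less_top)
  finally have "ennreal (4 powr A) * Lnorm dt_over_t q (\<lambda>t. \<integral>\<^sup>+y. ennreal (w y) * G (y * t) \<partial>lborel) < \<infinity>"
    by (simp add: ennreal_mult_less_top)
  then have bfin: "Lnorm dt_over_t q b < \<infinity>"
    unfolding b_def by (intro le_less_trans[OF Lnorm_cmult_le[OF _ q]] measurable_dt) auto
  have H: "(\<integral>\<^sup>+r\<in>{0<..<t}. ennreal (r powr (A + B - 1)) * \<phi> r \<partial>lborel) = ennreal (t powr A) * (\<integral>\<^sup>+y. ennreal (w y) * G (y * t) \<partial>lborel)"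
    if t: "t > 0" for t
  proof -
    have "(\<integral>\<^sup>+r\<in>{0<..<t}. ennreal (r powr (A + B - 1)) * \<phi> r \<partial>lborel) =
      ennreal \<bar>t\<bar> * (\<integral>\<^sup>+y. ennreal ((0 + t * y) powr (A + B - 1)) * \<phi> (0 + t * y) * indicator {0<..<t} (0 + t * y) \<partial>lborel)"
      using t by (intro nn_integral_real_affine) auto
    also have "\<dots> = (\<integral>\<^sup>+y. ennreal \<bar>t\<bar> * (ennreal ((0 + t * y) powr (A + B - 1)) * \<phi> (0 + t * y) * indicator {0<..<t} (0 + t * y)) \<partial>lborel)"
      by (rule nn_integral_cmult[symmetric]) measurable
    also have "\<dots> = (\<integral>\<^sup>+y. ennreal (t powr A) * (ennreal (w y) * G (y * t)) \<partial>lborel)"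
    proof (rule nn_integral_cong)
      fix y
      show "ennreal \<bar>t\<bar> * (ennreal ((0 + t * y) powr (A + B - 1)) * \<phi> (0 + t * y) * indicator {0<..<t} (0 + t * y)) = ennreal (t powr A) * (ennreal (w y) * G (y * t))"
      proof (cases "0 < y \<and> y < 1")
        case True
        then have ty: "0 < t * y" "t * y < t" using t by auto
        have "t * (t * y) powr (A + B - 1) = t powr A * (y powr (A - 1) * (y * t) powr B)"
        proof -
          have "t * (t * y) powr (A + B - 1) = t powr 1 * (t powr (A + B - 1) * y powr (A + B - 1))"
            using t True by (simp add: powr_mult)
          also have "\<dots> = t powr (1 + (A + B - 1)) * y powr (A + B - 1)" by (simp only: powr_add mult.assoc)
          also have "\<dots> = t powr (A + B) * y powr (A - 1 + B)" by (simp add: algebra_simps)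
          also have "\<dots> = t powr A * (y powr (A - 1) * (y * t) powr B)"
            using t True unfolding powr_add by (simp add: powr_mult)
          finally show ?thesis .
        qed
        then have "ennreal t * ennreal ((t * y) powr (A + B - 1)) = ennreal (t powr A) * (ennreal (w y) * ennreal ((y * t) powr B))"
          using t True by (simp add: w_def ennreal_mult[symmetric])
        then show ?thesis using t True ty by (simp add: G_def mult.assoc[symmetric]) (simp add: mult.commute[of t y])
      next
        case False
        then have "\<not> (0 < t * y \<and> t * y < t)" using t by (auto simp: zero_less_mult_iff)
        then show ?thesis using False by (auto simp: w_def)
      qed
    qed
    also have "\<dots> = ennreal (t powr A) * (\<integral>\<^sup>+y. ennreal (w y) * G (y * t) \<partial>lborel)" by (rule nn_integral_cmult) measurable
    finally show ?thesis .
  qed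
  show ?thesis
  proof (rule Lnorm_wmeasure_dt[OF q _ bfin])
    fix n :: int and t :: real
    let ?y = "1 + iabs n"
    assume t: "?y\<^sup>2 < t" "t < (2 + iabs n)\<^sup>2"
    have y: "?y \<ge> 1" by simp
    have t0: "t > 0" using t(1) zero_le_power2[of ?y] by linarith
    have "(2 + iabs n)\<^sup>2 \<le> (2 * ?y)\<^sup>2" by (intro power_mono) auto
    then have "t \<le> 4 * ?y\<^sup>2" using t(2) unfolding power_mult_distrib by simp
    then have "t powr A \<le> (4 * ?y\<^sup>2) powr A" using A t0 by (intro powr_mono2) auto
    also have "\<dots> = 4 powr A * ?y powr (2 * A)"
    proof -
      have "?y\<^sup>2 = ?y powr 2" by simp
      then show ?thesis by (simp only: powr_mult powr_powr)
    qed
    finally have "?y powr (- (2 * A)) * t powr A \<le> 4 powr A"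
      by (simp add: powr_minus_divide divide_le_eq add_pos_nonneg)
    moreover have "(\<integral>\<^sup>+r\<in>{0<..<?y\<^sup>2}. ennreal (r powr (A + B - 1)) * \<phi> r \<partial>lborel) \<le> (\<integral>\<^sup>+r\<in>{0<..<t}. ennreal (r powr (A + B - 1)) * \<phi> r \<partial>lborel)"
      using t(1) by (intro nn_integral_mono) (auto simp: indicator_def)
    ultimately have "ennreal (?y powr (- (2 * A))) * (\<integral>\<^sup>+r\<in>{0<..<?y\<^sup>2}. ennreal (r powr (A + B - 1)) * \<phi> r \<partial>lborel)
      \<le> ennreal (?y powr (- (2 * A))) * (ennreal (t powr A) * (\<integral>\<^sup>+y. ennreal (w y) * G (y * t) \<partial>lborel))"
      unfolding H[OF t0] by (intro mult_left_mono) auto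
    also have "\<dots> = ennreal (?y powr (- (2 * A)) * t powr A) * (\<integral>\<^sup>+y. ennreal (w y) * G (y * t) \<partial>lborel)"
      by (simp add: ennreal_mult mult.assoc)
    also have "\<dots> \<le> b t"
      unfolding b_def using \<open>?y powr (- (2 * A)) * t powr A \<le> 4 powr A\<close> by (intro mult_right_mono ennreal_leI) auto
    finally show "ennreal (?y powr (- (2 * A))) * (\<integral>\<^sup>+r\<in>{0<..<?y\<^sup>2}. ennreal (r powr (A + B - 1)) * \<phi> r \<partial>lborel) \<le> b t" .
  qed simp
qed

section \<open>Differences of the semigroup\<close>

lemma abs_heat_Lap_le:
  assumes "f \<in> expb"
  shows "ennreal \<bar>heat t ((Lap ^^ L) f) n\<bar> \<le> (\<integral>\<^sup>+j. ennreal (\<bar>lap_kernel L t (n - j)\<bar> * \<bar>f j\<bar>) \<partial>count_space UNIV)"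
  using has_sum_abs_le_nn_integral[OF lap_kernel_has_sum[OF assms]] by (simp add: abs_mult)

text \<open>In this time window sqrt(1 + t) is comparable to 1 + |n|, so the kernel bound collapses
  to a power of 1 + |n| times the symmetric majorant. The factor K leaves room for finitely many
  multiples of the scale.\<close>

lemma heat_Lap_spread:
  assumes M: "M > 0" and K: "K \<ge> 1"
  shows "\<exists>C\<ge>0. \<forall>f\<in>expb. \<forall>n t. (1 + iabs n)\<^sup>2 \<le> t \<longrightarrow> t \<le> K * (1 + iabs n)\<^sup>2 \<longrightarrow>
    ennreal \<bar>heat t ((Lap ^^ L) f) n\<bar> \<le> ennreal (C * (1 + iabs n) powr (M - 1 - 2 * real L)) * spread M f n"
proof -
  define e where "e = M - 1 - 2 * real L"
  obtain C where C: "C \<ge> 0" and B: "\<And>t n. t \<ge> 0 \<Longrightarrow> \<bar>lap_kernel L t n\<bar> \<le>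
     C * sqrt (1 + t) powr e * (sqrt (1 + t) + iabs n) powr (- M)"
    using lap_kernel_bound[OF M, of L] unfolding e_def by blast
  \<comment> \<open>The exponent e may have either sign; the absolute value makes c at least 1,
    which covers the negative case as well.\<close>
  define c where "c = sqrt (1 + K) powr \<bar>e\<bar>"
  show ?thesis
  proof (intro exI[of _ "C * c * 2 powr M"] conjI ballI allI impI)
    fix f n t assume f: "f \<in> expb"
    let ?y = "1 + iabs n"
    assume t: "?y\<^sup>2 \<le> t" "t \<le> K * ?y\<^sup>2"
    have y: "?y \<ge> 1" by simp
    have t0: "t \<ge> 0" using t(1) zero_le_power2[of ?y] by linarith
    define r where "r = sqrt (1 + t)"
    have r1: "?y \<le> r" unfolding r_def using t(1) by (intro real_le_rsqrt) simp
    have "1 + t \<le> (1 + K) * ?y\<^sup>2" using t(2) one_le_power[OF y, of 2] unfolding distrib_right by linarith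
    then have "r \<le> sqrt ((1 + K) * ?y\<^sup>2)" unfolding r_def by (rule real_sqrt_le_mono)
    then have r2: "r \<le> sqrt (1 + K) * ?y" by (simp add: real_sqrt_mult)
    have re: "r powr e \<le> c * ?y powr e"
    proof (cases "e \<ge> 0")
      case True
      then have "r powr e \<le> (sqrt (1 + K) * ?y) powr e" using r1 r2 by (intro powr_mono2) auto
      then show ?thesis using True by (simp add: powr_mult c_def)
    next
      case False
      then have "r powr e \<le> ?y powr e" using r1 by (intro powr_mono2') auto
      also have "1 \<le> c" unfolding c_def using K by (intro ge_one_powr_ge_zero) auto
      from mult_right_mono[OF this powr_ge_zero, of ?y e] have "?y powr e \<le> c * ?y powr e" by simp
      finally show ?thesis .
    qed
    have "ennreal \<bar>heat t ((Lap ^^ L) f) n\<bar> \<le> (\<integral>\<^sup>+j. ennreal (\<bar>lap_kernel L t (n - j)\<bar> * \<bar>f j\<bar>) \<partial>count_space UNIV)"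
      by (rule abs_heat_Lap_le[OF f])
    also have "\<dots> \<le> (\<integral>\<^sup>+j. ennreal (C * c * 2 powr M * ?y powr e) * ennreal ((?y + iabs j) powr (- M) * \<bar>f j\<bar>) \<partial>count_space UNIV)"
    proof (intro nn_integral_mono)
      fix j
      have "(?y + iabs j) / 2 \<le> r + iabs (n - j)" using r1 unfolding of_int_diff by argo
      then have "(r + iabs (n - j)) powr (- M) \<le> ((?y + iabs j) / 2) powr (- M)"
        using M by (intro powr_mono2') auto
      also have "\<dots> = 2 powr M * (?y + iabs j) powr (- M)"
        by (simp add: powr_divide powr_minus field_simps)
      finally have 1: "(r + iabs (n - j)) powr (- M) \<le> 2 powr M * (?y + iabs j) powr (- M)" .
      have "\<bar>lap_kernel L t (n - j)\<bar> \<le> C * r powr e * (r + iabs (n - j)) powr (- M)"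
        using B[OF t0, of "n - j"] by (simp add: r_def)
      also have "\<dots> \<le> C * (c * ?y powr e) * (2 powr M * (?y + iabs j) powr (- M))"
        using C by (intro mult_mono mult_left_mono re 1 mult_nonneg_nonneg) (auto simp: c_def)
      finally have "\<bar>lap_kernel L t (n - j)\<bar> * \<bar>f j\<bar> \<le> (C * (c * ?y powr e) * (2 powr M * (?y + iabs j) powr (- M))) * \<bar>f j\<bar>"
        by (intro mult_right_mono) auto
      also have "\<dots> = C * c * 2 powr M * ?y powr e * ((?y + iabs j) powr (- M) * \<bar>f j\<bar>)" by (simp only: mult_ac)
      finally show "ennreal (\<bar>lap_kernel L t (n - j)\<bar> * \<bar>f j\<bar>) \<le> ennreal (C * c * 2 powr M * ?y powr e) * ennreal ((?y + iabs j) powr (- M) * \<bar>f j\<bar>)"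
        using C by (subst ennreal_mult[symmetric]) (auto simp: c_def intro!: ennreal_leI)
    qed
    also have "\<dots> = ennreal (C * c * 2 powr M * ?y powr e) * spread M f n"
      unfolding spread_def by (rule nn_integral_cmult) simp
    finally show "ennreal \<bar>heat t ((Lap ^^ L) f) n\<bar> \<le> ennreal (C * c * 2 powr M * ?y powr (M - 1 - 2 * real L)) * spread M f n"
      by (simp add: e_def)
  qed (use C in \<open>simp add: c_def\<close>)
qed

text \<open>A pointwise substitute for the norm estimate: by the mean value theorem each difference
  becomes \<tau> times a time derivative at a time at most \<tau> later, hence the range up to L
  \<tau>.\<close>

lemma hdiff_pow_MVT:
  assumes "f \<in> expb" "\<tau> > 0" "\<And>s. 0 \<le> s \<Longrightarrow> s \<le> real L * \<tau> \<Longrightarrow> \<bar>heat s ((Lap ^^ L) f) n\<bar> \<le> B"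
  shows "\<bar>(hdiff \<tau> ^^ L) f n\<bar> \<le> \<tau> ^ L * B"
  using assms
proof (induction L arbitrary: f B)
  case 0
  then show ?case using 0(3)[of 0] by (simp add: heat_0)
next
  case (Suc L)
  note f = Suc.prems(1) and \<tau> = Suc.prems(2)
  have "\<bar>(hdiff \<tau> ^^ L) (hdiff \<tau> f) n\<bar> \<le> \<tau> ^ L * (\<tau> * B)"
  proof (rule Suc.IH[OF expb_hdiff[OF f] \<tau>])
    fix s assume s: "0 \<le> s" "s \<le> real L * \<tau>"
    have "heat s ((Lap ^^ L) (hdiff \<tau> f)) n = heat s (hdiff \<tau> ((Lap ^^ L) f)) n"
      using Lap_pow_hdiff_pow[OF f, where k = 1 and \<tau> = \<tau> and l = L] by simp
    also have "\<dots> = heat (s + \<tau>) ((Lap ^^ L) f) n - heat s ((Lap ^^ L) f) n"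
      using f by (simp add: heat_hdiff expb_Lap_pow) (simp add: hdiff_def heat_heat expb_Lap_pow)
    finally have e: "heat s ((Lap ^^ L) (hdiff \<tau> f)) n = heat (s + \<tau>) ((Lap ^^ L) f) n - heat s ((Lap ^^ L) f) n" .
    have "\<exists>z. s < z \<and> z < s + \<tau> \<and> heat (s + \<tau>) ((Lap ^^ L) f) n - heat s ((Lap ^^ L) f) n = (s + \<tau> - s) * heat z (Lap ((Lap ^^ L) f)) n"
      using \<tau> by (intro MVT2 heat_has_derivative expb_Lap_pow f) auto
    then obtain z where z: "s < z" "z < s + \<tau>" "heat s ((Lap ^^ L) (hdiff \<tau> f)) n = \<tau> * heat z ((Lap ^^ Suc L) f) n"
      unfolding e by auto
    have "\<bar>heat z ((Lap ^^ Suc L) f) n\<bar> \<le> B"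
      using z s by (intro Suc.prems(3)) (auto simp: algebra_simps)
    then show "\<bar>heat s ((Lap ^^ L) (hdiff \<tau> f)) n\<bar> \<le> \<tau> * B"
      using \<tau> unfolding z(3) by (simp add: abs_mult)
  qed
  then show ?case by (simp add: funpow_swap1 mult_ac)
qed

text \<open>The binomial expansion of (e^{\<tau>\<Delta>} - I)^k. The coefficients stay abstract:
  what is recorded is that they depend on k alone and that the one at i = 0 has modulus 1, which
  allows solving for f.\<close>

lemma hdiff_pow_expand:
  "\<exists>c::nat \<Rightarrow> real. \<bar>c 0\<bar> = 1 \<and> (\<forall>\<tau>. \<forall>f\<in>expb. \<forall>n. (hdiff \<tau> ^^ k) f n = (\<Sum>i\<le>k. c i * heat (real i * \<tau>) f n))"
proof (induction k)
  case 0
  show ?case by (rule exI[of _ "\<lambda>_. 1"]) (simp add: heat_0)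
next
  case (Suc k)
  then obtain c where c: "\<bar>c 0\<bar> = (1::real)" and e: "\<And>\<tau> f n. f \<in> expb \<Longrightarrow> (hdiff \<tau> ^^ k) f n = (\<Sum>i\<le>k. c i * heat (real i * \<tau>) f n)"
    by blast
  define d where "d i = (case i of 0 \<Rightarrow> 0 | Suc j \<Rightarrow> c j) - (if i \<le> k then c i else 0)" for i
  show ?case
  proof (intro exI[of _ d] conjI allI ballI)
    show "\<bar>d 0\<bar> = 1" using c by (simp add: d_def)
    fix \<tau> f n assume f: "f \<in> expb"
    let ?h = "\<lambda>i. heat (real i * \<tau>) f n"
    have "(hdiff \<tau> ^^ Suc k) f n = (hdiff \<tau> ^^ k) (hdiff \<tau> f) n" by (simp add: funpow_swap1)
    also have "\<dots> = (\<Sum>i\<le>k. c i * heat (real i * \<tau>) (hdiff \<tau> f) n)" by (rule e[OF expb_hdiff[OF f]])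
    also have "\<dots> = (\<Sum>i\<le>k. c i * ?h (Suc i) - c i * ?h i)"
      using f by (intro sum.cong refl) (simp add: heat_hdiff hdiff_def heat_heat algebra_simps)
    also have "\<dots> = (\<Sum>i\<le>k. c i * ?h (Suc i)) - (\<Sum>i\<le>k. c i * ?h i)" by (rule sum_subtractf)
    also have "(\<Sum>i\<le>k. c i * ?h (Suc i)) = (\<Sum>i\<le>Suc k. (case i of 0 \<Rightarrow> 0 | Suc j \<Rightarrow> c j) * ?h i)"
      by (subst sum.atMost_Suc_shift) simp
    also have "(\<Sum>i\<le>k. c i * ?h i) = (\<Sum>i\<le>Suc k. (if i \<le> k then c i else 0) * ?h i)" by simp
    also have "(\<Sum>i\<le>Suc k. (case i of 0 \<Rightarrow> 0 | Suc j \<Rightarrow> c j) * ?h i) - (\<Sum>i\<le>Suc k. (if i \<le> k then c i else 0) * ?h i) = (\<Sum>i\<le>Suc k. d i * ?h i)"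
      unfolding sum_subtractf[symmetric] by (intro sum.cong refl) (simp add: d_def algebra_simps)
    finally show "(hdiff \<tau> ^^ Suc k) f n = (\<Sum>i\<le>Suc k. d i * ?h i)" .
  qed
qed

lemma hdiff_pow_measurable:
  assumes "f \<in> expb"
  shows "(\<lambda>\<tau>. (hdiff \<tau> ^^ k) f n) \<in> borel_measurable borel"
proof -
  note [measurable] = heat_measurable[OF assms]
  obtain c :: "nat \<Rightarrow> real" where c: "\<And>\<tau> n. (hdiff \<tau> ^^ k) f n = (\<Sum>i\<le>k. c i * heat (real i * \<tau>) f n)"
    using hdiff_pow_expand[of k] assms by blast
  show ?thesis unfolding c by measurable
qed

lemma abs_le_hdiff_pow:
  "\<exists>c. (\<forall>i. c i \<ge> 0) \<and> (\<forall>T. \<forall>f\<in>expb. \<forall>n. \<bar>f n\<bar> \<le> \<bar>(hdiff T ^^ k) f n\<bar> + (\<Sum>i=1..k. c i * \<bar>heat (real i * T) f n\<bar>))"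
proof -
  obtain c :: "nat \<Rightarrow> real" where c: "\<bar>c 0\<bar> = 1" and e: "\<And>\<tau> f n. f \<in> expb \<Longrightarrow> (hdiff \<tau> ^^ k) f n = (\<Sum>i\<le>k. c i * heat (real i * \<tau>) f n)"
    using hdiff_pow_expand[of k] by blast
  show ?thesis
  proof (intro exI[of _ "\<lambda>i. \<bar>c i\<bar>"] conjI allI ballI)
    fix T f n assume f: "f \<in> expb"
    have "{..k} = insert 0 {1..k}" by auto
    then have "(hdiff T ^^ k) f n = c 0 * f n + (\<Sum>i=1..k. c i * heat (real i * T) f n)"
      using f by (simp add: e heat_0)
    then have "\<bar>c 0 * f n\<bar> \<le> \<bar>(hdiff T ^^ k) f n\<bar> + \<bar>\<Sum>i=1..k. c i * heat (real i * T) f n\<bar>" by linarith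
    also have "\<bar>\<Sum>i=1..k. c i * heat (real i * T) f n\<bar> \<le> (\<Sum>i=1..k. \<bar>c i\<bar> * \<bar>heat (real i * T) f n\<bar>)"
      by (rule order_trans[OF sum_abs]) (simp add: abs_mult)
    finally show "\<bar>f n\<bar> \<le> \<bar>(hdiff T ^^ k) f n\<bar> + (\<Sum>i=1..k. \<bar>c i\<bar> * \<bar>heat (real i * T) f n\<bar>)"
      using c by (simp add: abs_mult)
  qed simp
qed

text \<open>Exchange of integrals: for fixed r the \<tau>-integral over (r, \<infinity>) is
  r^{-\<beta>} / \<beta>. The set X stands for (0, T) or (0, \<infinity>); in the former case
  letting \<tau> run past T only enlarges the right side.\<close>

lemma nn_integral_tail:
  fixes A :: "real \<Rightarrow> ennreal"
  assumes [measurable]: "A \<in> borel_measurable borel" "X \<in> sets borel" and b: "\<beta> > 0"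
    and X: "X \<subseteq> {0<..}" "\<And>r \<tau>. \<tau> \<in> X \<Longrightarrow> 0 < r \<Longrightarrow> r < \<tau> \<Longrightarrow> r \<in> X"
  shows "(\<integral>\<^sup>+\<tau>\<in>X. ennreal (\<tau> powr (- 1 - \<beta>)) * (\<integral>\<^sup>+r\<in>{0<..<\<tau>}. A r \<partial>lborel) \<partial>lborel)
    \<le> ennreal (1 / \<beta>) * (\<integral>\<^sup>+r\<in>X. ennreal (r powr (- \<beta>)) * A r \<partial>lborel)"
proof -
  define B where "B \<tau> r = ennreal (\<tau> powr (- 1 - \<beta>)) * A r * (indicator X r * indicator {x. snd x < fst x} (\<tau>, r))" for \<tau> r :: real
  have [measurable]: "(\<lambda>(\<tau>, r). B \<tau> r) \<in> borel_measurable (borel \<Otimes>\<^sub>M borel)"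
    unfolding B_def case_prod_unfold prod.collapse by measurable
  have "(\<integral>\<^sup>+\<tau>\<in>X. ennreal (\<tau> powr (- 1 - \<beta>)) * (\<integral>\<^sup>+r\<in>{0<..<\<tau>}. A r \<partial>lborel) \<partial>lborel)
     = (\<integral>\<^sup>+\<tau>. (\<integral>\<^sup>+r. ennreal (\<tau> powr (- 1 - \<beta>)) * A r * indicator {0<..<\<tau>} r * indicator X \<tau> \<partial>lborel) \<partial>lborel)"
    by (auto intro!: nn_integral_cong simp: nn_integral_cmult[symmetric] nn_integral_multc[symmetric] mult_ac)
  also have "\<dots> \<le> (\<integral>\<^sup>+\<tau>. (\<integral>\<^sup>+r. B \<tau> r \<partial>lborel) \<partial>lborel)"
    by (intro nn_integral_mono) (use X in \<open>auto simp: B_def indicator_def\<close>)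
  also have "\<dots> = (\<integral>\<^sup>+r. (\<integral>\<^sup>+\<tau>. B \<tau> r \<partial>lborel) \<partial>lborel)"
    by (rule lborel_pair.Fubini') simp
  also have "\<dots> = (\<integral>\<^sup>+r. ennreal (1 / \<beta>) * (ennreal (r powr (- \<beta>)) * A r * indicator X r) \<partial>lborel)"
  proof (rule nn_integral_cong)
    fix r
    show "(\<integral>\<^sup>+\<tau>. B \<tau> r \<partial>lborel) = ennreal (1 / \<beta>) * (ennreal (r powr (- \<beta>)) * A r * indicator X r)"
    proof (cases "r \<in> X")
      case True
      then have r: "r > 0" using X by auto
      have "(\<integral>\<^sup>+\<tau>. B \<tau> r \<partial>lborel) = (\<integral>\<^sup>+\<tau>. A r * (ennreal (\<tau> powr (- 1 - \<beta>)) * indicator {r<..} \<tau>) \<partial>lborel)"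
        using True by (intro nn_integral_cong) (auto simp: B_def indicator_def mult_ac)
      also have "\<dots> = A r * ennreal (r powr (- \<beta>) / \<beta>)"
        by (subst nn_integral_cmult) (auto simp: nn_integral_powr_inf[OF b r])
      also have "ennreal (r powr (- \<beta>) / \<beta>) = ennreal (1 / \<beta>) * ennreal (r powr (- \<beta>))"
        using b by (simp add: ennreal_mult[symmetric])
      finally show ?thesis using True by (simp add: mult_ac)
    qed (simp add: B_def)
  qed
  also have "\<dots> = ennreal (1 / \<beta>) * (\<integral>\<^sup>+r\<in>X. ennreal (r powr (- \<beta>)) * A r \<partial>lborel)"
    by (rule nn_integral_cmult) measurable
  finally show ?thesis .
qed

lemma sup_norm_hdiff:
  assumes "f \<in> expb" "T \<ge> 0"
  shows "lp_norm \<infinity> (hdiff T f) \<le> 2 * lp_norm \<infinity> f"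
  unfolding lp_norm_infinity[of "hdiff T f"]
proof (rule SUP_least)
  fix n
  have "ennreal \<bar>hdiff T f n\<bar> \<le> ennreal (\<bar>heat T f n\<bar> + \<bar>f n\<bar>)" by (intro ennreal_leI) (auto simp: hdiff_def)
  also have "\<dots> = ennreal \<bar>heat T f n\<bar> + ennreal \<bar>f n\<bar>" by simp
  also have "\<dots> \<le> lp_norm \<infinity> (heat T f) + lp_norm \<infinity> f" by (intro add_mono abs_le_lp_norm) simp_all
  also have "\<dots> \<le> lp_norm \<infinity> f + lp_norm \<infinity> f" by (intro add_right_mono lp_norm_heat assms) simp_all
  finally show "ennreal \<bar>hdiff T f n\<bar> \<le> 2 * lp_norm \<infinity> f" by (simp add: mult_2)
qed

lemma sup_norm_hdiff_pow:
  assumes "f \<in> expb" "T \<ge> 0"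
  shows "lp_norm \<infinity> ((hdiff T ^^ k) f) \<le> 2 ^ k * lp_norm \<infinity> f"
proof (induction k)
  case (Suc k)
  have "lp_norm \<infinity> ((hdiff T ^^ Suc k) f) \<le> 2 * lp_norm \<infinity> ((hdiff T ^^ k) f)"
    using sup_norm_hdiff[OF expb_hdiff_pow[OF assms(1)] assms(2)] by simp
  also have "\<dots> \<le> 2 * (2 ^ k * lp_norm \<infinity> f)" by (intro mult_left_mono Suc) auto
  finally show ?case by (simp add: mult_ac)
qed simp

text \<open>Differences with two independent steps: the estimate for step T is applied to the heat
  flow at time r that the estimate for step \<tau> leaves behind. Both give derivatives, of total
  order Suc l + Suc m.\<close>

lemma lp_norm_hdiff_hdiff:
  assumes p: "1 \<le> p"
  shows "\<exists>C\<ge>0. \<forall>f\<in>expb. \<forall>\<tau>\<ge>0. \<forall>T\<ge>0. lp_norm p ((hdiff \<tau> ^^ Suc l) ((hdiff T ^^ Suc m) f)) \<le>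
     ennreal C * (\<integral>\<^sup>+r\<in>{0<..<\<tau>}. ennreal (r powr real l) *
       (\<integral>\<^sup>+s\<in>{0<..<T}. ennreal (s powr real m) * lp_norm p (heat (r + s) ((Lap ^^ (Suc l + Suc m)) f)) \<partial>lborel) \<partial>lborel)"
proof -
  obtain C where C: "C \<ge> 0" and 1: "\<And>f \<tau>. f \<in> expb \<Longrightarrow> \<tau> \<ge> 0 \<Longrightarrow> lp_norm p ((hdiff \<tau> ^^ Suc l) f)
     \<le> ennreal C * (\<integral>\<^sup>+r\<in>{0<..<\<tau>}. ennreal (r powr real l) * lp_norm p (heat r ((Lap ^^ Suc l) f)) \<partial>lborel)"
    using lp_norm_hdiff_pow[OF p, of l] by blast
  obtain D where D: "D \<ge> 0" and 2: "\<And>f \<tau>. f \<in> expb \<Longrightarrow> \<tau> \<ge> 0 \<Longrightarrow> lp_norm p ((hdiff \<tau> ^^ Suc m) f)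
     \<le> ennreal D * (\<integral>\<^sup>+r\<in>{0<..<\<tau>}. ennreal (r powr real m) * lp_norm p (heat r ((Lap ^^ Suc m) f)) \<partial>lborel)"
    using lp_norm_hdiff_pow[OF p, of m] by blast
  show ?thesis
  proof (intro exI[of _ "C * D"] conjI ballI allI impI)
    fix f \<tau> T assume f: "f \<in> expb" and t: "(0::real) \<le> \<tau>" "(0::real) \<le> T"
    define w where "w = (Lap ^^ (Suc l + Suc m)) f"
    have w: "w \<in> expb" unfolding w_def by (rule expb_Lap_pow[OF f])
    note [measurable] = lp_norm_heat_measurable[OF p w]
    let ?A = "\<lambda>r. (\<integral>\<^sup>+s\<in>{0<..<T}. ennreal (s powr real m) * lp_norm p (heat (r + s) w) \<partial>lborel)"
    have "lp_norm p ((hdiff \<tau> ^^ Suc l) ((hdiff T ^^ Suc m) f)) \<le>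
      ennreal C * (\<integral>\<^sup>+r\<in>{0<..<\<tau>}. ennreal (r powr real l) * lp_norm p (heat r ((Lap ^^ Suc l) ((hdiff T ^^ Suc m) f))) \<partial>lborel)"
      by (intro 1 expb_hdiff_pow f t)
    also have "\<dots> \<le> ennreal C * (\<integral>\<^sup>+r. ennreal D * (ennreal (r powr real l) * ?A r * indicator {0<..<\<tau>} r) \<partial>lborel)"
    proof (intro mult_left_mono nn_integral_mono)
      fix r :: real
      let ?g = "(Lap ^^ Suc l) f"
      have g: "?g \<in> expb" by (rule expb_Lap_pow[OF f])
      have "heat r ((Lap ^^ Suc l) ((hdiff T ^^ Suc m) f)) = (hdiff T ^^ Suc m) (heat r ?g)"
        by (simp only: Lap_pow_hdiff_pow[OF f] heat_hdiff_pow[OF g])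
      then have "lp_norm p (heat r ((Lap ^^ Suc l) ((hdiff T ^^ Suc m) f))) \<le> ennreal D * (\<integral>\<^sup>+s\<in>{0<..<T}. ennreal (s powr real m) * lp_norm p (heat s ((Lap ^^ Suc m) (heat r ?g))) \<partial>lborel)"
        using 2[OF expb_heat[OF g] t(2)] by simp
      also have "(\<lambda>s. heat s ((Lap ^^ Suc m) (heat r ?g))) = (\<lambda>s. heat (r + s) w)"
        using g by (simp only: Lap_pow_heat heat_heat expb_Lap_pow w_def funpow_add o_def add.commute[of "Suc l"])
      then have "(\<integral>\<^sup>+s\<in>{0<..<T}. ennreal (s powr real m) * lp_norm p (heat s ((Lap ^^ Suc m) (heat r ?g))) \<partial>lborel) = ?A r"
        by (metis (no_types, lifting))
      finally have "ennreal (r powr real l) * lp_norm p (heat r ((Lap ^^ Suc l) ((hdiff T ^^ Suc m) f))) * indicator {0<..<\<tau>} r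
        \<le> ennreal (r powr real l) * (ennreal D * ?A r) * indicator {0<..<\<tau>} r"
        by (intro mult_right_mono mult_left_mono) auto
      then show "ennreal (r powr real l) * lp_norm p (heat r ((Lap ^^ Suc l) ((hdiff T ^^ Suc m) f))) * indicator {0<..<\<tau>} r
        \<le> ennreal D * (ennreal (r powr real l) * ?A r * indicator {0<..<\<tau>} r)" by (simp only: mult_ac)
    qed auto
    also have "\<dots> = ennreal C * (ennreal D * (\<integral>\<^sup>+r\<in>{0<..<\<tau>}. ennreal (r powr real l) * ?A r \<partial>lborel))"
      by (subst nn_integral_cmult) measurable
    also have "\<dots> = ennreal (C * D) * (\<integral>\<^sup>+r\<in>{0<..<\<tau>}. ennreal (r powr real l) * ?A r \<partial>lborel)"
      using C D by (simp add: ennreal_mult mult.assoc)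
    finally show "lp_norm p ((hdiff \<tau> ^^ Suc l) ((hdiff T ^^ Suc m) f)) \<le> ennreal (C * D) * (\<integral>\<^sup>+r\<in>{0<..<\<tau>}. ennreal (r powr real l) *
       (\<integral>\<^sup>+s\<in>{0<..<T}. ennreal (s powr real m) * lp_norm p (heat (r + s) ((Lap ^^ (Suc l + Suc m)) f)) \<partial>lborel) \<partial>lborel)"
      by (simp add: w_def)
  qed (use C D in simp)
qed

text \<open>The defining integral of the fractional power with absolute values, over a part X of the
  \<tau>-axis. Its value in [0, \<infinity>] is available before any integrability is known.\<close>

definition frac_int :: "real set \<Rightarrow> nat \<Rightarrow> real \<Rightarrow> (int \<Rightarrow> real) \<Rightarrow> int \<Rightarrow> ennreal" where
  "frac_int X L \<beta> f n = (\<integral>\<^sup>+\<tau>\<in>X. ennreal (\<tau> powr (- 1 - \<beta>)) * ennreal \<bar>(hdiff \<tau> ^^ L) f n\<bar> \<partial>lborel)"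

text \<open>The \<tau>-differences already supply Suc l Laplacians, so only Suc m of the
  T-differences are converted into derivatives and the surplus Suc l cost a factor 2 each.
  Integrating out \<tau> leaves r^{l-\<beta>}, integrable at 0 since \<beta> < Suc l, and
  monotonicity merges r and s.\<close>

lemma sup_remainder:
  assumes b: "0 < \<beta>" "\<beta> < real (Suc l)"
  shows "\<exists>C\<ge>0. \<forall>f\<in>expb. \<forall>T\<ge>0. \<forall>n. frac_int {0<..<T} (Suc l) \<beta> ((hdiff T ^^ (Suc l + Suc m)) f) n \<le>
     ennreal C * (\<integral>\<^sup>+r\<in>{0<..<T}. ennreal (r powr (real (Suc l + Suc m) - 1 - \<beta>)) * lp_norm \<infinity> (heat r ((Lap ^^ (Suc l + Suc m)) f)) \<partial>lborel)"
proof -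
  obtain C where C: "C \<ge> 0" and 1: "\<And>f \<tau> T. f \<in> expb \<Longrightarrow> \<tau> \<ge> 0 \<Longrightarrow> T \<ge> 0 \<Longrightarrow> lp_norm \<infinity> ((hdiff \<tau> ^^ Suc l) ((hdiff T ^^ Suc m) f)) \<le>
     ennreal C * (\<integral>\<^sup>+r\<in>{0<..<\<tau>}. ennreal (r powr real l) *
       (\<integral>\<^sup>+s\<in>{0<..<T}. ennreal (s powr real m) * lp_norm \<infinity> (heat (r + s) ((Lap ^^ (Suc l + Suc m)) f)) \<partial>lborel) \<partial>lborel)"
    using lp_norm_hdiff_hdiff[of \<infinity> l m] by auto
  define D where "D = 1 / (real (Suc l) - \<beta>) + 1 / real (Suc m)"
  have D: "D \<ge> 0" using b by (simp add: D_def)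
  show ?thesis
  proof (intro exI[of _ "2 ^ Suc l * C * (1 / \<beta>) * D"] conjI ballI allI impI)
    fix f T n assume f: "f \<in> expb" and T: "(0::real) \<le> T"
    define w where "w = (Lap ^^ (Suc l + Suc m)) f"
    have w: "w \<in> expb" unfolding w_def by (rule expb_Lap_pow[OF f])
    define \<phi> where "\<phi> r = lp_norm \<infinity> (heat r w)" for r
    have m[measurable]: "\<phi> \<in> borel_measurable borel"
      unfolding \<phi>_def by (rule lp_norm_heat_measurable[OF _ w]) simp
    have anti: "\<phi> s \<le> \<phi> r" if "0 < r" "r \<le> s" for r s
      unfolding \<phi>_def using that w by (intro lp_norm_heat_antimono) auto
    define B where "B r = (\<integral>\<^sup>+s\<in>{0<..<T}. ennreal (s powr real m) * \<phi> (r + s) \<partial>lborel)" for r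
    have [measurable]: "B \<in> borel_measurable borel" unfolding B_def by measurable
    have le: "ennreal \<bar>(hdiff \<tau> ^^ Suc l) ((hdiff T ^^ (Suc l + Suc m)) f) n\<bar> \<le>
      ennreal (2 ^ Suc l * C) * (\<integral>\<^sup>+r\<in>{0<..<\<tau>}. ennreal (r powr real l) * B r \<partial>lborel)" if \<tau>: "\<tau> \<ge> 0" for \<tau>
    proof -
      \<comment> \<open>The surplus T-differences are brought to the outside, where the sup norm
        bound applies to them.\<close>
      have e: "(hdiff \<tau> ^^ Suc l) ((hdiff T ^^ (Suc l + Suc m)) f) = (hdiff T ^^ Suc l) ((hdiff \<tau> ^^ Suc l) ((hdiff T ^^ Suc m) f))"
        unfolding funpow_add o_def by (rule hdiff_pow_commute) (intro expb_hdiff_pow f)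
      have "ennreal \<bar>(hdiff \<tau> ^^ Suc l) ((hdiff T ^^ (Suc l + Suc m)) f) n\<bar> \<le> lp_norm \<infinity> ((hdiff T ^^ Suc l) ((hdiff \<tau> ^^ Suc l) ((hdiff T ^^ Suc m) f)))"
        unfolding e by (rule abs_le_lp_norm) simp
      also have "\<dots> \<le> 2 ^ Suc l * lp_norm \<infinity> ((hdiff \<tau> ^^ Suc l) ((hdiff T ^^ Suc m) f))"
        by (intro sup_norm_hdiff_pow expb_hdiff_pow f T)
      also have "\<dots> \<le> 2 ^ Suc l * (ennreal C * (\<integral>\<^sup>+r\<in>{0<..<\<tau>}. ennreal (r powr real l) * B r \<partial>lborel))"
        using 1[OF f \<tau> T] by (intro mult_left_mono) (auto simp: B_def \<phi>_def w_def)
      also have "\<dots> = ennreal (2 ^ Suc l * C) * (\<integral>\<^sup>+r\<in>{0<..<\<tau>}. ennreal (r powr real l) * B r \<partial>lborel)"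
        using C by (simp add: ennreal_mult mult.assoc ennreal_power[symmetric] del: power_Suc)
      finally show ?thesis .
    qed
    have "frac_int {0<..<T} (Suc l) \<beta> ((hdiff T ^^ (Suc l + Suc m)) f) n \<le>
      (\<integral>\<^sup>+\<tau>. ennreal (2 ^ Suc l * C) * (ennreal (\<tau> powr (- 1 - \<beta>)) * (\<integral>\<^sup>+r\<in>{0<..<\<tau>}. ennreal (r powr real l) * B r \<partial>lborel) * indicator {0<..<T} \<tau>) \<partial>lborel)"
      unfolding frac_int_def
    proof (intro nn_integral_mono)
      fix \<tau> :: real
      show "ennreal (\<tau> powr (- 1 - \<beta>)) * ennreal \<bar>(hdiff \<tau> ^^ Suc l) ((hdiff T ^^ (Suc l + Suc m)) f) n\<bar> * indicator {0<..<T} \<tau> \<le>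
        ennreal (2 ^ Suc l * C) * (ennreal (\<tau> powr (- 1 - \<beta>)) * (\<integral>\<^sup>+r\<in>{0<..<\<tau>}. ennreal (r powr real l) * B r \<partial>lborel) * indicator {0<..<T} \<tau>)"
        using mult_left_mono[OF le[of \<tau>], of "ennreal (\<tau> powr (- 1 - \<beta>))"]
        by (cases "\<tau> \<in> {0<..<T}") (auto simp: mult_ac)
    qed
    also have "\<dots> = ennreal (2 ^ Suc l * C) * (\<integral>\<^sup>+\<tau>\<in>{0<..<T}. ennreal (\<tau> powr (- 1 - \<beta>)) * (\<integral>\<^sup>+r\<in>{0<..<\<tau>}. ennreal (r powr real l) * B r \<partial>lborel) \<partial>lborel)"
      by (rule nn_integral_cmult) measurable
    also have "\<dots> \<le> ennreal (2 ^ Suc l * C) * (ennreal (1 / \<beta>) * (\<integral>\<^sup>+r\<in>{0<..<T}. ennreal (r powr (- \<beta>)) * (ennreal (r powr real l) * B r) \<partial>lborel))"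
      by (intro mult_left_mono nn_integral_tail b) auto
    also have "(\<integral>\<^sup>+r\<in>{0<..<T}. ennreal (r powr (- \<beta>)) * (ennreal (r powr real l) * B r) \<partial>lborel) =
      (\<integral>\<^sup>+r\<in>{0<..<T}. ennreal (r powr ((real (Suc l) - \<beta>) - 1)) * (\<integral>\<^sup>+s\<in>{0<..<T}. ennreal (s powr (real (Suc m) - 1)) * \<phi> (r + s) \<partial>lborel) \<partial>lborel)"
    proof (rule nn_integral_cong)
      fix r :: real
      have "ennreal (r powr (- \<beta>)) * ennreal (r powr real l) = ennreal (r powr ((real (Suc l) - \<beta>) - 1))"
        by (simp add: ennreal_mult[symmetric] powr_add[symmetric])
      then show "ennreal (r powr (- \<beta>)) * (ennreal (r powr real l) * B r) * indicator {0<..<T} r =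
        ennreal (r powr ((real (Suc l) - \<beta>) - 1)) * (\<integral>\<^sup>+s\<in>{0<..<T}. ennreal (s powr (real (Suc m) - 1)) * \<phi> (r + s) \<partial>lborel) * indicator {0<..<T} r"
        by (simp add: B_def flip: mult.assoc)
    qed
    also have "ennreal (2 ^ Suc l * C) * (ennreal (1 / \<beta>) * \<dots>) \<le> ennreal (2 ^ Suc l * C) * (ennreal (1 / \<beta>) *
       (ennreal D * (\<integral>\<^sup>+r\<in>{0<..<T}. ennreal (r powr ((real (Suc l) - \<beta>) + real (Suc m) - 1)) * \<phi> r \<partial>lborel)))"
      unfolding D_def using b by (intro mult_left_mono nn_integral_antimono_square[OF m anti]) auto
    also have "\<dots> = ennreal (2 ^ Suc l * C * (1 / \<beta>) * D) * (\<integral>\<^sup>+r\<in>{0<..<T}. ennreal (r powr ((real (Suc l) - \<beta>) + real (Suc m) - 1)) * \<phi> r \<partial>lborel)"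
      using C D b by (simp only: ennreal_mult mult.assoc mult_nonneg_nonneg zero_le_power zero_le_numeral divide_nonneg_pos zero_le_one)
    finally show "frac_int {0<..<T} (Suc l) \<beta> ((hdiff T ^^ (Suc l + Suc m)) f) n \<le> ennreal (2 ^ Suc l * C * (1 / \<beta>) * D) *
      (\<integral>\<^sup>+r\<in>{0<..<T}. ennreal (r powr (real (Suc l + Suc m) - 1 - \<beta>)) * lp_norm \<infinity> (heat r ((Lap ^^ (Suc l + Suc m)) f)) \<partial>lborel)"
      by (simp add: \<phi>_def w_def algebra_simps)
  qed (use C D b in simp)
qed

text \<open>The decomposition at scale T = (1 + |n|)^2 is applied to v = D_\<tau>^L f with L = Suc
  l. Its first term is the remainder treated above. In the others, v evolved to time iT, the
  \<tau>-differences become \<tau>^L \<Delta>^L by the mean value theorem, and \<tau>^{L-1-\<beta>}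
  is integrable at 0.\<close>

lemma frac_int_near:
  assumes M: "M > 0" and b: "0 < \<beta>" "\<beta> < real (Suc l)"
  shows "\<exists>C\<ge>0. \<forall>f\<in>expb. \<forall>n. frac_int {0<..<(1 + iabs n)\<^sup>2} (Suc l) \<beta> f n \<le>
    ennreal C * (ennreal ((1 + iabs n) powr (M - 1 - 2 * \<beta>)) * spread M f n +
      (\<integral>\<^sup>+r\<in>{0<..<(1 + iabs n)\<^sup>2}. ennreal (r powr (real (Suc l + Suc m) - 1 - \<beta>)) * lp_norm \<infinity> (heat r ((Lap ^^ (Suc l + Suc m)) f)) \<partial>lborel))"
proof -
  define k where "k = Suc l + Suc m"
  define L where "L = Suc l"
  obtain c where c: "\<And>i. c i \<ge> 0" and dec: "\<And>T f n. f \<in> expb \<Longrightarrow> \<bar>f n\<bar> \<le> \<bar>(hdiff T ^^ k) f n\<bar> + (\<Sum>i=1..k. c i * \<bar>heat (real i * T) f n\<bar>)"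
    using abs_le_hdiff_pow[of k] by blast
  obtain C1 where C1: "C1 \<ge> 0" and rem: "\<And>f T n. f \<in> expb \<Longrightarrow> T \<ge> 0 \<Longrightarrow> frac_int {0<..<T} (Suc l) \<beta> ((hdiff T ^^ k) f) n \<le>
     ennreal C1 * (\<integral>\<^sup>+r\<in>{0<..<T}. ennreal (r powr (real k - 1 - \<beta>)) * lp_norm \<infinity> (heat r ((Lap ^^ k) f)) \<partial>lborel)"
    using sup_remainder[OF b, of m] unfolding k_def by blast
  \<comment> \<open>The times that occur are iT + s with i <= k and s <= L \<tau> <= L T, hence the
    window factor k + L.\<close>
  obtain C2 where C2: "C2 \<ge> 0" and spr: "\<And>f n t. f \<in> expb \<Longrightarrow> (1 + iabs n)\<^sup>2 \<le> t \<Longrightarrow> t \<le> real (k + L) * (1 + iabs n)\<^sup>2 \<Longrightarrow>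
    ennreal \<bar>heat t ((Lap ^^ L) f) n\<bar> \<le> ennreal (C2 * (1 + iabs n) powr (M - 1 - 2 * real L)) * spread M f n"
    using heat_Lap_spread[OF M, of "real (k + L)" L] unfolding k_def by auto
  define S where "S = (\<Sum>i=1..k. c i)"
  have S: "S \<ge> 0" unfolding S_def by (intro sum_nonneg c)
  define C where "C = C1 + S * C2 / (real L - \<beta>)"
  have Lb: "real L - \<beta> > 0" using b by (simp add: L_def)
  have Cge: "C1 \<le> C" "S * C2 / (real L - \<beta>) \<le> C" using C1 C2 S Lb by (auto simp: C_def)
  show ?thesis
  proof (intro exI[of _ C] conjI ballI allI)
    show "C \<ge> 0" using C1 C2 S Lb by (simp add: C_def)
    fix f n assume f: "f \<in> expb"
    let ?y = "1 + iabs n"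
    define T where "T = ?y\<^sup>2"
    have T: "T > 0" "T \<ge> 0" by (auto simp: T_def add_pos_nonneg)
    define W where "W = ennreal (C2 * ?y powr (M - 1 - 2 * real L)) * spread M f n"
    define R where "R = (\<integral>\<^sup>+r\<in>{0<..<T}. ennreal (r powr (real k - 1 - \<beta>)) * lp_norm \<infinity> (heat r ((Lap ^^ k) f)) \<partial>lborel)"
    have main: "ennreal \<bar>heat (real i * T) ((hdiff \<tau> ^^ L) f) n\<bar> \<le> ennreal (\<tau> powr real L) * W"
      if i: "i \<in> {1..k}" and \<tau>: "\<tau> \<in> {0<..<T}" for i \<tau>
    proof (cases W)
      case (real B)
      have e: "heat (real i * T) ((hdiff \<tau> ^^ L) f) = (hdiff \<tau> ^^ L) (heat (real i * T) f)"
        by (rule heat_hdiff_pow[OF f])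
      have "\<bar>(hdiff \<tau> ^^ L) (heat (real i * T) f) n\<bar> \<le> \<tau> ^ L * B"
      proof (rule hdiff_pow_MVT[OF expb_heat[OF f]])
        fix s assume s: "0 \<le> s" "s \<le> real L * \<tau>"
        have "T \<le> real i * T" using i T by simp
        moreover have "real i * T \<le> real k * T" using i T by (intro mult_right_mono) auto
        moreover have "real L * \<tau> \<le> real L * T" using \<tau> by (intro mult_left_mono) auto
        ultimately have "?y\<^sup>2 \<le> real i * T + s" "real i * T + s \<le> real (k + L) * ?y\<^sup>2"
          using s by (auto simp: T_def[symmetric] distrib_right)
        from spr[OF f this] have "ennreal \<bar>heat (real i * T + s) ((Lap ^^ L) f) n\<bar> \<le> ennreal B"
          using real by (simp add: W_def)
        then show "\<bar>heat s ((Lap ^^ L) (heat (real i * T) f)) n\<bar> \<le> B"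
          using f real by (simp add: Lap_pow_heat heat_heat expb_Lap_pow)
      qed (use \<tau> in auto)
      then show ?thesis using \<tau> real unfolding e by (simp add: ennreal_mult[symmetric] powr_realpow ennreal_leI)
    qed (use \<tau> in \<open>simp add: ennreal_mult_top\<close>)
    have "frac_int {0<..<T} L \<beta> f n \<le> (\<integral>\<^sup>+\<tau>. ennreal (\<tau> powr (- 1 - \<beta>)) * ennreal \<bar>(hdiff \<tau> ^^ Suc l) ((hdiff T ^^ k) f) n\<bar> * indicator {0<..<T} \<tau>
       + ennreal S * W * (ennreal (\<tau> powr ((real L - \<beta>) - 1)) * indicator {0<..<T} \<tau>) \<partial>lborel)"
      unfolding frac_int_def
    proof (intro nn_integral_mono)
      fix \<tau>
      show "ennreal (\<tau> powr (- 1 - \<beta>)) * ennreal \<bar>(hdiff \<tau> ^^ L) f n\<bar> * indicator {0<..<T} \<tau> \<le>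
        ennreal (\<tau> powr (- 1 - \<beta>)) * ennreal \<bar>(hdiff \<tau> ^^ Suc l) ((hdiff T ^^ k) f) n\<bar> * indicator {0<..<T} \<tau>
       + ennreal S * W * (ennreal (\<tau> powr ((real L - \<beta>) - 1)) * indicator {0<..<T} \<tau>)"
      proof (cases "\<tau> \<in> {0<..<T}")
        case True
        let ?v = "(hdiff \<tau> ^^ L) f"
        have e: "(hdiff T ^^ k) ?v = (hdiff \<tau> ^^ Suc l) ((hdiff T ^^ k) f)"
          unfolding L_def by (rule hdiff_pow_commute[OF f])
        have "ennreal \<bar>?v n\<bar> \<le> ennreal (\<bar>(hdiff T ^^ k) ?v n\<bar> + (\<Sum>i=1..k. c i * \<bar>heat (real i * T) ?v n\<bar>))"
          by (intro ennreal_leI dec expb_hdiff_pow f)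
        also have "\<dots> = ennreal \<bar>(hdiff T ^^ k) ?v n\<bar> + (\<Sum>i=1..k. ennreal (c i) * ennreal \<bar>heat (real i * T) ?v n\<bar>)"
          using c by (subst ennreal_plus) (auto intro!: sum_nonneg simp: sum_ennreal[symmetric] ennreal_mult)
        also have "\<dots> \<le> ennreal \<bar>(hdiff T ^^ k) ?v n\<bar> + (\<Sum>i=1..k. ennreal (c i) * (ennreal (\<tau> powr real L) * W))"
          by (intro add_left_mono sum_mono mult_left_mono main True) auto
        also have "(\<Sum>i=1..k. ennreal (c i) * (ennreal (\<tau> powr real L) * W)) = ennreal S * (ennreal (\<tau> powr real L) * W)"
          unfolding S_def sum_distrib_right[symmetric] using c by (simp add: sum_ennreal)
        finally have "ennreal (\<tau> powr (- 1 - \<beta>)) * ennreal \<bar>?v n\<bar> \<le>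
          ennreal (\<tau> powr (- 1 - \<beta>)) * (ennreal \<bar>(hdiff T ^^ k) ?v n\<bar> + ennreal S * (ennreal (\<tau> powr real L) * W))"
          by (intro mult_left_mono) auto
        also have "\<dots> = ennreal (\<tau> powr (- 1 - \<beta>)) * ennreal \<bar>(hdiff T ^^ k) ?v n\<bar> + ennreal S * W * (ennreal (\<tau> powr (- 1 - \<beta>)) * ennreal (\<tau> powr real L))"
          by (simp add: distrib_left mult_ac)
        also have "ennreal (\<tau> powr (- 1 - \<beta>)) * ennreal (\<tau> powr real L) = ennreal (\<tau> powr ((real L - \<beta>) - 1))"
          by (simp add: ennreal_mult[symmetric] powr_add[symmetric] algebra_simps)
        finally show ?thesis using True unfolding e by simp
      qed simp
    qed
    also have "\<dots> = frac_int {0<..<T} (Suc l) \<beta> ((hdiff T ^^ k) f) n + ennreal S * W * (\<integral>\<^sup>+\<tau>\<in>{0<..<T}. ennreal (\<tau> powr ((real L - \<beta>) - 1)) \<partial>lborel)"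
    proof -
      note [measurable] = hdiff_pow_measurable[OF expb_hdiff_pow[OF f]]
      show ?thesis unfolding frac_int_def
        by (subst nn_integral_add) (auto simp: nn_integral_cmult simp del: funpow.simps)
    qed
    also have "(\<integral>\<^sup>+\<tau>\<in>{0<..<T}. ennreal (\<tau> powr ((real L - \<beta>) - 1)) \<partial>lborel) = ennreal (T powr (real L - \<beta>) / (real L - \<beta>))"
      by (rule nn_integral_powr_0[OF Lb T(2)])
    also have "ennreal S * W * ennreal (T powr (real L - \<beta>) / (real L - \<beta>)) = ennreal (S * C2 / (real L - \<beta>)) * (ennreal (?y powr (M - 1 - 2 * \<beta>)) * spread M f n)"
    proof -
      \<comment> \<open>Integrating \<tau>^{L-\<beta>-1} up to T = (1 + |n|)^2 raises the exponent
        of 1 + |n| by 2 (L - \<beta>), from M - 1 - 2L to M - 1 - 2 \<beta>.\<close>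
      have "T powr (real L - \<beta>) = (?y powr 2) powr (real L - \<beta>)" by (simp add: T_def)
      then have "T powr (real L - \<beta>) = ?y powr (2 * (real L - \<beta>))" by (simp only: powr_powr)
      then have "?y powr (M - 1 - 2 * real L) * T powr (real L - \<beta>) = ?y powr (M - 1 - 2 * real L + 2 * (real L - \<beta>))" by (simp only: powr_add)
      also have "M - 1 - 2 * real L + 2 * (real L - \<beta>) = M - 1 - 2 * \<beta>" by simp
      finally have e: "S * (C2 * ?y powr (M - 1 - 2 * real L)) * (T powr (real L - \<beta>) / (real L - \<beta>)) = S * C2 / (real L - \<beta>) * ?y powr (M - 1 - 2 * \<beta>)"
        by (simp add: mult_ac)
      have "ennreal S * W * ennreal (T powr (real L - \<beta>) / (real L - \<beta>)) =
        ennreal S * ennreal (C2 * ?y powr (M - 1 - 2 * real L)) * ennreal (T powr (real L - \<beta>) / (real L - \<beta>)) * spread M f n"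
        unfolding W_def by (simp only: mult_ac)
      also have "ennreal S * ennreal (C2 * ?y powr (M - 1 - 2 * real L)) * ennreal (T powr (real L - \<beta>) / (real L - \<beta>)) =
        ennreal (S * (C2 * ?y powr (M - 1 - 2 * real L)) * (T powr (real L - \<beta>) / (real L - \<beta>)))"
        using S C2 Lb by (simp only: ennreal_mult[symmetric] mult_nonneg_nonneg powr_ge_zero divide_nonneg_pos)
      also have "\<dots> = ennreal (S * C2 / (real L - \<beta>)) * ennreal (?y powr (M - 1 - 2 * \<beta>))"
        unfolding e using S C2 Lb by (intro ennreal_mult) auto
      finally show ?thesis by (simp only: mult.assoc)
    qed
    also have "frac_int {0<..<T} (Suc l) \<beta> ((hdiff T ^^ k) f) n + ennreal (S * C2 / (real L - \<beta>)) * (ennreal (?y powr (M - 1 - 2 * \<beta>)) * spread M f n)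
      \<le> ennreal C * R + ennreal C * (ennreal (?y powr (M - 1 - 2 * \<beta>)) * spread M f n)"
    proof (rule add_mono)
      have "frac_int {0<..<T} (Suc l) \<beta> ((hdiff T ^^ k) f) n \<le> ennreal C1 * R" unfolding R_def by (rule rem[OF f T(2)])
      also have "\<dots> \<le> ennreal C * R" using Cge by (intro mult_right_mono ennreal_leI) auto
      finally show "frac_int {0<..<T} (Suc l) \<beta> ((hdiff T ^^ k) f) n \<le> ennreal C * R" .
      show "ennreal (S * C2 / (real L - \<beta>)) * (ennreal (?y powr (M - 1 - 2 * \<beta>)) * spread M f n) \<le> ennreal C * (ennreal (?y powr (M - 1 - 2 * \<beta>)) * spread M f n)"
        using Cge by (intro mult_right_mono ennreal_leI) auto
    qed
    finally show "frac_int {0<..<?y\<^sup>2} (Suc l) \<beta> f n \<le> ennreal C * (ennreal (?y powr (M - 1 - 2 * \<beta>)) * spread M f n +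
      (\<integral>\<^sup>+r\<in>{0<..<?y\<^sup>2}. ennreal (r powr (real (Suc l + Suc m) - 1 - \<beta>)) * lp_norm \<infinity> (heat r ((Lap ^^ (Suc l + Suc m)) f)) \<partial>lborel))"
      unfolding T_def L_def R_def k_def by (simp only: distrib_left add.commute)
  qed
qed

text \<open>In the variable sqrt \<tau> the integrand is a pure power, which gives the explicit
  antiderivative \<open>F\<close>.\<close>

lemma nn_integral_sqrt_tail:
  assumes a: "a \<ge> 0" and b: "\<beta> > 0" and T: "T > 0"
  shows "(\<integral>\<^sup>+\<tau>. ennreal (\<tau> powr (- (1/2)) * (sqrt \<tau> + a) powr (- 2 - 2 * \<beta>)) * indicator {T..} \<tau> \<partial>lborel) =
    ennreal (2 / (1 + 2 * \<beta>) * (sqrt T + a) powr (- 1 - 2 * \<beta>))"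
proof -
  define F where "F \<tau> = - (2 / (1 + 2 * \<beta>)) * (sqrt \<tau> + a) powr (- 1 - 2 * \<beta>)" for \<tau>
  have "(\<integral>\<^sup>+\<tau>. ennreal (\<tau> powr (- (1/2)) * (sqrt \<tau> + a) powr (- 2 - 2 * \<beta>)) * indicator {T..} \<tau> \<partial>lborel) = 0 - F T"
  proof (rule nn_integral_FTC_atLeast)
    fix x assume "T \<le> x"
    then have x: "x > 0" using T by simp
    then have s: "sqrt x > 0" by simp
    have "x powr (- (1/2)) = 1 / sqrt x" using x by (simp add: powr_minus_divide powr_half_sqrt)
    moreover have "- 1 - 2 * \<beta> - 1 = - 2 - 2 * \<beta>" by simp
    moreover have "(F has_real_derivative - (2 / (1 + 2 * \<beta>)) * ((- 1 - 2 * \<beta>) * (sqrt x + a) powr (- 1 - 2 * \<beta> - 1) * (inverse (sqrt x) / 2))) (at x)"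
    proof -
      have "((\<lambda>\<tau>. - K * (sqrt \<tau> + a) powr (- 1 - 2 * \<beta>)) has_real_derivative - K * ((- 1 - 2 * \<beta>) * (sqrt x + a) powr (- 1 - 2 * \<beta> - 1) * (inverse (sqrt x) / 2))) (at x)" for K
        using x s a by (auto intro!: derivative_eq_intros simp: add_pos_nonneg)
      then show ?thesis unfolding F_def .
    qed
    moreover have "- (2 / (1 + 2 * \<beta>)) * ((- 1 - 2 * \<beta>) * z * (inverse (sqrt x) / 2)) = 1 / sqrt x * z" for z
      using b s by (simp add: divide_simps) (simp add: algebra_simps)
    ultimately show "(F has_real_derivative x powr (- (1/2)) * (sqrt x + a) powr (- 2 - 2 * \<beta>)) (at x)" by (simp only:)
  next
    have "filterlim (\<lambda>x. sqrt x + a) at_top at_top"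
      by (rule filterlim_at_top_mono[OF sqrt_at_top]) (use a in simp)
    then have "((\<lambda>x. (sqrt x + a) powr (- 1 - 2 * \<beta>)) \<longlongrightarrow> 0) at_top"
      using b by (intro tendsto_neg_powr) auto
    then show "(F \<longlongrightarrow> 0) at_top" unfolding F_def by (intro tendsto_mult_right_zero)
  qed auto
  then show ?thesis by (simp add: F_def)
qed

text \<open>For large \<tau> no cancellation is used: the difference is expanded and each flow term
  is bounded through the kernel. The term i = 0 produces T^{-\<beta>} |f(n)|; the others, integrated
  over \<tau>, reproduce exactly the weight that defines \<open>ell\<close>.\<close>

lemma frac_int_far:
  assumes b: "\<beta> > 0"
  shows "\<exists>C\<ge>0. \<forall>f\<in>expb. \<forall>n. \<forall>T\<ge>1. frac_int {T..} L \<beta> f n \<le>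
    ennreal C * (ennreal (T powr (- \<beta>)) * ennreal \<bar>f n\<bar> +
      (\<integral>\<^sup>+j. ennreal ((sqrt T + iabs (n - j)) powr (- 1 - 2 * \<beta>) * \<bar>f j\<bar>) \<partial>count_space UNIV))"
proof -
  obtain c :: "nat \<Rightarrow> real" where e: "\<And>\<tau> f n. f \<in> expb \<Longrightarrow> (hdiff \<tau> ^^ L) f n = (\<Sum>i\<le>L. c i * heat (real i * \<tau>) f n)"
    using hdiff_pow_expand[of L] by blast
  \<comment> \<open>Decay M = 2 + 2 \<beta>: the prefactor is then of size \<tau>^{1/2+\<beta>},
    which against \<tau>^{-1-\<beta>} leaves \<tau>^{-1/2}, and integration in sqrt \<tau> lowers
    the decay to 1 + 2 \<beta>.\<close>
  obtain C0 where C0: "C0 \<ge> 0" and K: "\<And>t n. t \<ge> 0 \<Longrightarrow> \<bar>lap_kernel 0 t n\<bar> \<le>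
     C0 * sqrt (1 + t) powr (1 + 2 * \<beta>) * (sqrt (1 + t) + iabs n) powr (- (2 + 2 * \<beta>))"
    using lap_kernel_bound[of "2 + 2 * \<beta>" 0] b by auto
  \<comment> \<open>The first summand serves i >= 1, with L + 1 coming from sqrt(1 + i \<tau>) <= (L
    + 1) sqrt \<tau> for \<tau> >= 1; the second serves i = 0.\<close>
  define D where "D = C0 * real (L + 1) powr (1 + 2 * \<beta>) * (2 / (1 + 2 * \<beta>)) + 1 / \<beta>"
  have D: "D \<ge> 0" using C0 b by (simp add: D_def)
  define C where "C = (\<Sum>i\<le>L. \<bar>c i\<bar>) * D"
  show ?thesis
  proof (intro exI[of _ C] conjI ballI allI impI)
    show "C \<ge> 0" using D by (auto simp: C_def intro!: mult_nonneg_nonneg sum_nonneg)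
    fix f n T assume f: "f \<in> expb" and T: "(1::real) \<le> T"
    define R where "R = ennreal (T powr (- \<beta>)) * ennreal \<bar>f n\<bar> +
      (\<integral>\<^sup>+j. ennreal ((sqrt T + iabs (n - j)) powr (- 1 - 2 * \<beta>) * \<bar>f j\<bar>) \<partial>count_space UNIV)"
    note [measurable] = heat_measurable[OF f]
    have part: "(\<integral>\<^sup>+\<tau>\<in>{T..}. ennreal (\<tau> powr (- 1 - \<beta>)) * ennreal \<bar>heat (real i * \<tau>) f n\<bar> \<partial>lborel) \<le> ennreal D * R"
      if i: "i \<le> L" for i
    proof (cases "i = 0")
      case True
      have "(\<integral>\<^sup>+\<tau>\<in>{T..}. ennreal (\<tau> powr (- 1 - \<beta>)) * ennreal \<bar>heat (real i * \<tau>) f n\<bar> \<partial>lborel) =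
        (\<integral>\<^sup>+\<tau>. (ennreal (\<tau> powr (- 1 - \<beta>)) * indicator {T<..} \<tau>) * ennreal \<bar>f n\<bar> \<partial>lborel)"
      proof (rule nn_integral_cong_AE)
        have "AE \<tau> in lborel. \<tau> \<noteq> T" by (rule AE_lborel_singleton)
        then show "AE \<tau> in lborel. ennreal (\<tau> powr (- 1 - \<beta>)) * ennreal \<bar>heat (real i * \<tau>) f n\<bar> * indicator {T..} \<tau> =
          (ennreal (\<tau> powr (- 1 - \<beta>)) * indicator {T<..} \<tau>) * ennreal \<bar>f n\<bar>"
          by eventually_elim (use True f in \<open>auto simp: heat_0 indicator_def\<close>)
      qed
      also have "\<dots> = ennreal (T powr (- \<beta>) / \<beta>) * ennreal \<bar>f n\<bar>"
        using T by (subst nn_integral_multc) (auto simp: nn_integral_powr_inf[OF b])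
      also have "ennreal (T powr (- \<beta>) / \<beta>) \<le> ennreal (D * T powr (- \<beta>))"
        using b C0 by (intro ennreal_leI) (simp add: D_def distrib_right)
      finally have "(\<integral>\<^sup>+\<tau>\<in>{T..}. ennreal (\<tau> powr (- 1 - \<beta>)) * ennreal \<bar>heat (real i * \<tau>) f n\<bar> \<partial>lborel) \<le> ennreal (D * T powr (- \<beta>)) * ennreal \<bar>f n\<bar>"
        by (simp add: mult_right_mono)
      also have "\<dots> \<le> ennreal D * R" unfolding R_def using D by (simp add: ennreal_mult distrib_left mult.assoc)
      finally show ?thesis .
    next
      case False
      then have i1: "i \<ge> 1" by simp
      define E where "E = C0 * real (L + 1) powr (1 + 2 * \<beta>)"
      have E: "E \<ge> 0" using C0 by (simp add: E_def)
      define h where "h \<tau> j = ennreal (\<tau> powr (- (1/2)) * (sqrt \<tau> + iabs (n - j)) powr (- 2 - 2 * \<beta>)) * indicator {T..} \<tau>" for \<tau> j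
      have hm: "(\<lambda>\<tau>. h \<tau> j) \<in> borel_measurable lborel" for j unfolding h_def by measurable
      have ker: "\<tau> powr (- 1 - \<beta>) * \<bar>lap_kernel 0 (real i * \<tau>) m\<bar> \<le> E * (\<tau> powr (- (1/2)) * (sqrt \<tau> + iabs m) powr (- 2 - 2 * \<beta>))"
        if \<tau>: "\<tau> \<ge> T" for \<tau> m
      proof -
        have t1: "\<tau> \<ge> 1" using \<tau> T by simp
        define r where "r = sqrt (1 + real i * \<tau>)"
        have "1 * \<tau> \<le> real i * \<tau>" using i1 t1 by (intro mult_right_mono) auto
        then have r1: "sqrt \<tau> \<le> r" unfolding r_def by (intro real_sqrt_le_mono) simp
        have "1 + real i * \<tau> \<le> \<tau> + real L * \<tau>" using i t1 by (intro add_mono mult_right_mono) auto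
        also have "\<dots> = (real L + 1) * \<tau>" by (simp add: algebra_simps)
        also have "\<dots> \<le> (real L + 1)\<^sup>2 * \<tau>" using t1 by (intro mult_right_mono) (auto simp: power2_eq_square algebra_simps)
        finally have "r \<le> sqrt ((real L + 1)\<^sup>2 * \<tau>)" unfolding r_def by (rule real_sqrt_le_mono)
        then have r2: "r \<le> real (L + 1) * sqrt \<tau>" by (simp add: real_sqrt_mult add.commute)
        have st: "sqrt \<tau> > 0" using t1 by simp
        have "\<bar>lap_kernel 0 (real i * \<tau>) m\<bar> \<le> C0 * r powr (1 + 2 * \<beta>) * (r + iabs m) powr (- (2 + 2 * \<beta>))"
          unfolding r_def using t1 by (intro K) auto
        also have "\<dots> \<le> C0 * (real (L + 1) * sqrt \<tau>) powr (1 + 2 * \<beta>) * (sqrt \<tau> + iabs m) powr (- (2 + 2 * \<beta>))"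
        proof -
          have "r powr (1 + 2 * \<beta>) \<le> (real (L + 1) * sqrt \<tau>) powr (1 + 2 * \<beta>)"
            using r2 order_trans[OF less_imp_le[OF st] r1] b by (intro powr_mono2) auto
          moreover have "(r + iabs m) powr (- (2 + 2 * \<beta>)) \<le> (sqrt \<tau> + iabs m) powr (- (2 + 2 * \<beta>))"
            using r1 st b by (intro powr_mono2') (auto simp: add_pos_nonneg)
          ultimately show ?thesis using C0 by (intro mult_mono[OF mult_left_mono]) auto
        qed
        also have "\<dots> = E * (\<tau> powr (1/2 + \<beta>) * (sqrt \<tau> + iabs m) powr (- 2 - 2 * \<beta>))"
        proof -
          have "(sqrt \<tau>) powr (1 + 2 * \<beta>) = (\<tau> powr (1/2)) powr (1 + 2 * \<beta>)" using t1 by (simp add: powr_half_sqrt)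
          also have "\<dots> = \<tau> powr (1/2 + \<beta>)" unfolding powr_powr by (simp add: field_simps)
          finally show ?thesis by (simp add: powr_mult E_def)
        qed
        finally have "\<tau> powr (- 1 - \<beta>) * \<bar>lap_kernel 0 (real i * \<tau>) m\<bar> \<le> \<tau> powr (- 1 - \<beta>) * (E * (\<tau> powr (1/2 + \<beta>) * (sqrt \<tau> + iabs m) powr (- 2 - 2 * \<beta>)))"
          by (intro mult_left_mono) auto
        also have "\<dots> = E * ((\<tau> powr (- 1 - \<beta>) * \<tau> powr (1/2 + \<beta>)) * (sqrt \<tau> + iabs m) powr (- 2 - 2 * \<beta>))"
          by (simp only: mult_ac)
        also have "\<tau> powr (- 1 - \<beta>) * \<tau> powr (1/2 + \<beta>) = \<tau> powr (- (1/2))" by (simp add: powr_add[symmetric])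
        finally show ?thesis .
      qed
      interpret pair_sigma_finite "count_space (UNIV :: int set)" "lborel :: real measure"
        by (intro pair_sigma_finite.intro sigma_finite_count_int lborel.sigma_finite_measure_axioms)
      have hm2: "(\<lambda>(j, \<tau>). ennreal E * (h \<tau> j * ennreal \<bar>f j\<bar>)) \<in> borel_measurable (count_space UNIV \<Otimes>\<^sub>M lborel)"
        using hm by (intro measurable_pair_measure_countable1) auto
      have "(\<integral>\<^sup>+\<tau>\<in>{T..}. ennreal (\<tau> powr (- 1 - \<beta>)) * ennreal \<bar>heat (real i * \<tau>) f n\<bar> \<partial>lborel) \<le>
        (\<integral>\<^sup>+\<tau>. (\<integral>\<^sup>+j. ennreal E * (h \<tau> j * ennreal \<bar>f j\<bar>) \<partial>count_space UNIV) \<partial>lborel)"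
      proof (intro nn_integral_mono)
        fix \<tau>
        show "ennreal (\<tau> powr (- 1 - \<beta>)) * ennreal \<bar>heat (real i * \<tau>) f n\<bar> * indicator {T..} \<tau> \<le> (\<integral>\<^sup>+j. ennreal E * (h \<tau> j * ennreal \<bar>f j\<bar>) \<partial>count_space UNIV)"
        proof (cases "\<tau> \<ge> T")
          case True
          have "ennreal (\<tau> powr (- 1 - \<beta>)) * ennreal \<bar>heat (real i * \<tau>) f n\<bar> \<le>
            ennreal (\<tau> powr (- 1 - \<beta>)) * (\<integral>\<^sup>+j. ennreal (\<bar>lap_kernel 0 (real i * \<tau>) (n - j)\<bar> * \<bar>f j\<bar>) \<partial>count_space UNIV)"
            using abs_heat_Lap_le[OF f, of "real i * \<tau>" 0 n] by (intro mult_left_mono) auto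
          also have "\<dots> = (\<integral>\<^sup>+j. ennreal (\<tau> powr (- 1 - \<beta>)) * ennreal (\<bar>lap_kernel 0 (real i * \<tau>) (n - j)\<bar> * \<bar>f j\<bar>) \<partial>count_space UNIV)"
            by (rule nn_integral_cmult[symmetric]) simp
          also have "\<dots> \<le> (\<integral>\<^sup>+j. ennreal E * (h \<tau> j * ennreal \<bar>f j\<bar>) \<partial>count_space UNIV)"
          proof (intro nn_integral_mono)
            fix j
            have "ennreal (\<tau> powr (- 1 - \<beta>)) * ennreal (\<bar>lap_kernel 0 (real i * \<tau>) (n - j)\<bar> * \<bar>f j\<bar>) = ennreal (\<tau> powr (- 1 - \<beta>) * \<bar>lap_kernel 0 (real i * \<tau>) (n - j)\<bar>) * ennreal \<bar>f j\<bar>"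
              by (simp add: ennreal_mult mult.assoc)
            also have "\<dots> \<le> ennreal (E * (\<tau> powr (- (1/2)) * (sqrt \<tau> + iabs (n - j)) powr (- 2 - 2 * \<beta>))) * ennreal \<bar>f j\<bar>"
              by (intro mult_right_mono ennreal_leI ker True) auto
            also have "\<dots> = ennreal E * (h \<tau> j * ennreal \<bar>f j\<bar>)"
              unfolding h_def using True E by (subst ennreal_mult) (auto simp: mult.assoc)
            finally show "ennreal (\<tau> powr (- 1 - \<beta>)) * ennreal (\<bar>lap_kernel 0 (real i * \<tau>) (n - j)\<bar> * \<bar>f j\<bar>) \<le> ennreal E * (h \<tau> j * ennreal \<bar>f j\<bar>)" .
          qed
          finally show ?thesis using True by simp
        qed simp
      qed
      also have "\<dots> = (\<integral>\<^sup>+j. (\<integral>\<^sup>+\<tau>. ennreal E * (h \<tau> j * ennreal \<bar>f j\<bar>) \<partial>lborel) \<partial>count_space UNIV)"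
        by (rule Fubini'[OF hm2])
      also have "\<dots> = (\<integral>\<^sup>+j. ennreal (E * (2 / (1 + 2 * \<beta>))) * ennreal ((sqrt T + iabs (n - j)) powr (- 1 - 2 * \<beta>) * \<bar>f j\<bar>) \<partial>count_space UNIV)"
      proof (rule nn_integral_cong)
        fix j
        have "(\<integral>\<^sup>+\<tau>. ennreal E * (h \<tau> j * ennreal \<bar>f j\<bar>) \<partial>lborel) = ennreal E * ((\<integral>\<^sup>+\<tau>. h \<tau> j \<partial>lborel) * ennreal \<bar>f j\<bar>)"
          using hm by (simp add: nn_integral_cmult nn_integral_multc)
        also have "(\<integral>\<^sup>+\<tau>. h \<tau> j \<partial>lborel) = ennreal (2 / (1 + 2 * \<beta>) * (sqrt T + iabs (n - j)) powr (- 1 - 2 * \<beta>))"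
          unfolding h_def using T by (intro nn_integral_sqrt_tail b) auto
        finally show "(\<integral>\<^sup>+\<tau>. ennreal E * (h \<tau> j * ennreal \<bar>f j\<bar>) \<partial>lborel) = ennreal (E * (2 / (1 + 2 * \<beta>))) * ennreal ((sqrt T + iabs (n - j)) powr (- 1 - 2 * \<beta>) * \<bar>f j\<bar>)"
          using E b by (simp add: ennreal_mult[symmetric] mult.assoc)
      qed
      also have "\<dots> = ennreal (E * (2 / (1 + 2 * \<beta>))) * (\<integral>\<^sup>+j. ennreal ((sqrt T + iabs (n - j)) powr (- 1 - 2 * \<beta>) * \<bar>f j\<bar>) \<partial>count_space UNIV)"
        by (rule nn_integral_cmult) simp
      also have "\<dots> \<le> ennreal D * R"
        unfolding R_def using b by (intro mult_mono ennreal_leI) (auto simp: D_def E_def)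
      finally show ?thesis .
    qed
    have "frac_int {T..} L \<beta> f n \<le> (\<integral>\<^sup>+\<tau>. (\<Sum>i\<le>L. ennreal \<bar>c i\<bar> * (ennreal (\<tau> powr (- 1 - \<beta>)) * ennreal \<bar>heat (real i * \<tau>) f n\<bar> * indicator {T..} \<tau>)) \<partial>lborel)"
      unfolding frac_int_def
    proof (intro nn_integral_mono)
      fix \<tau>
      have "ennreal \<bar>(hdiff \<tau> ^^ L) f n\<bar> \<le> ennreal (\<Sum>i\<le>L. \<bar>c i\<bar> * \<bar>heat (real i * \<tau>) f n\<bar>)"
        unfolding e[OF f] by (intro ennreal_leI order_trans[OF sum_abs]) (simp add: abs_mult)
      also have "\<dots> = (\<Sum>i\<le>L. ennreal \<bar>c i\<bar> * ennreal \<bar>heat (real i * \<tau>) f n\<bar>)"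
        by (simp add: sum_ennreal[symmetric] ennreal_mult)
      finally have "ennreal (\<tau> powr (- 1 - \<beta>)) * ennreal \<bar>(hdiff \<tau> ^^ L) f n\<bar> * indicator {T..} \<tau> \<le>
        ennreal (\<tau> powr (- 1 - \<beta>)) * (\<Sum>i\<le>L. ennreal \<bar>c i\<bar> * ennreal \<bar>heat (real i * \<tau>) f n\<bar>) * indicator {T..} \<tau>"
        by (intro mult_right_mono mult_left_mono) auto
      also have "\<dots> = (\<Sum>i\<le>L. ennreal \<bar>c i\<bar> * (ennreal (\<tau> powr (- 1 - \<beta>)) * ennreal \<bar>heat (real i * \<tau>) f n\<bar> * indicator {T..} \<tau>))"
        unfolding sum_distrib_left sum_distrib_right by (intro sum.cong refl) (simp only: mult_ac)
      finally show "ennreal (\<tau> powr (- 1 - \<beta>)) * ennreal \<bar>(hdiff \<tau> ^^ L) f n\<bar> * indicator {T..} \<tau> \<le>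
        (\<Sum>i\<le>L. ennreal \<bar>c i\<bar> * (ennreal (\<tau> powr (- 1 - \<beta>)) * ennreal \<bar>heat (real i * \<tau>) f n\<bar> * indicator {T..} \<tau>))" .
    qed
    also have "\<dots> = (\<Sum>i\<le>L. ennreal \<bar>c i\<bar> * (\<integral>\<^sup>+\<tau>\<in>{T..}. ennreal (\<tau> powr (- 1 - \<beta>)) * ennreal \<bar>heat (real i * \<tau>) f n\<bar> \<partial>lborel))"
    proof (subst nn_integral_sum)
      have m: "(\<lambda>\<tau>. ennreal (\<tau> powr (- 1 - \<beta>)) * ennreal \<bar>heat (real i * \<tau>) f n\<bar> * indicator {T..} \<tau>) \<in> borel_measurable lborel" for i
        by measurable
      then show "(\<lambda>\<tau>. ennreal \<bar>c i\<bar> * (ennreal (\<tau> powr (- 1 - \<beta>)) * ennreal \<bar>heat (real i * \<tau>) f n\<bar> * indicator {T..} \<tau>)) \<in> borel_measurable lborel" for i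
        by (rule borel_measurable_times_ennreal[OF borel_measurable_const])
      show "(\<Sum>i\<le>L. \<integral>\<^sup>+\<tau>. ennreal \<bar>c i\<bar> * (ennreal (\<tau> powr (- 1 - \<beta>)) * ennreal \<bar>heat (real i * \<tau>) f n\<bar> * indicator {T..} \<tau>) \<partial>lborel) =
        (\<Sum>i\<le>L. ennreal \<bar>c i\<bar> * (\<integral>\<^sup>+\<tau>\<in>{T..}. ennreal (\<tau> powr (- 1 - \<beta>)) * ennreal \<bar>heat (real i * \<tau>) f n\<bar> \<partial>lborel))"
        by (intro sum.cong refl nn_integral_cmult m)
    qed
    also have "\<dots> \<le> (\<Sum>i\<le>L. ennreal \<bar>c i\<bar> * (ennreal D * R))" by (intro sum_mono mult_left_mono part) auto
    also have "\<dots> = ennreal C * R"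
      unfolding C_def sum_distrib_right[symmetric] using D by (simp add: sum_ennreal ennreal_mult sum_nonneg mult.assoc)
    finally show "frac_int {T..} L \<beta> f n \<le> ennreal C * (ennreal (T powr (- \<beta>)) * ennreal \<bar>f n\<bar> +
      (\<integral>\<^sup>+j. ennreal ((sqrt T + iabs (n - j)) powr (- 1 - 2 * \<beta>) * \<bar>f j\<bar>) \<partial>count_space UNIV))"
      unfolding R_def .
  qed
qed

section \<open>The fractional Laplacian\<close>

lemma ell_nn_integral:
  assumes "f \<in> ell \<beta>"
  shows "(\<integral>\<^sup>+j. ennreal ((1 + iabs j) powr (- 1 - 2 * \<beta>) * \<bar>f j\<bar>) \<partial>count_space UNIV) < \<infinity>"
proof -
  have e: "\<bar>f j\<bar> / (1 + iabs j) powr (1 + 2 * \<beta>) = (1 + iabs j) powr (- 1 - 2 * \<beta>) * \<bar>f j\<bar>" for j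
  proof -
    have "- 1 - 2 * \<beta> = - (1 + 2 * \<beta>)" by simp
    then show ?thesis by (simp only: powr_minus divide_inverse mult.commute)
  qed
  obtain S where "((\<lambda>j. (1 + iabs j) powr (- 1 - 2 * \<beta>) * \<bar>f j\<bar>) has_sum S) UNIV"
    using assms unfolding ell_def mem_Collect_eq e by (auto simp: summable_on_def)
  from has_sum_nn_integral[OF this] show ?thesis by simp
qed

text \<open>Absolute convergence of the defining integral with controlled growth in n. The growth
  control justifies Fubini against the heat kernel, and the property passes from f to its
  Laplacians.\<close>

definition frac_good :: "nat \<Rightarrow> real \<Rightarrow> (int \<Rightarrow> real) \<Rightarrow> bool" where
  "frac_good L \<beta> f \<longleftrightarrow> f \<in> expb \<and> (\<exists>C\<ge>0. \<forall>n. frac_int {0<..} L \<beta> f n \<le> ennreal (C * exp (iabs n)))"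

lemma frac_int_split:
  assumes f: "f \<in> expb" and T: "T > 0"
  shows "frac_int {0<..} L \<beta> f n \<le> frac_int {0<..<T} L \<beta> f n + frac_int {T..} L \<beta> f n"
proof -
  note [measurable] = hdiff_pow_measurable[OF f]
  have "frac_int {0<..} L \<beta> f n \<le> (\<integral>\<^sup>+\<tau>. ennreal (\<tau> powr (- 1 - \<beta>)) * ennreal \<bar>(hdiff \<tau> ^^ L) f n\<bar> * indicator {0<..<T} \<tau>
    + ennreal (\<tau> powr (- 1 - \<beta>)) * ennreal \<bar>(hdiff \<tau> ^^ L) f n\<bar> * indicator {T..} \<tau> \<partial>lborel)"
    unfolding frac_int_def by (intro nn_integral_mono) (auto simp: indicator_def)
  also have "\<dots> = frac_int {0<..<T} L \<beta> f n + frac_int {T..} L \<beta> f n"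
    unfolding frac_int_def by (intro nn_integral_add) measurable
  finally show ?thesis .
qed

text \<open>The integral is split at \<tau> = 1. Near 0 the mean value theorem gives an integrand of
  order \<tau>^{L-1-\<beta>}; beyond 1 the far estimate and membership in \<open>ell\<close> give
  polynomial growth in n.\<close>

lemma frac_good_ell:
  assumes f: "f \<in> expb" "f \<in> ell \<beta>" and b: "0 < \<beta>" "\<beta> < real L"
  shows "frac_good L \<beta> f"
proof -
  obtain C where C: "C \<ge> 0" "\<And>n. \<bar>f n\<bar> \<le> C * exp (iabs n)" using expbE[OF f(1)] by blast
  obtain C1 where C1: "C1 \<ge> 0" and far: "\<And>n. frac_int {1..} L \<beta> f n \<le>
    ennreal C1 * (ennreal (1 powr (- \<beta>)) * ennreal \<bar>f n\<bar> +
      (\<integral>\<^sup>+j. ennreal ((sqrt 1 + iabs (n - j)) powr (- 1 - 2 * \<beta>) * \<bar>f j\<bar>) \<partial>count_space UNIV))"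
    using frac_int_far[OF b(1), of L] f(1) by blast
  define S where "S = (\<integral>\<^sup>+j. ennreal ((1 + iabs j) powr (- 1 - 2 * \<beta>) * \<bar>f j\<bar>) \<partial>count_space UNIV)"
  have "S < \<infinity>" unfolding S_def by (rule ell_nn_integral[OF f(2)])
  then obtain s where s: "S = ennreal s" "s \<ge> 0" by (cases S) auto
  define M where "M = 1 + 2 * \<beta>"
  have M: "M > 0" using b by (simp add: M_def)
  define D where "D = exp (1 - M + M * ln M)"
  have D: "D \<ge> 0" by (simp add: D_def)
  have poly: "(1 + iabs n) powr M \<le> D * exp (iabs n)" for n
    unfolding D_def by (intro powr_le_exp M) simp
  have far': "frac_int {1..} L \<beta> f n \<le> ennreal (C1 * (C + D * s) * exp (iabs n))" for n
  proof -
    have "(\<integral>\<^sup>+j. ennreal ((sqrt 1 + iabs (n - j)) powr (- 1 - 2 * \<beta>) * \<bar>f j\<bar>) \<partial>count_space UNIV)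
      \<le> (\<integral>\<^sup>+j. ennreal ((1 + iabs n) powr M) * ennreal ((1 + iabs j) powr (- 1 - 2 * \<beta>) * \<bar>f j\<bar>) \<partial>count_space UNIV)"
    proof (intro nn_integral_mono)
      fix j
      let ?a = "1 + iabs (n - j)" and ?b = "1 + iabs n" and ?c = "1 + iabs j"
      \<comment> \<open>The submultiplicative bound 1 + |j| <= (1 + |n - j|)(1 + |n|) moves the
        weight from n - j to j at a polynomial cost in n.\<close>
      have "?c \<le> ?a + iabs n" unfolding of_int_diff by argo
      also have "\<dots> \<le> ?a * ?b" by (simp add: distrib_left distrib_right)
      finally have "?c powr M \<le> (?a * ?b) powr M" using M by (intro powr_mono2) auto
      then have "?c powr M \<le> ?a powr M * ?b powr M" by (simp add: powr_mult)
      moreover have "?a powr M > 0" "?c powr M > 0" by (simp_all add: add_pos_nonneg)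
      ultimately have "?a powr (- M) \<le> ?b powr M * ?c powr (- M)" by (simp add: powr_minus field_simps)
      then have "?a powr (- 1 - 2 * \<beta>) * \<bar>f j\<bar> \<le> ?b powr M * ?c powr (- 1 - 2 * \<beta>) * \<bar>f j\<bar>"
        by (intro mult_right_mono) (auto simp: M_def)
      then show "ennreal ((sqrt 1 + iabs (n - j)) powr (- 1 - 2 * \<beta>) * \<bar>f j\<bar>) \<le> ennreal (?b powr M) * ennreal (?c powr (- 1 - 2 * \<beta>) * \<bar>f j\<bar>)"
        by (simp add: ennreal_mult[symmetric] ennreal_leI mult.assoc)
    qed
    also have "\<dots> = ennreal ((1 + iabs n) powr M) * S" unfolding S_def by (rule nn_integral_cmult) simp
    also have "\<dots> \<le> ennreal (D * exp (iabs n)) * ennreal s" unfolding s(1) by (intro mult_right_mono ennreal_leI poly) auto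
    finally have 1: "(\<integral>\<^sup>+j. ennreal ((sqrt 1 + iabs (n - j)) powr (- 1 - 2 * \<beta>) * \<bar>f j\<bar>) \<partial>count_space UNIV) \<le> ennreal (D * exp (iabs n)) * ennreal s" .
    have "frac_int {1..} L \<beta> f n \<le> ennreal C1 * (ennreal (C * exp (iabs n)) + ennreal (D * exp (iabs n)) * ennreal s)"
    proof (rule order_trans[OF far], intro mult_left_mono add_mono 1)
      show "ennreal (1 powr (- \<beta>)) * ennreal \<bar>f n\<bar> \<le> ennreal (C * exp (iabs n))" using C(2)[of n] by (simp add: ennreal_leI)
    qed simp
    also have "\<dots> = ennreal (C1 * (C + D * s) * exp (iabs n))"
      using C C1 D s by (simp add: ennreal_mult[symmetric] ennreal_plus[symmetric] algebra_simps del: ennreal_plus)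
    finally show ?thesis .
  qed
  \<comment> \<open>The growth constant of \<Delta>^L f under the flow at times s <= L \<tau> <= L:
    e^{-2s} <= 1 is dropped, and 8^L pays for the Laplacians.\<close>
  define C2 where "C2 = exp (2 * exp 1 * real L) * (8 ^ L * C)"
  have C2: "C2 \<ge> 0" using C by (simp add: C2_def)
  have Lb: "real L - \<beta> > 0" using b by simp
  have near: "frac_int {0<..<1} L \<beta> f n \<le> ennreal (C2 / (real L - \<beta>) * exp (iabs n))" for n
  proof -
    have "frac_int {0<..<1} L \<beta> f n \<le> (\<integral>\<^sup>+\<tau>. ennreal (C2 * exp (iabs n)) * (ennreal (\<tau> powr ((real L - \<beta>) - 1)) * indicator {0<..<1} \<tau>) \<partial>lborel)"
      unfolding frac_int_def
    proof (intro nn_integral_mono)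
      fix \<tau> :: real
      show "ennreal (\<tau> powr (- 1 - \<beta>)) * ennreal \<bar>(hdiff \<tau> ^^ L) f n\<bar> * indicator {0<..<1} \<tau> \<le> ennreal (C2 * exp (iabs n)) * (ennreal (\<tau> powr ((real L - \<beta>) - 1)) * indicator {0<..<1} \<tau>)"
      proof (cases "\<tau> \<in> {0<..<1}")
        case True
        have "\<bar>(hdiff \<tau> ^^ L) f n\<bar> \<le> \<tau> ^ L * (C2 * exp (iabs n))"
        proof (rule hdiff_pow_MVT[OF f(1)])
          fix s assume s: "0 \<le> s" "s \<le> real L * \<tau>"
          have "real L * \<tau> \<le> real L * 1" using True by (intro mult_left_mono) auto
          then have s2: "s \<le> real L" using s by simp
          have "\<bar>heat s ((Lap ^^ L) f) n\<bar> \<le> exp (- 2 * s) * exp (2 * exp 1 * \<bar>s\<bar>) * (8 ^ L * C) * exp (iabs n)"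
            by (rule heat_bound[OF Lap_pow_bound[OF C(2,1)]]) (use C in auto)
          also have "\<dots> \<le> 1 * exp (2 * exp 1 * real L) * (8 ^ L * C) * exp (iabs n)"
            using s s2 C by (intro mult_right_mono mult_mono) auto
          finally show "\<bar>heat s ((Lap ^^ L) f) n\<bar> \<le> C2 * exp (iabs n)" by (simp add: C2_def mult.assoc)
        qed (use True in auto)
        also have "\<tau> ^ L = \<tau> powr real L" using True by (simp add: powr_realpow)
        finally have "\<tau> powr (- 1 - \<beta>) * \<bar>(hdiff \<tau> ^^ L) f n\<bar> \<le> \<tau> powr (- 1 - \<beta>) * (\<tau> powr real L * (C2 * exp (iabs n)))"
          by (intro mult_left_mono) auto
        also have "\<dots> = C2 * exp (iabs n) * (\<tau> powr (- 1 - \<beta>) * \<tau> powr real L)" by (simp only: mult_ac)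
        also have "\<tau> powr (- 1 - \<beta>) * \<tau> powr real L = \<tau> powr ((real L - \<beta>) - 1)" by (simp add: powr_add[symmetric] algebra_simps)
        finally show ?thesis using True C2 by (simp add: ennreal_mult[symmetric] ennreal_leI)
      qed simp
    qed
    also have "\<dots> = ennreal (C2 * exp (iabs n)) * ennreal (1 powr (real L - \<beta>) / (real L - \<beta>))"
      by (subst nn_integral_cmult) (auto simp: nn_integral_powr_0[OF Lb])
    also have "\<dots> = ennreal (C2 / (real L - \<beta>) * exp (iabs n))"
      using C2 Lb by (simp add: ennreal_mult[symmetric])
    finally show ?thesis .
  qed
  have "frac_int {0<..} L \<beta> f n \<le> ennreal ((C2 / (real L - \<beta>) + C1 * (C + D * s)) * exp (iabs n))" for n
  proof -
    have "frac_int {0<..} L \<beta> f n \<le> frac_int {0<..<1} L \<beta> f n + frac_int {1..} L \<beta> f n" by (rule frac_int_split[OF f(1)]) simp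
    also have "\<dots> \<le> ennreal (C2 / (real L - \<beta>) * exp (iabs n)) + ennreal (C1 * (C + D * s) * exp (iabs n))"
      by (intro add_mono near far')
    also have "\<dots> = ennreal ((C2 / (real L - \<beta>) + C1 * (C + D * s)) * exp (iabs n))"
      using C C1 C2 D s Lb by (simp add: ennreal_plus[symmetric] distrib_right del: ennreal_plus)
    finally show ?thesis .
  qed
  moreover have "C2 / (real L - \<beta>) + C1 * (C + D * s) \<ge> 0" using C C1 C2 D s Lb by simp
  ultimately show ?thesis unfolding frac_good_def using f(1) by blast
qed

text \<open>The fractional power without its normalising constant and with the order L of the
  difference as a free parameter.\<close>

definition frac_op :: "nat \<Rightarrow> real \<Rightarrow> (int \<Rightarrow> real) \<Rightarrow> int \<Rightarrow> real" where
  "frac_op L \<beta> f n = (LINT \<tau>:{0<..}|lborel. (hdiff \<tau> ^^ L) f n / \<tau> powr (1 + \<beta>))"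

definition frac_integrand :: "nat \<Rightarrow> real \<Rightarrow> (int \<Rightarrow> real) \<Rightarrow> int \<Rightarrow> real \<Rightarrow> real" where
  "frac_integrand L \<beta> f n \<tau> = indicator {0<..} \<tau> *\<^sub>R ((hdiff \<tau> ^^ L) f n / \<tau> powr (1 + \<beta>))"

lemma frac_op_eq: "frac_op L \<beta> f n = (\<integral>\<tau>. frac_integrand L \<beta> f n \<tau> \<partial>lborel)"
  by (simp add: frac_op_def frac_integrand_def set_lebesgue_integral_def)

lemma frac_integrand_measurable: "f \<in> expb \<Longrightarrow> frac_integrand L \<beta> f n \<in> borel_measurable borel"
proof -
  assume "f \<in> expb"
  note [measurable] = hdiff_pow_measurable[OF this]
  show ?thesis unfolding frac_integrand_def[abs_def] by measurable
qed

lemma frac_integrand_norm: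
  "(\<integral>\<^sup>+\<tau>. ennreal \<bar>frac_integrand L \<beta> f n \<tau>\<bar> \<partial>lborel) = frac_int {0<..} L \<beta> f n"
  unfolding frac_int_def
proof (rule nn_integral_cong)
  fix \<tau> :: real
  have "- 1 - \<beta> = - (1 + \<beta>)" by simp
  then have e: "\<tau> powr (- 1 - \<beta>) = inverse (\<tau> powr (1 + \<beta>))" by (simp only: powr_minus)
  show "ennreal \<bar>frac_integrand L \<beta> f n \<tau>\<bar> = ennreal (\<tau> powr (- 1 - \<beta>)) * ennreal \<bar>(hdiff \<tau> ^^ L) f n\<bar> * indicator {0<..} \<tau>"
    unfolding e frac_integrand_def
    by (auto simp: indicator_def abs_mult ennreal_mult[symmetric] divide_inverse mult.commute)
qed

lemma frac_integrand_integrable: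
  assumes "frac_good L \<beta> f"
  shows "integrable lborel (frac_integrand L \<beta> f n)"
proof (rule integrableI_bounded)
  show "frac_integrand L \<beta> f n \<in> borel_measurable lborel"
    using assms frac_integrand_measurable by (simp add: frac_good_def)
  obtain C where "frac_int {0<..} L \<beta> f n \<le> ennreal (C * exp (iabs n))" using assms by (auto simp: frac_good_def)
  then show "(\<integral>\<^sup>+\<tau>. ennreal (norm (frac_integrand L \<beta> f n \<tau>)) \<partial>lborel) < \<infinity>"
    by (simp add: frac_integrand_norm) (auto elim: le_less_trans)
qed

lemma frac_op_le: "frac_good L \<beta> f \<Longrightarrow> ennreal \<bar>frac_op L \<beta> f n\<bar> \<le> frac_int {0<..} L \<beta> f n"
  using integral_norm_bound_ennreal[OF frac_integrand_integrable, of L \<beta> f n]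
  unfolding frac_op_eq frac_integrand_norm[symmetric] by simp

lemma frac_op_expb: "frac_good L \<beta> f \<Longrightarrow> frac_op L \<beta> f \<in> expb"
proof -
  assume g: "frac_good L \<beta> f"
  then obtain C where C: "C \<ge> 0" "\<And>n. frac_int {0<..} L \<beta> f n \<le> ennreal (C * exp (iabs n))" by (auto simp: frac_good_def)
  have "\<bar>frac_op L \<beta> f n\<bar> \<le> C * exp (iabs n)" for n
    using order_trans[OF frac_op_le[OF g] C(2), of n] C(1) by simp
  then show ?thesis by (rule expbI)
qed

lemma frac_integrand_Lap:
  "f \<in> expb \<Longrightarrow> frac_integrand L \<beta> (Lap f) n \<tau> = frac_integrand L \<beta> f (n + 1) \<tau> - 2 * frac_integrand L \<beta> f n \<tau> + frac_integrand L \<beta> f (n - 1) \<tau>"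
  unfolding frac_integrand_def Lap_hdiff_pow[symmetric] discrete_laplacian_def
  by (simp add: add_divide_distrib diff_divide_distrib algebra_simps)

lemma frac_good_Lap:
  assumes g: "frac_good L \<beta> f"
  shows "frac_good L \<beta> (Lap f)"
proof -
  have f: "f \<in> expb" using g by (simp add: frac_good_def)
  obtain C where C: "C \<ge> 0" "\<And>n. frac_int {0<..} L \<beta> f n \<le> ennreal (C * exp (iabs n))" using g by (auto simp: frac_good_def)
  note [measurable] = frac_integrand_measurable[OF f]
  have "frac_int {0<..} L \<beta> (Lap f) n \<le> ennreal (C * 12 * exp (iabs n))" for n
  proof -
    let ?h = "\<lambda>n \<tau>. ennreal \<bar>frac_integrand L \<beta> f n \<tau>\<bar>"
    have "frac_int {0<..} L \<beta> (Lap f) n \<le> (\<integral>\<^sup>+\<tau>. ?h (n + 1) \<tau> + 2 * ?h n \<tau> + ?h (n - 1) \<tau> \<partial>lborel)"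
      unfolding frac_integrand_norm[symmetric]
    proof (intro nn_integral_mono)
      fix \<tau>
      have "\<bar>frac_integrand L \<beta> (Lap f) n \<tau>\<bar> \<le> \<bar>frac_integrand L \<beta> f (n + 1) \<tau>\<bar> + 2 * \<bar>frac_integrand L \<beta> f n \<tau>\<bar> + \<bar>frac_integrand L \<beta> f (n - 1) \<tau>\<bar>"
        unfolding frac_integrand_Lap[OF f] by linarith
      from ennreal_leI[OF this] show "ennreal \<bar>frac_integrand L \<beta> (Lap f) n \<tau>\<bar> \<le> ?h (n + 1) \<tau> + 2 * ?h n \<tau> + ?h (n - 1) \<tau>"
        by (simp add: ennreal_mult)
    qed
    also have "\<dots> = frac_int {0<..} L \<beta> f (n + 1) + 2 * frac_int {0<..} L \<beta> f n + frac_int {0<..} L \<beta> f (n - 1)"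
      by (simp add: nn_integral_add nn_integral_cmult frac_integrand_norm)
    also have "\<dots> \<le> ennreal (C * exp (iabs (n + 1))) + 2 * ennreal (C * exp (iabs n)) + ennreal (C * exp (iabs (n - 1)))"
      by (intro add_mono mult_left_mono C) auto
    also have "\<dots> = ennreal (C * (exp (iabs (n + 1)) + 2 * exp (iabs n) + exp (iabs (n - 1))))"
    proof -
      have "ennreal (C * x) + 2 * ennreal (C * y) + ennreal (C * z) = ennreal (C * (x + 2 * y + z))" if "x \<ge> 0" "y \<ge> 0" "z \<ge> 0" for x y z
      proof -
        have "2 * ennreal (C * y) = ennreal (2 * (C * y))" using that C(1) by (simp add: ennreal_mult)
        then show ?thesis using that C(1) by (simp add: ennreal_plus[symmetric] algebra_simps del: ennreal_plus)
      qed
      then show ?thesis by simp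
    qed
    also have "\<dots> \<le> ennreal (C * (12 * exp (iabs n)))"
    proof (intro ennreal_leI mult_left_mono C(1))
      note 1 = exp_abs_shift[of _ n]
      show "exp (iabs (n + 1)) + 2 * exp (iabs n) + exp (iabs (n - 1)) \<le> 12 * exp (iabs n)"
        using 1[of 1] 1[of "- 1"] exp_ge_zero[of "iabs n"] unfolding add_uminus_conv_diff by linarith
    qed
    finally show ?thesis by (simp add: mult.assoc)
  qed
  then show ?thesis unfolding frac_good_def using expb_Lap[OF f] C(1) by (intro conjI exI[of _ "C * 12"]) auto
qed

lemma Lap_frac_op:
  assumes g: "frac_good L \<beta> f"
  shows "Lap (frac_op L \<beta> f) = frac_op L \<beta> (Lap f)"
proof
  fix n
  have f: "f \<in> expb" using g by (simp add: frac_good_def)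
  note i = frac_integrand_integrable[OF g]
  have "frac_op L \<beta> (Lap f) n = (\<integral>\<tau>. frac_integrand L \<beta> f (n + 1) \<tau> - 2 * frac_integrand L \<beta> f n \<tau> + frac_integrand L \<beta> f (n - 1) \<tau> \<partial>lborel)"
    by (simp add: frac_op_eq frac_integrand_Lap[OF f])
  also have "\<dots> = frac_op L \<beta> f (n + 1) - 2 * frac_op L \<beta> f n + frac_op L \<beta> f (n - 1)"
    unfolding frac_op_eq using i by simp
  finally show "Lap (frac_op L \<beta> f) n = frac_op L \<beta> (Lap f) n" by (simp add: discrete_laplacian_def)
qed

lemma Lap_pow_frac_op:
  assumes g: "frac_good L \<beta> f"
  shows "(Lap ^^ l) (frac_op L \<beta> f) = frac_op L \<beta> ((Lap ^^ l) f)" "frac_good L \<beta> ((Lap ^^ l) f)"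
proof (induction l)
  case (Suc l)
  case 1
  show ?case using Suc by (simp add: Lap_frac_op)
  case 2
  show ?case using Suc by (simp add: frac_good_Lap)
qed (use g in simp_all)

text \<open>The unordered sum is recast as a Bochner integral over counting measure, so that
  Fubini's theorem covers its exchange with the \<tau>-integral.\<close>

lemma heat_integral:
  assumes f: "f \<in> expb"
  shows "integrable (count_space UNIV) (\<lambda>j. heat_kernel t (n - j) * f j)"
    and "heat t f n = (\<integral>j. heat_kernel t (n - j) * f j \<partial>count_space UNIV)"
proof -
  have s: "Infinite_Set_Sum.abs_summable_on (\<lambda>j. heat_kernel t (n - j) * f j) UNIV"
    unfolding abs_summable_equivalent[symmetric] using heat_has_sum_kernel(2)[OF f] by simp
  show "integrable (count_space UNIV) (\<lambda>j. heat_kernel t (n - j) * f j)"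
    using s by (simp add: Infinite_Set_Sum.abs_summable_on_def)
  show "heat t f n = (\<integral>j. heat_kernel t (n - j) * f j \<partial>count_space UNIV)"
    unfolding heat_def infsetsum_infsum[OF s, symmetric] infsetsum_def ..
qed

text \<open>Fubini moves the flow inside the \<tau>-integral; the growth bound in
  \<open>frac_good\<close> is summable against the heat kernel, which gives joint
  integrability.\<close>

lemma heat_frac_op_le:
  assumes g: "frac_good L \<beta> f" and t: "t \<ge> 0"
  shows "ennreal \<bar>heat t (frac_op L \<beta> f) n\<bar> \<le> frac_int {0<..} L \<beta> (heat t f) n"
proof -
  have f: "f \<in> expb" using g by (simp add: frac_good_def)
  obtain C where C: "C \<ge> 0" "\<And>n. frac_int {0<..} L \<beta> f n \<le> ennreal (C * exp (iabs n))" using g by (auto simp: frac_good_def)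
  define F where "F j \<tau> = heat_kernel t (n - j) * frac_integrand L \<beta> f j \<tau>" for j \<tau>
  interpret pair_sigma_finite "count_space (UNIV :: int set)" "lborel :: real measure"
    by (intro pair_sigma_finite.intro sigma_finite_count_int lborel.sigma_finite_measure_axioms)
  note m = frac_integrand_measurable[OF f]
  have Fm[measurable]: "case_prod F \<in> borel_measurable (count_space UNIV \<Otimes>\<^sub>M lborel)"
    unfolding F_def case_prod_unfold using m by (intro measurable_pair_measure_countable1) auto
  have int: "integrable (count_space UNIV \<Otimes>\<^sub>M lborel) (case_prod F)"
  proof (rule integrableI_bounded[OF Fm])
    have "(\<integral>\<^sup>+x. ennreal (norm (case_prod F x)) \<partial>(count_space UNIV \<Otimes>\<^sub>M lborel)) = (\<integral>\<^sup>+j. (\<integral>\<^sup>+\<tau>. ennreal \<bar>F j \<tau>\<bar> \<partial>lborel) \<partial>count_space UNIV)"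
      by (subst lborel.nn_integral_fst[symmetric]) auto
    also have "\<dots> = (\<integral>\<^sup>+j. ennreal (heat_kernel t (n - j)) * frac_int {0<..} L \<beta> f j \<partial>count_space UNIV)"
    proof (rule nn_integral_cong)
      fix j
      have "ennreal \<bar>F j \<tau>\<bar> = ennreal (heat_kernel t (n - j)) * ennreal \<bar>frac_integrand L \<beta> f j \<tau>\<bar>" for \<tau>
        using heat_kernel_nonneg[OF t, of "n - j"] by (simp add: F_def abs_mult ennreal_mult)
      then show "(\<integral>\<^sup>+\<tau>. ennreal \<bar>F j \<tau>\<bar> \<partial>lborel) = ennreal (heat_kernel t (n - j)) * frac_int {0<..} L \<beta> f j"
        using m by (simp add: nn_integral_cmult frac_integrand_norm)
    qed
    also have "\<dots> \<le> (\<integral>\<^sup>+j. ennreal (norm (heat_kernel t (n - j) * (C * exp (iabs j)))) \<partial>count_space UNIV)"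
    proof (intro nn_integral_mono)
      fix j
      have "ennreal (heat_kernel t (n - j)) * frac_int {0<..} L \<beta> f j \<le> ennreal (heat_kernel t (n - j)) * ennreal (C * exp (iabs j))"
        by (intro mult_left_mono C) auto
      then show "ennreal (heat_kernel t (n - j)) * frac_int {0<..} L \<beta> f j \<le> ennreal (norm (heat_kernel t (n - j) * (C * exp (iabs j))))"
        using heat_kernel_nonneg[OF t, of "n - j"] C(1) by (simp add: abs_mult ennreal_mult[symmetric])
    qed
    also have "\<dots> < \<infinity>"
    proof -
      have "(\<lambda>j. C * exp (iabs j)) \<in> expb" by (rule expbI[where C = C]) (use C in simp)
      from heat_integral(1)[OF this, of t n] show ?thesis by (simp only: integrable_iff_bounded)
    qed
    finally show "(\<integral>\<^sup>+x. ennreal (norm (case_prod F x)) \<partial>(count_space UNIV \<Otimes>\<^sub>M lborel)) < \<infinity>" .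
  qed
  have "heat t (frac_op L \<beta> f) n = (\<integral>j. (\<integral>\<tau>. F j \<tau> \<partial>lborel) \<partial>count_space UNIV)"
    using heat_integral(2)[OF frac_op_expb[OF g]] by (simp add: frac_op_eq F_def)
  also have "\<dots> = (\<integral>\<tau>. (\<integral>j. F j \<tau> \<partial>count_space UNIV) \<partial>lborel)"
    by (rule Fubini_integral[OF int, symmetric])
  also have "\<dots> = (\<integral>\<tau>. frac_integrand L \<beta> (heat t f) n \<tau> \<partial>lborel)"
  proof (rule Bochner_Integration.integral_cong)
    fix \<tau>
    have "(\<integral>j. F j \<tau> \<partial>count_space UNIV) = (\<integral>j. (indicator {0<..} \<tau> / \<tau> powr (1 + \<beta>)) * (heat_kernel t (n - j) * (hdiff \<tau> ^^ L) f j) \<partial>count_space UNIV)"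
      by (rule Bochner_Integration.integral_cong) (auto simp: F_def frac_integrand_def)
    also have "\<dots> = (indicator {0<..} \<tau> / \<tau> powr (1 + \<beta>)) * heat t ((hdiff \<tau> ^^ L) f) n"
      using heat_integral[OF expb_hdiff_pow[OF f]] by simp
    finally show "(\<integral>j. F j \<tau> \<partial>count_space UNIV) = frac_integrand L \<beta> (heat t f) n \<tau>"
      by (simp add: frac_integrand_def heat_hdiff_pow[OF f])
  qed simp
  finally have e: "heat t (frac_op L \<beta> f) n = (\<integral>\<tau>. frac_integrand L \<beta> (heat t f) n \<tau> \<partial>lborel)" .
  show ?thesis
  proof (cases "integrable lborel (frac_integrand L \<beta> (heat t f) n)")
    case True
    from integral_norm_bound_ennreal[OF this] show ?thesis unfolding e frac_integrand_norm[symmetric] by simp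
  next
    \<comment> \<open>A Bochner integral of a non-integrable function is 0 by convention, so the
      bound holds trivially here.\<close>
    case False
    then show ?thesis unfolding e by (simp add: not_integrable_integral_eq)
  qed
qed

text \<open>Minkowski in \<tau>, then the norm estimate for the differences, then integrating out
  \<tau>: the power r^l becomes r^{l-\<beta>}. The flow time t is simply added to r.\<close>

lemma lp_norm_heat_frac_op:
  assumes p: "1 \<le> p" and b: "\<beta> > 0"
  shows "\<exists>C\<ge>0. \<forall>g t. frac_good (Suc l) \<beta> g \<longrightarrow> t \<ge> 0 \<longrightarrow> lp_norm p (heat t (frac_op (Suc l) \<beta> g)) \<le>
    ennreal C * (\<integral>\<^sup>+r\<in>{0<..}. ennreal (r powr (real (Suc l) - \<beta> - 1)) * lp_norm p (heat (t + r) ((Lap ^^ Suc l) g)) \<partial>lborel)"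
proof -
  obtain C where C: "C \<ge> 0" and D: "\<And>f \<tau>. f \<in> expb \<Longrightarrow> \<tau> \<ge> 0 \<Longrightarrow> lp_norm p ((hdiff \<tau> ^^ Suc l) f)
     \<le> ennreal C * (\<integral>\<^sup>+r\<in>{0<..<\<tau>}. ennreal (r powr real l) * lp_norm p (heat r ((Lap ^^ Suc l) f)) \<partial>lborel)"
    using lp_norm_hdiff_pow[OF p, of l] by blast
  show ?thesis
  proof (intro exI[of _ "C * (1 / \<beta>)"] conjI allI impI)
    fix g t assume g: "frac_good (Suc l) \<beta> g" and t: "(0::real) \<le> t"
    have ge: "g \<in> expb" using g by (simp add: frac_good_def)
    define v where "v = heat t g"
    have v: "v \<in> expb" unfolding v_def by (rule expb_heat[OF ge])
    note [measurable] = hdiff_pow_measurable[OF v]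
    have [measurable]: "(\<lambda>\<tau>. lp_norm p ((hdiff \<tau> ^^ Suc l) v)) \<in> borel_measurable borel"
      by (rule lp_norm_measurable[OF p hdiff_pow_measurable[OF v]])
    define A where "A r = ennreal (r powr real l) * lp_norm p (heat r ((Lap ^^ Suc l) v))" for r
    have [measurable]: "A \<in> borel_measurable borel"
      unfolding A_def using lp_norm_heat_measurable[OF p expb_Lap_pow[OF v]] by measurable
    have "lp_norm p (heat t (frac_op (Suc l) \<beta> g)) \<le> (\<integral>\<^sup>+\<tau>. ennreal (\<tau> powr (- 1 - \<beta>)) * lp_norm p ((hdiff \<tau> ^^ Suc l) v) * indicator {0<..} \<tau> \<partial>lborel)"
    proof (rule lp_norm_le_integral[OF lborel.sigma_finite_measure_axioms p])
      fix n
      show "(\<lambda>\<tau>. ennreal (\<tau> powr (- 1 - \<beta>)) * ennreal \<bar>(hdiff \<tau> ^^ Suc l) v n\<bar> * indicator {0<..} \<tau>) \<in> borel_measurable lborel"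
        by measurable
      show "ennreal \<bar>heat t (frac_op (Suc l) \<beta> g) n\<bar> \<le> (\<integral>\<^sup>+\<tau>. ennreal (\<tau> powr (- 1 - \<beta>)) * ennreal \<bar>(hdiff \<tau> ^^ Suc l) v n\<bar> * indicator {0<..} \<tau> \<partial>lborel)"
        using heat_frac_op_le[OF g t, of n] by (simp only: frac_int_def v_def)
    next
      fix \<tau> :: real
      show "Lnorm (count_space UNIV) p (\<lambda>n. ennreal (\<tau> powr (- 1 - \<beta>)) * ennreal \<bar>(hdiff \<tau> ^^ Suc l) v n\<bar> * indicator {0<..} \<tau>)
        \<le> ennreal (\<tau> powr (- 1 - \<beta>)) * lp_norm p ((hdiff \<tau> ^^ Suc l) v) * indicator {0<..} \<tau>"
        using Lnorm_cmult_le[of "\<lambda>n. ennreal \<bar>(hdiff \<tau> ^^ Suc l) v n\<bar>" "count_space UNIV" p "\<tau> powr (- 1 - \<beta>)"]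
          Lnorm_cmult_le[of "\<lambda>n. ennreal \<bar>(hdiff \<tau> ^^ Suc l) v n\<bar>" "count_space UNIV" p 0] p
        by (cases "\<tau> > 0") (auto simp: lp_norm_def simp del: funpow.simps)
    qed measurable
    also have "\<dots> \<le> (\<integral>\<^sup>+\<tau>. ennreal C * (ennreal (\<tau> powr (- 1 - \<beta>)) * (\<integral>\<^sup>+r\<in>{0<..<\<tau>}. A r \<partial>lborel) * indicator {0<..} \<tau>) \<partial>lborel)"
    proof (intro nn_integral_mono)
      fix \<tau> :: real
      show "ennreal (\<tau> powr (- 1 - \<beta>)) * lp_norm p ((hdiff \<tau> ^^ Suc l) v) * indicator {0<..} \<tau> \<le> ennreal C * (ennreal (\<tau> powr (- 1 - \<beta>)) * (\<integral>\<^sup>+r\<in>{0<..<\<tau>}. A r \<partial>lborel) * indicator {0<..} \<tau>)"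
        using mult_left_mono[OF D[OF v, of \<tau>], of "ennreal (\<tau> powr (- 1 - \<beta>))"]
        by (cases "\<tau> > 0") (auto simp: A_def mult_ac simp del: funpow.simps)
    qed
    also have "\<dots> = ennreal C * (\<integral>\<^sup>+\<tau>\<in>{0<..}. ennreal (\<tau> powr (- 1 - \<beta>)) * (\<integral>\<^sup>+r\<in>{0<..<\<tau>}. A r \<partial>lborel) \<partial>lborel)"
      by (rule nn_integral_cmult) measurable
    also have "\<dots> \<le> ennreal C * (ennreal (1 / \<beta>) * (\<integral>\<^sup>+r\<in>{0<..}. ennreal (r powr (- \<beta>)) * A r \<partial>lborel))"
      by (intro mult_left_mono nn_integral_tail b) auto
    also have "\<dots> = ennreal (C * (1 / \<beta>)) * (\<integral>\<^sup>+r\<in>{0<..}. ennreal (r powr (- \<beta>)) * A r \<partial>lborel)"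
      using C b by (simp only: ennreal_mult mult.assoc divide_nonneg_pos zero_le_one)
    also have "(\<integral>\<^sup>+r\<in>{0<..}. ennreal (r powr (- \<beta>)) * A r \<partial>lborel) = (\<integral>\<^sup>+r\<in>{0<..}. ennreal (r powr (real (Suc l) - \<beta> - 1)) * lp_norm p (heat (t + r) ((Lap ^^ Suc l) g)) \<partial>lborel)"
    proof (rule nn_integral_cong)
      fix r :: real
      have e: "heat r ((Lap ^^ Suc l) v) = heat (t + r) ((Lap ^^ Suc l) g)"
        unfolding v_def Lap_pow_heat[OF ge] by (rule heat_heat[OF expb_Lap_pow[OF ge]])
      have "ennreal (r powr (- \<beta>)) * ennreal (r powr real l) = ennreal (r powr (real (Suc l) - \<beta> - 1))"
        by (simp add: ennreal_mult[symmetric] powr_add[symmetric])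
      then show "ennreal (r powr (- \<beta>)) * A r * indicator {0<..} r = ennreal (r powr (real (Suc l) - \<beta> - 1)) * lp_norm p (heat (t + r) ((Lap ^^ Suc l) g)) * indicator {0<..} r"
        unfolding A_def e by (simp only: mult.assoc[symmetric])
    qed
    finally show "lp_norm p (heat t (frac_op (Suc l) \<beta> g)) \<le> ennreal (C * (1 / \<beta>)) * (\<integral>\<^sup>+r\<in>{0<..}. ennreal (r powr (real (Suc l) - \<beta> - 1)) * lp_norm p (heat (t + r) ((Lap ^^ Suc l) g)) \<partial>lborel)" .
  qed (use C b in simp)
qed

text \<open>The substitution r = t y gives a superposition of dilations by 1 + y with weight y^{B-1}
  (1 + y)^{-(A+B)}, a Beta integral; B > 0 makes it converge at 0 and A > 0 at infinity.\<close>

lemma Lnorm_dt_tail: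
  assumes q: "1 \<le> q" and A: "A > 0" and B: "B > 0" and [measurable]: "\<psi> \<in> borel_measurable borel"
    and fin: "Lnorm dt_over_t q (\<lambda>t. ennreal (t powr (A + B)) * \<psi> t) < \<infinity>"
  shows "Lnorm dt_over_t q (\<lambda>t. ennreal (t powr A) * (\<integral>\<^sup>+r\<in>{0<..}. ennreal (r powr (B - 1)) * \<psi> (t + r) \<partial>lborel)) < \<infinity>"
proof -
  define G where "G t = ennreal (t powr (A + B)) * \<psi> t" for t
  have [measurable]: "G \<in> borel_measurable borel" unfolding G_def by measurable
  define w where "w y = y powr (B - 1) * (1 + y) powr (- (A + B)) * indicator {0<..} y" for y :: real
  have [measurable]: "w \<in> borel_measurable borel" unfolding w_def by measurable
  have w0: "w y \<ge> 0" for y by (simp add: w_def)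
  \<comment> \<open>The Beta integral is only shown finite: y^{B-1} dominates the weight for small y
    and y^{-1-A} for large y. The two ranges overlap on purpose, so no boundary point needs
    care.\<close>
  have "(\<integral>\<^sup>+y. ennreal (w y) \<partial>lborel) \<le> (\<integral>\<^sup>+y. ennreal (y powr (B - 1)) * indicator {0<..<2} y + ennreal (y powr (- 1 - A)) * indicator {1<..} y \<partial>lborel)"
  proof (intro nn_integral_mono)
    fix y :: real
    show "ennreal (w y) \<le> ennreal (y powr (B - 1)) * indicator {0<..<2} y + ennreal (y powr (- 1 - A)) * indicator {1<..} y"
    proof (cases "y > 0")
      case True
      show ?thesis
      proof (cases "y < 2")
        case y2: True
        have "(1 + y) powr (- (A + B)) \<le> 1" using True A B powr_mono[of "- (A + B)" 0 "1 + y"] by simp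
        then have "w y \<le> y powr (B - 1)" using True by (simp add: w_def mult_left_le)
        then have "ennreal (w y) \<le> ennreal (y powr (B - 1)) * indicator {0<..<2} y" using True y2 by (simp add: ennreal_leI)
        then show ?thesis by (rule order_trans) simp
      next
        case False
        have "(1 + y) powr (- (A + B)) \<le> y powr (- (A + B))" using True A B by (intro powr_mono2') auto
        then have "w y \<le> y powr (B - 1) * y powr (- (A + B))" using True by (simp add: w_def mult_left_mono)
        also have "\<dots> = y powr ((B - 1) + (- (A + B)))" by (rule powr_add[symmetric])
        also have "(B - 1) + (- (A + B)) = - 1 - A" by simp
        finally show ?thesis using False by (simp add: ennreal_leI)
      qed
    qed (simp add: w_def)
  qed
  also have "\<dots> = ennreal (2 powr B / B) + ennreal (1 powr (- A) / A)"
    by (subst nn_integral_add) (auto simp: nn_integral_powr_0[OF B] nn_integral_powr_inf[OF A])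
  also have "\<dots> < \<infinity>" by simp
  finally have wint: "(\<integral>\<^sup>+y. ennreal (w y) \<partial>lborel) < \<infinity>" .
  have e: "ennreal (t powr A) * (\<integral>\<^sup>+r\<in>{0<..}. ennreal (r powr (B - 1)) * \<psi> (t + r) \<partial>lborel) = (\<integral>\<^sup>+y. ennreal (w y) * G ((1 + y) * t) \<partial>lborel)" if t: "t > 0" for t
  proof -
    have "(\<integral>\<^sup>+r\<in>{0<..}. ennreal (r powr (B - 1)) * \<psi> (t + r) \<partial>lborel) =
      ennreal \<bar>t\<bar> * (\<integral>\<^sup>+y. ennreal ((0 + t * y) powr (B - 1)) * \<psi> (t + (0 + t * y)) * indicator {0<..} (0 + t * y) \<partial>lborel)"
      using t by (intro nn_integral_real_affine) auto
    then have "ennreal (t powr A) * (\<integral>\<^sup>+r\<in>{0<..}. ennreal (r powr (B - 1)) * \<psi> (t + r) \<partial>lborel) =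
      (\<integral>\<^sup>+y. ennreal (t powr A) * (ennreal \<bar>t\<bar> * (ennreal ((0 + t * y) powr (B - 1)) * \<psi> (t + (0 + t * y)) * indicator {0<..} (0 + t * y))) \<partial>lborel)"
      by (simp only: nn_integral_cmult[symmetric] assms(4) measurable_lborel1) (subst nn_integral_cmult[symmetric]; (measurable | simp add: nn_integral_cmult))+
    also have "\<dots> = (\<integral>\<^sup>+y. ennreal (w y) * G ((1 + y) * t) \<partial>lborel)"
    proof (rule nn_integral_cong)
      fix y
      show "ennreal (t powr A) * (ennreal \<bar>t\<bar> * (ennreal ((0 + t * y) powr (B - 1)) * \<psi> (t + (0 + t * y)) * indicator {0<..} (0 + t * y))) = ennreal (w y) * G ((1 + y) * t)"
      proof (cases "y > 0")
        case True
        then have ty: "0 < t * y" using t by auto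
        have s: "t + (0 + t * y) = (1 + y) * t" by (simp add: algebra_simps)
        have "t powr A * (t * (t * y) powr (B - 1)) = w y * ((1 + y) * t) powr (A + B)"
        proof -
          have "(t * y) powr (B - 1) = t powr (B - 1) * y powr (B - 1)" using t True by (simp add: powr_mult)
          then have "t powr A * (t * (t * y) powr (B - 1)) = (t powr A * (t powr 1 * t powr (B - 1))) * y powr (B - 1)" using t by (simp add: mult_ac)
          also have "t powr A * (t powr 1 * t powr (B - 1)) = t powr (A + (1 + (B - 1)))" by (simp only: powr_add)
          also have "A + (1 + (B - 1)) = A + B" by simp
          finally have 1: "t powr A * (t * (t * y) powr (B - 1)) = t powr (A + B) * y powr (B - 1)" .
          have "(1 + y) powr (- (A + B)) * (1 + y) powr (A + B) = 1" using True unfolding powr_minus by simp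
          then have "w y * ((1 + y) * t) powr (A + B) = y powr (B - 1) * t powr (A + B)"
            using True t by (simp add: w_def powr_mult mult_ac)
          with 1 show ?thesis by simp
        qed
        then have "ennreal (t powr A) * (ennreal t * ennreal ((t * y) powr (B - 1))) = ennreal (w y) * ennreal (((1 + y) * t) powr (A + B))"
          using t w0 by (simp add: ennreal_mult[symmetric])
        then show ?thesis using ty t unfolding s G_def by (simp add: mult.assoc[symmetric])
      next
        case False
        then have "\<not> 0 < t * y" using t by (auto simp: zero_less_mult_iff)
        then show ?thesis using False by (simp add: w_def)
      qed
    qed
    finally show ?thesis .
  qed
  have m: "(\<lambda>t. ennreal (t powr A) * (\<integral>\<^sup>+r\<in>{0<..}. ennreal (r powr (B - 1)) * \<psi> (t + r) \<partial>lborel)) \<in> borel_measurable dt_over_t"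
    by (intro measurable_dt) measurable
  have "Lnorm dt_over_t q (\<lambda>t. ennreal (t powr A) * (\<integral>\<^sup>+r\<in>{0<..}. ennreal (r powr (B - 1)) * \<psi> (t + r) \<partial>lborel)) \<le> Lnorm dt_over_t q (\<lambda>t. \<integral>\<^sup>+y. ennreal (w y) * G ((1 + y) * t) \<partial>lborel)"
    by (rule Lnorm_mono[OF m _ q]) (simp add: e)
  also have "\<dots> \<le> (\<integral>\<^sup>+y. ennreal (w y) \<partial>lborel) * Lnorm dt_over_t q G"
    by (rule Lnorm_Mellin[OF _ _ _ _ w0 q]) (auto simp: w_def indicator_def split: if_splits)
  also have "\<dots> < \<infinity>" using fin wint by (simp add: G_def[abs_def] ennreal_mult_less_top)
  finally show ?thesis .
qed

section \<open>Lipschitz spaces\<close>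

text \<open>The order k and the smoothness c (which is \<alpha> / 2 for the Lipschitz space) are
  decoupled, so that the order can be raised while c stays fixed.\<close>

definition heat_norm :: "ennreal \<Rightarrow> ennreal \<Rightarrow> nat \<Rightarrow> real \<Rightarrow> (int \<Rightarrow> real) \<Rightarrow> ennreal" where
  "heat_norm p q k c f = Lnorm dt_over_t q (\<lambda>t. ennreal (t powr (real k - c)) * lp_norm p (heat t ((Lap ^^ k) f)))"

lemma lp_norm_cmult:
  assumes p: "1 \<le> p"
  shows "lp_norm p (\<lambda>n. c * u n) = ennreal \<bar>c\<bar> * lp_norm p u"
proof (cases "c = 0")
  case True
  then show ?thesis using lp_norm_cmult_le[OF p, of 0 u] by simp
next
  case False
  have "ennreal \<bar>c\<bar> * lp_norm p u \<le> ennreal \<bar>c\<bar> * (ennreal \<bar>1 / c\<bar> * lp_norm p (\<lambda>n. c * u n))"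
    using lp_norm_cmult_le[OF p, of "1 / c" "\<lambda>n. c * u n"] False by (intro mult_left_mono) auto
  also have "\<dots> = lp_norm p (\<lambda>n. c * u n)"
    using False by (simp add: mult.assoc[symmetric] ennreal_mult[symmetric])
  finally show ?thesis using lp_norm_cmult_le[OF p, of c u] by (intro antisym)
qed

text \<open>Replacing the time derivative by \<Delta>^k under the flow requires f in
  \<open>expb\<close>; the weighted condition supplies this in both directions.\<close>

lemma Lambda_H_iff:
  assumes p: "1 \<le> p" and q: "1 \<le> q" and a: "\<alpha> > 0"
  shows "f \<in> Lambda_H \<alpha> p q \<longleftrightarrow> wnorm \<alpha> q f < \<infinity> \<and> heat_norm p q (nat \<lfloor>\<alpha> / 2\<rfloor> + 1) (\<alpha> / 2) f < \<infinity>"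
proof -
  have "mixed_norm p q (\<lambda>t n. t powr (real (nat \<lfloor>\<alpha> / 2\<rfloor> + 1) - \<alpha> / 2) * heat_deriv (nat \<lfloor>\<alpha> / 2\<rfloor> + 1) t f n) = heat_norm p q (nat \<lfloor>\<alpha> / 2\<rfloor> + 1) (\<alpha> / 2) f"
    if "f \<in> expb"
    using p that by (simp add: mixed_norm_def heat_norm_def heat_deriv_eq lp_norm_cmult)
  then show ?thesis
    using wnorm_expb[OF q a, of f] by (auto simp: Lambda_H_def weighted_lq_iff[OF q a] Let_def)
qed

lemma Lap_pow_cmult: "(Lap ^^ k) (\<lambda>n. c * f n) = (\<lambda>n. c * (Lap ^^ k) f n)"
  by (induction k) (auto simp: discrete_laplacian_def fun_eq_iff algebra_simps)

lemma Lambda_H_cmult: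
  assumes p: "1 \<le> p" and q: "1 \<le> q" and a: "\<alpha> > 0" and f: "f \<in> Lambda_H \<alpha> p q"
  shows "(\<lambda>n. c * f n) \<in> Lambda_H \<alpha> p q"
proof -
  define k where "k = nat \<lfloor>\<alpha> / 2\<rfloor> + 1"
  have w: "wnorm \<alpha> q f < \<infinity>" and h: "heat_norm p q k (\<alpha> / 2) f < \<infinity>" using f by (auto simp: Lambda_H_iff[OF p q a] k_def)
  have fe: "f \<in> expb" by (rule wnorm_expb[OF q a w])
  have "wnorm \<alpha> q (\<lambda>n. c * f n) < \<infinity>"
    unfolding wnorm_def by (rule Lnorm_wmeasure_le[OF _ _ w[unfolded wnorm_def] q, of _ "\<bar>c\<bar>"])
      (auto simp: abs_mult ennreal_mult[symmetric] mult.assoc)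
  moreover have "heat_norm p q k (\<alpha> / 2) (\<lambda>n. c * f n) \<le> ennreal \<bar>c\<bar> * heat_norm p q k (\<alpha> / 2) f"
  proof -
    note [measurable] = lp_norm_heat_measurable[OF p expb_Lap_pow[OF fe, of k]]
    have "heat t ((Lap ^^ k) (\<lambda>n. c * f n)) = (\<lambda>n. c * heat t ((Lap ^^ k) f) n)" for t
      unfolding Lap_pow_cmult using heat_cmult[OF expb_Lap_pow[OF fe]] by auto
    then have "heat_norm p q k (\<alpha> / 2) (\<lambda>n. c * f n) = Lnorm dt_over_t q (\<lambda>t. ennreal \<bar>c\<bar> * (ennreal (t powr (real k - \<alpha> / 2)) * lp_norm p (heat t ((Lap ^^ k) f))))"
      unfolding heat_norm_def by (simp add: lp_norm_cmult[OF p] mult.left_commute)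
    also have "\<dots> \<le> ennreal \<bar>c\<bar> * heat_norm p q k (\<alpha> / 2) f"
      unfolding heat_norm_def by (intro Lnorm_cmult_le q measurable_dt) measurable
    finally show ?thesis .
  qed
  then have "heat_norm p q k (\<alpha> / 2) (\<lambda>n. c * f n) < \<infinity>"
    using h by (auto simp: ennreal_mult_less_top elim: le_less_trans)
  ultimately show ?thesis by (simp add: Lambda_H_iff[OF p q a] k_def)
qed

text \<open>Half of the time is spent on the additional Laplacian at cost 2C / t, which matches the
  extra power of t. What is left is the same seminorm at t / 2, bounded by dilation
  invariance.\<close>

lemma heat_norm_Suc:
  assumes p: "1 \<le> p" and q: "1 \<le> q" and f: "f \<in> expb" and fin: "heat_norm p q k c f < \<infinity>"
  shows "heat_norm p q (Suc k) c f < \<infinity>"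
proof -
  obtain C where C: "C \<ge> 0" and S: "\<And>t f. t > 0 \<Longrightarrow> f \<in> expb \<Longrightarrow> lp_norm p (heat t (Lap f)) \<le> ennreal (C / t) * lp_norm p f"
    using lp_norm_heat_Lap[OF p] by blast
  define w where "w = (Lap ^^ k) f"
  have w: "w \<in> expb" unfolding w_def by (rule expb_Lap_pow[OF f])
  note [measurable] = lp_norm_heat_measurable[OF p w] lp_norm_heat_measurable[OF p expb_Lap[OF w]]
  define G where "G t = ennreal (t powr (real k - c)) * lp_norm p (heat t w)" for t
  have [measurable]: "G \<in> borel_measurable borel" unfolding G_def by measurable
  define D where "D = 2 * C * 2 powr (real k - c)"
  have D: "D \<ge> 0" using C by (simp add: D_def)
  have le: "ennreal (t powr (real (Suc k) - c)) * lp_norm p (heat t (Lap w)) \<le> ennreal D * G (1/2 * t)" if t: "t > 0" for t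
  proof -
    have h: "heat t (Lap w) = heat (t / 2) (Lap (heat (t / 2) w))"
      using w by (simp add: Lap_heat heat_heat expb_Lap)
    have "lp_norm p (heat t (Lap w)) \<le> ennreal (C / (t / 2)) * lp_norm p (heat (t / 2) w)"
      unfolding h using t by (intro S expb_heat w) auto
    then have "ennreal (t powr (real (Suc k) - c)) * lp_norm p (heat t (Lap w)) \<le> ennreal (t powr (real (Suc k) - c)) * (ennreal (C / (t / 2)) * lp_norm p (heat (t / 2) w))"
      by (intro mult_left_mono) auto
    also have "\<dots> = ennreal (t powr (real (Suc k) - c) * (C / (t / 2))) * lp_norm p (heat (t / 2) w)"
      using C t by (subst ennreal_mult) (auto simp: mult.assoc)
    also have "t powr (real (Suc k) - c) * (C / (t / 2)) = D * (1/2 * t) powr (real k - c)"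
    proof -
      have "real (Suc k) - c = 1 + (real k - c)" by simp
      then have "t powr (real (Suc k) - c) = t * t powr (real k - c)" using t by (simp only: powr_add) simp
      moreover have "2 powr (real k - c) * (1/2 * t) powr (real k - c) = t powr (real k - c)"
        using t by (subst powr_mult[symmetric]) auto
      ultimately show ?thesis using t by (simp add: D_def)
    qed
    also have "ennreal (D * (1/2 * t) powr (real k - c)) = ennreal D * ennreal ((1/2 * t) powr (real k - c))"
      using D by (intro ennreal_mult) auto
    finally show ?thesis by (simp add: G_def mult.assoc)
  qed
  have "heat_norm p q (Suc k) c f \<le> Lnorm dt_over_t q (\<lambda>t. ennreal D * G (1/2 * t))"
    unfolding heat_norm_def using le
    by (intro Lnorm_mono q measurable_dt) (auto simp: w_def[symmetric])
  also have "\<dots> \<le> ennreal D * Lnorm dt_over_t q (\<lambda>t. G (1/2 * t))"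
    by (intro Lnorm_cmult_le q D measurable_dt) measurable
  also have "\<dots> \<le> ennreal D * Lnorm dt_over_t q G"
    by (intro mult_left_mono Lnorm_dt_scale q) auto
  also have "\<dots> < \<infinity>" using fin by (simp add: heat_norm_def G_def[abs_def] w_def ennreal_mult_less_top)
  finally show ?thesis .
qed

lemma heat_norm_add:
  "1 \<le> p \<Longrightarrow> 1 \<le> q \<Longrightarrow> f \<in> expb \<Longrightarrow> heat_norm p q k c f < \<infinity> \<Longrightarrow> heat_norm p q (k + j) c f < \<infinity>"
  by (induction j) (auto intro: heat_norm_Suc[unfolded infinity_ennreal_def])

lemma heat_norm_sup:
  assumes p: "1 \<le> p" and q: "1 \<le> q" and f: "f \<in> expb" and fin: "heat_norm p q k c f < \<infinity>"
  shows "heat_norm \<infinity> q k c f < \<infinity>"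
proof -
  note [measurable] = lp_norm_heat_measurable[of \<infinity>, OF _ expb_Lap_pow[OF f, of k], simplified]
  have "lp_norm \<infinity> u \<le> lp_norm p u" for u
    unfolding lp_norm_infinity by (intro SUP_least abs_le_lp_norm p)
  then have "heat_norm \<infinity> q k c f \<le> heat_norm p q k c f"
    unfolding heat_norm_def by (intro Lnorm_mono q measurable_dt mult_left_mono) (auto, measurable)
  then show ?thesis using fin by (rule le_less_trans)
qed

text \<open>The tail operator is applied with A = m - (c - \<beta>) and B = Suc l - \<beta>. Both
  are positive, and A + B = Suc l + m - c is exactly the exponent in the seminorm of f of order Suc
  l + m.\<close>

lemma heat_norm_frac_op:
  assumes p: "1 \<le> p" and q: "1 \<le> q" and b: "0 < \<beta>" "\<beta> < real (Suc l)" and g: "frac_good (Suc l) \<beta> f"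
    and m: "real m > c - \<beta>" and fin: "heat_norm p q (Suc l + m) c f < \<infinity>"
  shows "heat_norm p q m (c - \<beta>) (frac_op (Suc l) \<beta> f) < \<infinity>"
proof -
  have f: "f \<in> expb" using g by (simp add: frac_good_def)
  obtain C where C: "C \<ge> 0" and *: "\<And>g t. frac_good (Suc l) \<beta> g \<Longrightarrow> t \<ge> 0 \<Longrightarrow> lp_norm p (heat t (frac_op (Suc l) \<beta> g)) \<le>
    ennreal C * (\<integral>\<^sup>+r\<in>{0<..}. ennreal (r powr (real (Suc l) - \<beta> - 1)) * lp_norm p (heat (t + r) ((Lap ^^ Suc l) g)) \<partial>lborel)"
    using lp_norm_heat_frac_op[OF p b(1), of l] by blast
  define \<psi> where "\<psi> t = lp_norm p (heat t ((Lap ^^ (Suc l + m)) f))" for t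
  have [measurable]: "\<psi> \<in> borel_measurable borel"
    unfolding \<psi>_def by (rule lp_norm_heat_measurable[OF p expb_Lap_pow[OF f]])
  define A where "A = real m - (c - \<beta>)"
  define B where "B = real (Suc l) - \<beta>"
  have AB: "A > 0" "B > 0" "A + B = real (Suc l + m) - c" using m b by (auto simp: A_def B_def)
  define H where "H t = ennreal (t powr A) * (\<integral>\<^sup>+r\<in>{0<..}. ennreal (r powr (B - 1)) * \<psi> (t + r) \<partial>lborel)" for t
  have [measurable]: "H \<in> borel_measurable borel" unfolding H_def by measurable
  have Hfin: "Lnorm dt_over_t q H < \<infinity>"
    unfolding H_def
  proof (rule Lnorm_dt_tail[OF q AB(1,2)])
    show "Lnorm dt_over_t q (\<lambda>t. ennreal (t powr (A + B)) * \<psi> t) < \<infinity>"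
      using fin unfolding heat_norm_def \<psi>_def AB(3) .
  qed measurable
  have good: "frac_good (Suc l) \<beta> ((Lap ^^ m) f)" by (rule Lap_pow_frac_op[OF g])
  have le: "ennreal (t powr A) * lp_norm p (heat t ((Lap ^^ m) (frac_op (Suc l) \<beta> f))) \<le> ennreal C * H t" if t: "t > 0" for t
  proof -
    have "lp_norm p (heat t (frac_op (Suc l) \<beta> ((Lap ^^ m) f))) \<le> ennreal C * (\<integral>\<^sup>+r\<in>{0<..}. ennreal (r powr (B - 1)) * \<psi> (t + r) \<partial>lborel)"
      using *[OF good, of t] t unfolding B_def \<psi>_def by (simp only: funpow_add o_def less_imp_le)
    then have "ennreal (t powr A) * lp_norm p (heat t ((Lap ^^ m) (frac_op (Suc l) \<beta> f))) \<le> ennreal (t powr A) * (ennreal C * (\<integral>\<^sup>+r\<in>{0<..}. ennreal (r powr (B - 1)) * \<psi> (t + r) \<partial>lborel))"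
      unfolding Lap_pow_frac_op(1)[OF g] by (intro mult_left_mono) auto
    then show ?thesis unfolding H_def by (simp only: mult_ac)
  qed
  note [measurable] = lp_norm_heat_measurable[OF p expb_Lap_pow[OF frac_op_expb[OF g], of m]]
  have "heat_norm p q m (c - \<beta>) (frac_op (Suc l) \<beta> f) \<le> Lnorm dt_over_t q (\<lambda>t. ennreal C * H t)"
    unfolding heat_norm_def A_def[symmetric] using le
    by (intro Lnorm_mono q measurable_dt) auto
  also have "\<dots> \<le> ennreal C * Lnorm dt_over_t q H" by (intro Lnorm_cmult_le q C measurable_dt) measurable
  also have "\<dots> < \<infinity>" using Hfin by (simp add: ennreal_mult_less_top)
  finally show ?thesis .
qed

lemma Lnorm_Hardy_heat:
  assumes q: "1 \<le> q" and f: "f \<in> expb" and b: "\<beta> < \<alpha> / 2" and fin: "heat_norm \<infinity> q k (\<alpha> / 2) f < \<infinity>"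
  shows "Lnorm wmeasure q (\<lambda>n. ennreal ((1 + iabs n) powr (- (\<alpha> - 2 * \<beta>))) *
     (\<integral>\<^sup>+r\<in>{0<..<(1 + iabs n)\<^sup>2}. ennreal (r powr (real k - 1 - \<beta>)) * lp_norm \<infinity> (heat r ((Lap ^^ k) f)) \<partial>lborel)) < \<infinity>"
proof -
  \<comment> \<open>The Hardy exponent: half of the smoothness \<alpha> - 2 \<beta> that remains,
    positive because \<beta> < \<alpha> / 2.\<close>
  define A where "A = \<alpha> / 2 - \<beta>"
  have e: "2 * A = \<alpha> - 2 * \<beta>" "A + (real k - \<alpha> / 2) - 1 = real k - 1 - \<beta>" by (auto simp: A_def)
  have "A > 0" using b by (simp add: A_def)
  have m: "(\<lambda>t. lp_norm \<infinity> (heat t ((Lap ^^ k) f))) \<in> borel_measurable borel"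
    by (rule lp_norm_heat_measurable[OF _ expb_Lap_pow[OF f]]) simp
  from Lnorm_wmeasure_Hardy[OF q \<open>A > 0\<close> m fin[unfolded heat_norm_def]] show ?thesis unfolding e .
qed

lemma powr_mult_spread:
  "ennreal ((1 + iabs n) powr (- (\<alpha> - 2 * \<beta>))) * (ennreal ((1 + iabs n) powr (M - 1 - 2 * \<beta>)) * X) =
   ennreal ((1 + iabs n) powr (M - 1 - \<alpha>)) * X"
proof -
  have "(1 + iabs n) powr (- (\<alpha> - 2 * \<beta>)) * (1 + iabs n) powr (M - 1 - 2 * \<beta>) = (1 + iabs n) powr (- (\<alpha> - 2 * \<beta>) + (M - 1 - 2 * \<beta>))"
    by (rule powr_add[symmetric])
  also have "- (\<alpha> - 2 * \<beta>) + (M - 1 - 2 * \<beta>) = M - 1 - \<alpha>" by simp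
  finally show ?thesis by (simp add: ennreal_mult[symmetric] flip: mult.assoc)
qed

text \<open>Cutting the integral at (1 + |n|)^2 leaves four weighted terms: \<open>h1\<close> is the
  Schur term, \<open>h2\<close> the Hardy term, \<open>h3\<close> the weighted size of f itself, and
  a pure negative power of 1 + |n| multiplied by the \<open>ell\<close> sum.\<close>

lemma wnorm_frac_op:
  assumes q: "1 \<le> q" and ab: "0 < \<beta>" "\<beta> < \<alpha> / 2" "\<beta> < real (Suc l)" and w: "wnorm \<alpha> q f < \<infinity>" and e: "f \<in> ell \<beta>"
    and fin: "heat_norm \<infinity> q (Suc l + Suc m) (\<alpha> / 2) f < \<infinity>"
  shows "wnorm (\<alpha> - 2 * \<beta>) q (frac_op (Suc l) \<beta> f) < \<infinity>"
proof -
  have a: "\<alpha> > 0" using ab by simp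
  have f: "f \<in> expb" by (rule wnorm_expb[OF q a w])
  have g: "frac_good (Suc l) \<beta> f" by (rule frac_good_ell[OF f e ab(1,3)])
  obtain M where M: "M > 0" and spr: "Lnorm wmeasure q (\<lambda>n. ennreal ((1 + iabs n) powr (M - 1 - \<alpha>)) * spread M f n) < \<infinity>"
    using Lnorm_spread[OF q a w] by blast
  let ?y = "\<lambda>n. 1 + iabs n"
  define R where "R n = (\<integral>\<^sup>+r\<in>{0<..<(?y n)\<^sup>2}. ennreal (r powr (real (Suc l + Suc m) - 1 - \<beta>)) * lp_norm \<infinity> (heat r ((Lap ^^ (Suc l + Suc m)) f)) \<partial>lborel)" for n
  obtain C1 where C1: "C1 \<ge> 0" and near: "\<And>n. frac_int {0<..<(?y n)\<^sup>2} (Suc l) \<beta> f n \<le>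
    ennreal C1 * (ennreal (?y n powr (M - 1 - 2 * \<beta>)) * spread M f n + R n)"
    using frac_int_near[OF M ab(1,3), of m] f unfolding R_def by blast
  obtain C2 where C2: "C2 \<ge> 0" and far: "\<And>n T. T \<ge> 1 \<Longrightarrow> frac_int {T..} (Suc l) \<beta> f n \<le>
    ennreal C2 * (ennreal (T powr (- \<beta>)) * ennreal \<bar>f n\<bar> +
      (\<integral>\<^sup>+j. ennreal ((sqrt T + iabs (n - j)) powr (- 1 - 2 * \<beta>) * \<bar>f j\<bar>) \<partial>count_space UNIV))"
    using frac_int_far[OF ab(1), of "Suc l"] f by blast
  define S where "S = (\<integral>\<^sup>+j. ennreal ((1 + iabs j) powr (- 1 - 2 * \<beta>) * \<bar>f j\<bar>) \<partial>count_space UNIV)"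
  have "S < \<infinity>" unfolding S_def by (rule ell_nn_integral[OF e])
  then obtain s where s: "S = ennreal s" "s \<ge> 0" by (cases S) auto
  let ?g = "\<lambda>n. ennreal (?y n powr (- (\<alpha> - 2 * \<beta>)))"
  define h1 where "h1 n = ennreal (?y n powr (M - 1 - \<alpha>)) * spread M f n" for n
  define h2 where "h2 n = ?g n * R n" for n
  define h3 where "h3 n = ennreal (\<bar>f n\<bar> * ?y n powr (- \<alpha>))" for n
  define C where "C = max (max C1 C2) (C2 * s)"
  have Cge: "C1 \<le> C" "C2 \<le> C" "C2 * s \<le> C" "C \<ge> 0" using C1 by (auto simp: C_def)
  have le: "ennreal (\<bar>frac_op (Suc l) \<beta> f n\<bar> * ?y n powr (- (\<alpha> - 2 * \<beta>))) \<le> ennreal C * ((h1 n + h2 n) + (h3 n + ?g n))" for n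
  proof -
    define T where "T = (?y n)\<^sup>2"
    have T1: "T \<ge> 1" unfolding T_def by (rule one_le_power) simp
    have sT: "sqrt T = ?y n" unfolding T_def by simp
    have Tb: "T powr (- \<beta>) = ?y n powr (- (2 * \<beta>))"
    proof -
      have "T = ?y n powr 2" by (simp add: T_def)
      then have "T powr (- \<beta>) = (?y n powr 2) powr (- \<beta>)" by (rule arg_cong)
      then show ?thesis unfolding powr_powr by simp
    qed
    have "(\<integral>\<^sup>+j. ennreal ((sqrt T + iabs (n - j)) powr (- 1 - 2 * \<beta>) * \<bar>f j\<bar>) \<partial>count_space UNIV) \<le> ennreal s"
      unfolding s(1)[symmetric] S_def
    proof (intro nn_integral_mono ennreal_leI mult_right_mono)
      fix j
      \<comment> \<open>Since sqrt T = 1 + |n|, the triangle inequality bounds the far sum by the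
        \<open>ell\<close> sum uniformly in n.\<close>
      have "1 + iabs j \<le> sqrt T + iabs (n - j)" unfolding sT of_int_diff by argo
      then show "(sqrt T + iabs (n - j)) powr (- 1 - 2 * \<beta>) \<le> (1 + iabs j) powr (- 1 - 2 * \<beta>)"
        using ab by (intro powr_mono2') auto
    qed auto
    then have far': "frac_int {T..} (Suc l) \<beta> f n \<le> ennreal C2 * (ennreal (?y n powr (- (2 * \<beta>))) * ennreal \<bar>f n\<bar> + ennreal s)"
      unfolding Tb[symmetric] by (intro order_trans[OF far[OF T1]] mult_left_mono add_left_mono) auto
    have "ennreal \<bar>frac_op (Suc l) \<beta> f n\<bar> \<le> frac_int {0<..<T} (Suc l) \<beta> f n + frac_int {T..} (Suc l) \<beta> f n"
      using order_trans[OF frac_op_le[OF g] frac_int_split[OF f, of T]] T1 by simp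
    also have "\<dots> \<le> ennreal C1 * (ennreal (?y n powr (M - 1 - 2 * \<beta>)) * spread M f n + R n) + ennreal C2 * (ennreal (?y n powr (- (2 * \<beta>))) * ennreal \<bar>f n\<bar> + ennreal s)"
      using near[of n] far' unfolding T_def by (rule add_mono)
    finally have "?g n * ennreal \<bar>frac_op (Suc l) \<beta> f n\<bar> \<le> ?g n * (ennreal C1 * (ennreal (?y n powr (M - 1 - 2 * \<beta>)) * spread M f n + R n) + ennreal C2 * (ennreal (?y n powr (- (2 * \<beta>))) * ennreal \<bar>f n\<bar> + ennreal s))"
      by (intro mult_left_mono) auto
    also have "\<dots> = ennreal C1 * (?g n * (ennreal (?y n powr (M - 1 - 2 * \<beta>)) * spread M f n) + ?g n * R n) + (ennreal C2 * (?g n * ennreal (?y n powr (- (2 * \<beta>))) * ennreal \<bar>f n\<bar>) + ennreal C2 * ennreal s * ?g n)"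
      by (simp only: distrib_left mult_ac)
    also have "?g n * (ennreal (?y n powr (M - 1 - 2 * \<beta>)) * spread M f n) = h1 n"
      unfolding h1_def by (rule powr_mult_spread)
    also have "?g n * ennreal (?y n powr (- (2 * \<beta>))) * ennreal \<bar>f n\<bar> = h3 n"
    proof -
      have "?y n powr (- (\<alpha> - 2 * \<beta>)) * ?y n powr (- (2 * \<beta>)) = ?y n powr (- (\<alpha> - 2 * \<beta>) + - (2 * \<beta>))" by (rule powr_add[symmetric])
      also have "- (\<alpha> - 2 * \<beta>) + - (2 * \<beta>) = - \<alpha>" by simp
      finally show ?thesis unfolding h3_def by (simp add: ennreal_mult[symmetric] mult.commute)
    qed
    also have "ennreal C2 * ennreal s = ennreal (C2 * s)" using C2 s by (simp add: ennreal_mult)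
    also have "?g n * R n = h2 n" by (simp only: h2_def)
    also have "ennreal C1 * (h1 n + h2 n) + (ennreal C2 * h3 n + ennreal (C2 * s) * ?g n) \<le> ennreal C * (h1 n + h2 n) + (ennreal C * h3 n + ennreal C * ?g n)"
      using Cge by (intro add_mono mult_right_mono ennreal_leI) auto
    also have "\<dots> = ennreal C * ((h1 n + h2 n) + (h3 n + ?g n))" by (simp only: distrib_left)
    finally show ?thesis by (simp add: ennreal_mult mult.commute)
  qed
  show ?thesis unfolding wnorm_def
  proof (rule Lnorm_wmeasure_le[OF le Cge(4) _ q])
    show "Lnorm wmeasure q (\<lambda>n. (h1 n + h2 n) + (h3 n + ?g n)) < \<infinity>"
    proof (intro Lnorm_add_finite measurable_wmeasure q)
      show "Lnorm wmeasure q h1 < \<infinity>" unfolding h1_def by (rule spr)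
      show "Lnorm wmeasure q h2 < \<infinity>" unfolding h2_def R_def by (rule Lnorm_Hardy_heat[OF q f ab(2) fin])
      show "Lnorm wmeasure q h3 < \<infinity>" using w unfolding h3_def wnorm_def .
      show "Lnorm wmeasure q ?g < \<infinity>" using ab by (intro Lnorm_wmeasure_powr q) simp
    qed
  qed
qed

text \<open>The same decomposition for v = \<Delta>^m f, with no integral over \<tau>. Of the k = m
  + Suc j differences, Suc j become Laplacians and complete \<Delta>^m to \<Delta>^k; the other m
  cost a factor 2 each in the sup norm. The power of r is then j = k - 1 - m, as Hardy's inequality
  expects.\<close>

lemma wnorm_Lap_pow:
  assumes q: "1 \<le> q" and ab: "real m < \<alpha> / 2" and w: "wnorm \<alpha> q f < \<infinity>"
    and fin: "heat_norm \<infinity> q (m + Suc j) (\<alpha> / 2) f < \<infinity>"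
  shows "wnorm (\<alpha> - 2 * real m) q ((Lap ^^ m) f) < \<infinity>"
proof -
  have a: "\<alpha> > 0" using ab by (smt (verit) of_nat_0_le_iff field_sum_of_halves)
  have f: "f \<in> expb" by (rule wnorm_expb[OF q a w])
  define k where "k = m + Suc j"
  obtain M where M: "M > 0" and spr: "Lnorm wmeasure q (\<lambda>n. ennreal ((1 + iabs n) powr (M - 1 - \<alpha>)) * spread M f n) < \<infinity>"
    using Lnorm_spread[OF q a w] by blast
  let ?y = "\<lambda>n. 1 + iabs n"
  define v where "v = (Lap ^^ m) f"
  have v: "v \<in> expb" unfolding v_def by (rule expb_Lap_pow[OF f])
  define R where "R n = (\<integral>\<^sup>+r\<in>{0<..<(?y n)\<^sup>2}. ennreal (r powr (real k - 1 - real m)) * lp_norm \<infinity> (heat r ((Lap ^^ k) f)) \<partial>lborel)" for n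
  obtain c where c: "\<And>i. c i \<ge> 0" and dec: "\<And>T f n. f \<in> expb \<Longrightarrow> \<bar>f n\<bar> \<le> \<bar>(hdiff T ^^ k) f n\<bar> + (\<Sum>i=1..k. c i * \<bar>heat (real i * T) f n\<bar>)"
    using abs_le_hdiff_pow[of k] by blast
  obtain C1 where C1: "C1 \<ge> 0" and hd: "\<And>f \<tau>. f \<in> expb \<Longrightarrow> \<tau> \<ge> 0 \<Longrightarrow> lp_norm \<infinity> ((hdiff \<tau> ^^ Suc j) f)
     \<le> ennreal C1 * (\<integral>\<^sup>+r\<in>{0<..<\<tau>}. ennreal (r powr real j) * lp_norm \<infinity> (heat r ((Lap ^^ Suc j) f)) \<partial>lborel)"
    using lp_norm_hdiff_pow[of \<infinity> j] by auto
  obtain C2 where C2: "C2 \<ge> 0" and sp: "\<And>n t. (?y n)\<^sup>2 \<le> t \<Longrightarrow> t \<le> real k * (?y n)\<^sup>2 \<Longrightarrow>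
    ennreal \<bar>heat t ((Lap ^^ m) f) n\<bar> \<le> ennreal (C2 * ?y n powr (M - 1 - 2 * real m)) * spread M f n"
    using heat_Lap_spread[OF M, of "real k" m] f unfolding k_def by auto
  define S where "S = (\<Sum>i=1..k. c i)"
  have S: "S \<ge> 0" unfolding S_def by (intro sum_nonneg c)
  let ?g = "\<lambda>n. ennreal (?y n powr (- (\<alpha> - 2 * real m)))"
  define h1 where "h1 n = ennreal (?y n powr (M - 1 - \<alpha>)) * spread M f n" for n
  define h2 where "h2 n = ?g n * R n" for n
  define C where "C = 2 ^ m * C1 + S * C2"
  have C: "C \<ge> 0" "2 ^ m * C1 \<le> C" "S * C2 \<le> C" using C1 C2 S by (auto simp: C_def)
  have le: "ennreal (\<bar>v n\<bar> * ?y n powr (- (\<alpha> - 2 * real m))) \<le> ennreal C * (h1 n + h2 n)" for n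
  proof -
    define T where "T = (?y n)\<^sup>2"
    have T: "T \<ge> 0" by (simp add: T_def)
    have rem: "ennreal \<bar>(hdiff T ^^ k) v n\<bar> \<le> ennreal (2 ^ m * C1) * R n"
    proof -
      have "ennreal \<bar>(hdiff T ^^ k) v n\<bar> \<le> lp_norm \<infinity> ((hdiff T ^^ m) ((hdiff T ^^ Suc j) v))"
        unfolding k_def funpow_add o_def by (rule abs_le_lp_norm) simp
      also have "\<dots> \<le> 2 ^ m * lp_norm \<infinity> ((hdiff T ^^ Suc j) v)" by (intro sup_norm_hdiff_pow expb_hdiff_pow v T)
      also have "\<dots> \<le> 2 ^ m * (ennreal C1 * (\<integral>\<^sup>+r\<in>{0<..<T}. ennreal (r powr real j) * lp_norm \<infinity> (heat r ((Lap ^^ Suc j) v)) \<partial>lborel))"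
        by (intro mult_left_mono hd v T) auto
      also have "(Lap ^^ Suc j) v = (Lap ^^ k) f"
        unfolding v_def k_def add.commute[of m] funpow_add o_def ..
      also have "(\<integral>\<^sup>+r\<in>{0<..<T}. ennreal (r powr real j) * lp_norm \<infinity> (heat r ((Lap ^^ k) f)) \<partial>lborel) = R n"
        unfolding R_def T_def k_def by simp
      also have "2 ^ m * (ennreal C1 * R n) = ennreal (2 ^ m * C1) * R n"
        using C1 by (simp add: ennreal_mult mult.assoc ennreal_power[symmetric])
      finally show ?thesis .
    qed
    have main: "ennreal \<bar>heat (real i * T) v n\<bar> \<le> ennreal (C2 * ?y n powr (M - 1 - 2 * real m)) * spread M f n" if i: "i \<in> {1..k}" for i
    proof -
      have "1 * T \<le> real i * T" using i T by (intro mult_right_mono) auto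
      moreover have "real i * T \<le> real k * T" using i T by (intro mult_right_mono) auto
      ultimately show ?thesis unfolding v_def by (intro sp) (auto simp: T_def)
    qed
    have "ennreal \<bar>v n\<bar> \<le> ennreal (\<bar>(hdiff T ^^ k) v n\<bar> + (\<Sum>i=1..k. c i * \<bar>heat (real i * T) v n\<bar>))"
      by (intro ennreal_leI dec v)
    also have "\<dots> = ennreal \<bar>(hdiff T ^^ k) v n\<bar> + (\<Sum>i=1..k. ennreal (c i) * ennreal \<bar>heat (real i * T) v n\<bar>)"
      using c by (subst ennreal_plus) (auto intro!: sum_nonneg simp: sum_ennreal[symmetric] ennreal_mult)
    also have "\<dots> \<le> ennreal (2 ^ m * C1) * R n + (\<Sum>i=1..k. ennreal (c i) * (ennreal (C2 * ?y n powr (M - 1 - 2 * real m)) * spread M f n))"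
      by (intro add_mono rem sum_mono mult_left_mono main) auto
    also have "(\<Sum>i=1..k. ennreal (c i) * (ennreal (C2 * ?y n powr (M - 1 - 2 * real m)) * spread M f n)) = ennreal S * (ennreal (C2 * ?y n powr (M - 1 - 2 * real m)) * spread M f n)"
      unfolding S_def sum_distrib_right[symmetric] using c by (simp add: sum_ennreal)
    also have "\<dots> = ennreal (S * C2) * (ennreal (?y n powr (M - 1 - 2 * real m)) * spread M f n)"
      using S C2 by (simp add: ennreal_mult mult.assoc)
    finally have "?g n * ennreal \<bar>v n\<bar> \<le> ?g n * (ennreal (2 ^ m * C1) * R n + ennreal (S * C2) * (ennreal (?y n powr (M - 1 - 2 * real m)) * spread M f n))"
      by (intro mult_left_mono) auto
    also have "\<dots> = ennreal (2 ^ m * C1) * (?g n * R n) + ennreal (S * C2) * (?g n * (ennreal (?y n powr (M - 1 - 2 * real m)) * spread M f n))"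
      by (simp only: distrib_left mult_ac)
    also have "?g n * (ennreal (?y n powr (M - 1 - 2 * real m)) * spread M f n) = h1 n"
      unfolding h1_def by (rule powr_mult_spread)
    also have "?g n * R n = h2 n" by (simp only: h2_def)
    also have "ennreal (2 ^ m * C1) * h2 n + ennreal (S * C2) * h1 n \<le> ennreal C * h2 n + ennreal C * h1 n"
      using C by (intro add_mono mult_right_mono ennreal_leI) auto
    also have "\<dots> = ennreal C * (h1 n + h2 n)" by (simp only: distrib_left add.commute)
    finally show ?thesis by (simp add: ennreal_mult mult.commute)
  qed
  show ?thesis unfolding wnorm_def v_def[symmetric]
  proof (rule Lnorm_wmeasure_le[OF le C(1) _ q])
    show "Lnorm wmeasure q (\<lambda>n. h1 n + h2 n) < \<infinity>"
    proof (intro Lnorm_add_finite measurable_wmeasure q)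
      show "Lnorm wmeasure q h1 < \<infinity>" unfolding h1_def by (rule spr)
      show "Lnorm wmeasure q h2 < \<infinity>" unfolding h2_def R_def by (rule Lnorm_Hardy_heat[OF q f ab fin[folded k_def]])
    qed
  qed
qed

section \<open>Membership of the fractional and of the integer powers\<close>

lemma frac_laplacian_in_Lambda_H:
  assumes p: "1 \<le> p" and q: "1 \<le> q" and ab: "0 < \<beta>" "2 * \<beta> < \<alpha>" and f: "f \<in> Lambda_H \<alpha> p q" "f \<in> ell \<beta>"
  shows "frac_laplacian \<beta> f \<in> Lambda_H (\<alpha> - 2 * \<beta>) p q"
proof -
  have a: "\<alpha> > 0" "\<alpha> - 2 * \<beta> > 0" using ab by auto
  define l where "l = nat \<lfloor>\<beta>\<rfloor>"
  define k where "k = nat \<lfloor>\<alpha> / 2\<rfloor> + 1"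
  define m where "m = nat \<lfloor>(\<alpha> - 2 * \<beta>) / 2\<rfloor> + 1"
  have w: "wnorm \<alpha> q f < \<infinity>" and h: "heat_norm p q k (\<alpha> / 2) f < \<infinity>"
    using f by (auto simp: Lambda_H_iff[OF p q a(1)] k_def)
  have fe: "f \<in> expb" by (rule wnorm_expb[OF q a(1) w])
  have bl: "\<beta> < real (Suc l)" unfolding l_def using ab(1) by linarith
  have e: "(\<alpha> - 2 * \<beta>) / 2 = \<alpha> / 2 - \<beta>" by simp
  then have mk: "real m > \<alpha> / 2 - \<beta>" unfolding m_def using a(2) by linarith
  have "\<alpha> / 2 < real (Suc l + m)" using bl mk by simp
  \<comment> \<open>k is the least natural number above \<alpha> / 2, while Suc l + m lies above
    \<alpha> / 2 as a sum of numbers above \<beta> and \<alpha> / 2 - \<beta>. A surplus is bridged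
    by raising the order of the seminorm.\<close>
  then have "k \<le> Suc l + m" unfolding k_def using a(1) by linarith
  then obtain i where i: "Suc l + m = k + i" using le_Suc_ex by blast
  have h1: "heat_norm p q (Suc l + m) (\<alpha> / 2) f < \<infinity>" unfolding i by (rule heat_norm_add[OF p q fe h])
  have m1: "m \<ge> 1" by (simp add: m_def)
  then obtain m' where m': "m = Suc m'" by (cases m) auto
  have g: "frac_good (Suc l) \<beta> f" by (rule frac_good_ell[OF fe f(2) ab(1) bl])
  have "wnorm (\<alpha> - 2 * \<beta>) q (frac_op (Suc l) \<beta> f) < \<infinity>"
    using heat_norm_sup[OF p q fe h1] unfolding m' by (intro wnorm_frac_op q ab(1) bl w f(2)) (use ab in auto)
  moreover have "heat_norm p q m (\<alpha> / 2 - \<beta>) (frac_op (Suc l) \<beta> f) < \<infinity>"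
    by (rule heat_norm_frac_op[OF p q ab(1) bl g mk h1])
  ultimately have "frac_op (Suc l) \<beta> f \<in> Lambda_H (\<alpha> - 2 * \<beta>) p q"
    unfolding Lambda_H_iff[OF p q a(2)] m_def e by blast
  then have "(\<lambda>n. 1 / frac_const \<beta> * frac_op (Suc l) \<beta> f n) \<in> Lambda_H (\<alpha> - 2 * \<beta>) p q"
    by (rule Lambda_H_cmult[OF p q a(2)])
  moreover have "frac_laplacian \<beta> f = (\<lambda>n. 1 / frac_const \<beta> * frac_op (Suc l) \<beta> f n)"
    unfolding frac_laplacian_def frac_op_def hdiff_def[abs_def] l_def by (simp add: fun_eq_iff)
  ultimately show ?thesis by simp
qed

lemma neg_Lap_pow: "((\<lambda>g n. - Lap g n) ^^ m) f = (\<lambda>n. (-1) ^ m * (Lap ^^ m) f n)"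
  by (induction m) (auto simp: discrete_laplacian_def fun_eq_iff algebra_simps)

lemma laplacian_pow_in_Lambda_H:
  assumes p: "1 \<le> p" and q: "1 \<le> q" and ab: "2 * real m < \<alpha>" and f: "f \<in> Lambda_H \<alpha> p q"
  shows "((\<lambda>g n. - Lap g n) ^^ m) f \<in> Lambda_H (\<alpha> - 2 * real m) p q"
proof -
  have a: "\<alpha> > 0" "\<alpha> - 2 * real m > 0" using ab by linarith+
  define k where "k = nat \<lfloor>\<alpha> / 2\<rfloor> + 1"
  define l where "l = nat \<lfloor>(\<alpha> - 2 * real m) / 2\<rfloor> + 1"
  have w: "wnorm \<alpha> q f < \<infinity>" and h: "heat_norm p q k (\<alpha> / 2) f < \<infinity>"
    using f by (auto simp: Lambda_H_iff[OF p q a(1)] k_def)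
  have fe: "f \<in> expb" by (rule wnorm_expb[OF q a(1) w])
  have e: "(\<alpha> - 2 * real m) / 2 = \<alpha> / 2 - real m" by simp
  \<comment> \<open>Subtracting an integer commutes with the floor, so the orders add up exactly and
    the two heat seminorms are literally equal.\<close>
  have k: "k = m + l" unfolding k_def l_def e using ab by linarith
  then obtain j where j: "k = m + Suc j" by (auto simp: l_def)
  have "wnorm (\<alpha> - 2 * real m) q ((Lap ^^ m) f) < \<infinity>"
    by (rule wnorm_Lap_pow[OF q _ w heat_norm_sup[OF p q fe h, unfolded j]]) (use ab in simp)
  moreover have "heat_norm p q l (\<alpha> / 2 - real m) ((Lap ^^ m) f) = heat_norm p q k (\<alpha> / 2) f"
  proof -
    have "(Lap ^^ l) ((Lap ^^ m) f) = (Lap ^^ k) f" unfolding k add.commute[of m] funpow_add o_def ..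
    moreover have "real l - (\<alpha> / 2 - real m) = real k - \<alpha> / 2" by (simp add: k)
    ultimately show ?thesis by (simp only: heat_norm_def)
  qed
  ultimately have "(Lap ^^ m) f \<in> Lambda_H (\<alpha> - 2 * real m) p q"
    using h unfolding Lambda_H_iff[OF p q a(2)] l_def e by simp
  then show ?thesis unfolding neg_Lap_pow by (rule Lambda_H_cmult[OF p q a(2)])
qed

theorem theorem1p4:
  fixes \<alpha> \<beta> :: real and p q :: ennreal and f :: "int \<Rightarrow> real"
  assumes "\<alpha> > 0" and "\<beta> > 0" and "0 < 2 * \<beta>" and "2 * \<beta> < \<alpha>"
    and "1 \<le> p" and "1 \<le> q"
  shows "(f \<in> Lambda_H \<alpha> p q \<inter> ell \<beta> \<longrightarrow>
           frac_laplacian \<beta> f \<in> Lambda_H (\<alpha> - 2 * \<beta>) p q) \<and>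
         (\<forall>m::nat. 1 \<le> m \<and> \<beta> = real m \<and> f \<in> Lambda_H \<alpha> p q \<longrightarrow>
           ((\<lambda>g n. - discrete_laplacian g n) ^^ m) f \<in> Lambda_H (\<alpha> - 2 * \<beta>) p q)"
  using frac_laplacian_in_Lambda_H[of p q \<beta> \<alpha> f] laplacian_pow_in_Lambda_H[of p q _ \<alpha> f] assms
  by auto

end
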